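(* Let $G$ be a finite group and let $\phi:P_1=\bigoplus_i\mathbb{Z}[G/H_i]\to\bigoplus_j\mathbb{Z}[G/H_j']=P_2$ be an injective homomorphism of $\mathbb{Z}[G]$-permutation modules with finite cokernel. For a finitely generated $\mathbb{Z}[G]$-module $M$ write $(P_k,M)=\mathrm{Hom}_G(P_k,M)$ for $k=1,2$ and $(\phi,M):(P_2,M)\to(P_1,M)$ for the induced map, and let $\mathcal C_\Theta(M)$ be the regulator constant of $M$ with respect to the Brauer relation $\Theta=\sum_iH_i-\sum_jH_j'$. Then the quantity \[ \mathcal C_\Theta(M)\cdot\frac{|\mathrm{coker}(\phi,M)|^2}{|\ker(\phi,M)|^2}\cdot\frac{|(P_2,M)_{\mathrm{tors}}|^2}{|(P_1,M)_{\mathrm{tors}}|^2} \] depends only on the isomorphism class of the $\mathbb{Q}[G]$-module $M\otimes_\mathbb{Z}\mathbb{Q}$.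
   Context: A formal combination $\sum_H n_HH$ of subgroups of $G$ is a Brauer relation if $\bigoplus_H\mathbb{C}[G/H]^{\oplus n_H}=0$ as a virtual representation. For an abelian group $A$, $\overline A=A/A_{\mathrm{tors}}$. Given a finitely generated $\mathbb{Z}[G]$-module $M$, a $G$-invariant bilinear pairing $\langle\cdot,\cdot\rangle:M\times M\to\mathbb{C}$ that is non-degenerate on $\overline M$, and a Brauer relation $\Theta=\sum_Hn_HH$, the regulator constant is $\mathcal C_\Theta(M)=\prod_{H\le G}\det\bigl(\tfrac1{|H|}\langle\cdot,\cdot\rangle|_{\overline{M^H}}\bigr)^{n_H}$, each determinant computed on a $\mathbb{Z}$-basis of $\overline{M^H}$; this is known to be independent of the pairing and to lie in $\mathbb{Q}^\times$. *)

theory Defs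
  imports
    Complex_Main
    "HOL-Algebra.Group_Action"
    "HOL-Algebra.Left_Coset"
    "HOL-Algebra.Generated_Groups"
    "HOL-Algebra.Free_Abelian_Groups"
    "Jordan_Normal_Form.Determinant"
begin

section \<open>Modules over an integral group ring\<close>

text \<open>A \<open>\<int>[G]\<close>-module is an abelian group, written multiplicatively,
  with an action of \<open>G\<close> by group endomorphisms.\<close>

locale gmodule = group_action G "carrier M" \<rho> + comm_group M
  for G :: "('g, 'a) monoid_scheme" and M :: "('m, 'b) monoid_scheme" and \<rho> :: "'g \<Rightarrow> 'm \<Rightarrow> 'm" +
  assumes act_hom: "g \<in> carrier G \<Longrightarrow> \<rho> g \<in> hom M M"

definition finitely_generated_gmodule ::
  "('g, 'a) monoid_scheme \<Rightarrow> ('m, 'b) monoid_scheme \<Rightarrow> ('g \<Rightarrow> 'm \<Rightarrow> 'm) \<Rightarrow> bool" where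
  "finitely_generated_gmodule G M \<rho> \<longleftrightarrow> gmodule G M \<rho> \<and>
     (\<exists>S. finite S \<and> S \<subseteq> carrier M \<and> generate M (\<Union>g\<in>carrier G. \<rho> g ` S) = carrier M)"

definition equivariant ::
  "('g, 'a) monoid_scheme \<Rightarrow> ('m, 'b) monoid_scheme \<Rightarrow> ('g \<Rightarrow> 'm \<Rightarrow> 'm) \<Rightarrow> ('g \<Rightarrow> 'n \<Rightarrow> 'n)
     \<Rightarrow> ('m \<Rightarrow> 'n) \<Rightarrow> bool" where
  "equivariant G M \<rho> \<sigma> f \<longleftrightarrow> (\<forall>g\<in>carrier G. \<forall>x\<in>carrier M. f (\<rho> g x) = \<sigma> g (f x))"

definition Hom_G ::
  "('g, 'a) monoid_scheme \<Rightarrow> ('p, 'b) monoid_scheme \<Rightarrow> ('g \<Rightarrow> 'p \<Rightarrow> 'p)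
     \<Rightarrow> ('m, 'c) monoid_scheme \<Rightarrow> ('g \<Rightarrow> 'm \<Rightarrow> 'm) \<Rightarrow> ('p \<Rightarrow> 'm) monoid" where
  "Hom_G G P \<pi> M \<rho> =
     \<lparr>carrier = {f \<in> hom P M \<inter> extensional (carrier P). equivariant G P \<pi> \<rho> f},
      monoid.mult = (\<lambda>f f'. \<lambda>x\<in>carrier P. f x \<otimes>\<^bsub>M\<^esub> f' x),
      one = (\<lambda>x\<in>carrier P. \<one>\<^bsub>M\<^esub>)\<rparr>"

text \<open>The \<open>G\<close>-module \<open>\<Oplus>\<^sub>i\<^sub>\<in>\<^sub>I \<int>[G/H\<^sub>i]\<close>, where \<open>G\<close> acts on left cosets by left translation.\<close>

definition perm_module ::
  "('g, 'a) monoid_scheme \<Rightarrow> 'i set \<Rightarrow> ('i \<Rightarrow> 'g set) \<Rightarrow> ('i \<Rightarrow> 'g set \<Rightarrow>\<^sub>0 int) monoid" where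
  "perm_module G I H = sum_group I (\<lambda>i. free_Abelian_group (lcosets\<^bsub>G\<^esub> (H i)))"

definition perm_action ::
  "('g, 'a) monoid_scheme \<Rightarrow> 'i set \<Rightarrow> ('i \<Rightarrow> 'g set) \<Rightarrow> 'g
     \<Rightarrow> ('i \<Rightarrow> 'g set \<Rightarrow>\<^sub>0 int) \<Rightarrow> ('i \<Rightarrow> 'g set \<Rightarrow>\<^sub>0 int)" where
  "perm_action G I H g =
     (\<lambda>x\<in>carrier (perm_module G I H). \<lambda>i\<in>I. frag_extend (\<lambda>C. frag_of (g <#\<^bsub>G\<^esub> C)) (x i))"

definition fixed_submodule ::
  "('m, 'b) monoid_scheme \<Rightarrow> ('g \<Rightarrow> 'm \<Rightarrow> 'm) \<Rightarrow> 'g set \<Rightarrow> ('m, 'b) monoid_scheme" where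
  "fixed_submodule M \<rho> H = M\<lparr>carrier := {m \<in> carrier M. \<forall>h\<in>H. \<rho> h m = m}\<rparr>"


section \<open>Torsion and bases of free quotients\<close>

definition torsion :: "('m, 'b) monoid_scheme \<Rightarrow> 'm set" where
  "torsion A = {x \<in> carrier A. \<exists>n::nat. n > 0 \<and> x [^]\<^bsub>A\<^esub> n = \<one>\<^bsub>A\<^esub>}"

definition free_quotient :: "('m, 'b) monoid_scheme \<Rightarrow> 'm set monoid" where
  "free_quotient A = A Mod torsion A"

definition Z_basis :: "('m, 'b) monoid_scheme \<Rightarrow> 'm list \<Rightarrow> bool" where
  "Z_basis A bs \<longleftrightarrow> set bs \<subseteq> carrier A \<and>
     (\<forall>x\<in>carrier A. \<exists>!c::int list. length c = length bs \<and>
        x = finprod A (\<lambda>i. (bs ! i) [^]\<^bsub>A\<^esub> (c ! i)) {..<length bs})"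

text \<open>Bases of \<open>A/A\<^sub>t\<^sub>o\<^sub>r\<^sub>s\<close> are given by representatives in \<open>A\<close>. A biadditive pairing with values
  in \<open>\<complex>\<close> vanishes on torsion, so its Gram matrix does not depend on the representatives.\<close>

definition basis_mod_torsion :: "('m, 'b) monoid_scheme \<Rightarrow> 'm list \<Rightarrow> bool" where
  "basis_mod_torsion A bs \<longleftrightarrow> set bs \<subseteq> carrier A \<and>
     Z_basis (free_quotient A) (map (\<lambda>b. torsion A #>\<^bsub>A\<^esub> b) bs)"


section \<open>Pairings and regulator constants\<close>

definition bilinear_pairing :: "('m, 'b) monoid_scheme \<Rightarrow> ('m \<Rightarrow> 'm \<Rightarrow> complex) \<Rightarrow> bool" where
  "bilinear_pairing A B \<longleftrightarrow> (\<forall>x\<in>carrier A. \<forall>y\<in>carrier A. \<forall>z\<in>carrier A.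
     B (x \<otimes>\<^bsub>A\<^esub> y) z = B x z + B y z \<and> B z (x \<otimes>\<^bsub>A\<^esub> y) = B z x + B z y)"

text \<open>Non-degeneracy refers to the \<open>\<complex>\<close>-bilinear extension of the pairing to
  \<open>(A/A\<^sub>t\<^sub>o\<^sub>r\<^sub>s) \<otimes> \<complex>\<close>. Trivial left and right kernels in \<open>A/A\<^sub>t\<^sub>o\<^sub>r\<^sub>s\<close> itself would not suffice:
  on \<open>\<int>\<^sup>2\<close> the pairing \<open>l(x) l(y)\<close> with \<open>l(x) = x\<^sub>1 + \<surd>2 x\<^sub>2\<close> has trivial kernels, but its Gram
  determinant is zero.\<close>

definition nondegenerate_mod_torsion ::
  "('m, 'b) monoid_scheme \<Rightarrow> ('m \<Rightarrow> 'm \<Rightarrow> complex) \<Rightarrow> bool" where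
  "nondegenerate_mod_torsion A B \<longleftrightarrow> (\<exists>bs. basis_mod_torsion A bs \<and>
     (\<forall>c::nat \<Rightarrow> complex.
        (\<forall>j<length bs. (\<Sum>i<length bs. c i * B (bs ! i) (bs ! j)) = 0) \<longrightarrow>
        (\<forall>i<length bs. c i = 0)) \<and>
     (\<forall>c::nat \<Rightarrow> complex.
        (\<forall>i<length bs. (\<Sum>j<length bs. c j * B (bs ! i) (bs ! j)) = 0) \<longrightarrow>
        (\<forall>j<length bs. c j = 0)))"

definition regulator_pairing ::
  "('g, 'a) monoid_scheme \<Rightarrow> ('m, 'b) monoid_scheme \<Rightarrow> ('g \<Rightarrow> 'm \<Rightarrow> 'm)
     \<Rightarrow> ('m \<Rightarrow> 'm \<Rightarrow> complex) \<Rightarrow> bool" where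
  "regulator_pairing G M \<rho> B \<longleftrightarrow> bilinear_pairing M B \<and>
     (\<forall>g\<in>carrier G. \<forall>x\<in>carrier M. \<forall>y\<in>carrier M. B (\<rho> g x) (\<rho> g y) = B x y) \<and>
     nondegenerate_mod_torsion M B"

text \<open>The determinant of a pairing on \<open>A/A\<^sub>t\<^sub>o\<^sub>r\<^sub>s\<close>. A change of \<open>\<int>\<close>-basis multiplies it by the
  square of a unit of \<open>\<int>\<close>, so the choice of basis is immaterial.\<close>

definition pairing_det :: "('m, 'b) monoid_scheme \<Rightarrow> ('m \<Rightarrow> 'm \<Rightarrow> complex) \<Rightarrow> complex" where
  "pairing_det A B =
     (let bs = (SOME bs. basis_mod_torsion A bs)
      in det (mat (length bs) (length bs) (\<lambda>(i, j). B (bs ! i) (bs ! j))))"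

text \<open>A formal combination \<open>\<Sum>\<^sub>H n\<^sub>H H\<close> of subgroups is represented by \<open>\<Theta> H = n\<^sub>H\<close>.\<close>

definition regulator_constant ::
  "('g, 'a) monoid_scheme \<Rightarrow> ('g set \<Rightarrow> int) \<Rightarrow> ('m, 'b) monoid_scheme \<Rightarrow> ('g \<Rightarrow> 'm \<Rightarrow> 'm)
     \<Rightarrow> ('m \<Rightarrow> 'm \<Rightarrow> complex) \<Rightarrow> complex" where
  "regulator_constant G \<Theta> M \<rho> B =
     (\<Prod>H | subgroup H G.
        pairing_det (fixed_submodule M \<rho> H) (\<lambda>x y. 1 / of_nat (card H) * B x y) powi \<Theta> H)"

text \<open>The formal combination \<open>\<Sum>\<^sub>i H\<^sub>i - \<Sum>\<^sub>j H'\<^sub>j\<close>.\<close>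

definition subgroup_difference ::
  "'i set \<Rightarrow> ('i \<Rightarrow> 'g set) \<Rightarrow> 'j set \<Rightarrow> ('j \<Rightarrow> 'g set) \<Rightarrow> 'g set \<Rightarrow> int" where
  "subgroup_difference I H J H' K =
     int (card {i \<in> I. H i = K}) - int (card {j \<in> J. H' j = K})"


section \<open>Rationalisation\<close>

text \<open>\<open>M \<otimes>\<^sub>\<int> \<rat>\<close> is the free abelian group on \<open>M \<times> \<rat>\<close> modulo the biadditivity relations.\<close>

definition tensor_gens :: "('m, 'b) monoid_scheme \<Rightarrow> ('m \<times> rat \<Rightarrow>\<^sub>0 int) monoid" where
  "tensor_gens M = free_Abelian_group (carrier M \<times> UNIV)"

definition tensor_rels :: "('m, 'b) monoid_scheme \<Rightarrow> ('m \<times> rat \<Rightarrow>\<^sub>0 int) set" where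
  "tensor_rels M = generate (tensor_gens M)
     ({frag_of (x \<otimes>\<^bsub>M\<^esub> y, q) - frag_of (x, q) - frag_of (y, q) | x y q.
         x \<in> carrier M \<and> y \<in> carrier M} \<union>
      {frag_of (x, q + r) - frag_of (x, q) - frag_of (x, r) | x q r. x \<in> carrier M})"

definition tensor_Q :: "('m, 'b) monoid_scheme \<Rightarrow> ('m \<times> rat \<Rightarrow>\<^sub>0 int) set monoid" where
  "tensor_Q M = tensor_gens M Mod tensor_rels M"

text \<open>The endomorphism \<open>f \<otimes> k\<close> of \<open>M \<otimes>\<^sub>\<int> \<rat>\<close>: the image of a coset under the induced map of free
  abelian groups lies in a single coset, which is recovered by adding the relations again.\<close>

definition tensor_map ::
  "('m, 'b) monoid_scheme \<Rightarrow> ('m \<Rightarrow> 'm) \<Rightarrow> (rat \<Rightarrow> rat)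
     \<Rightarrow> ('m \<times> rat \<Rightarrow>\<^sub>0 int) set \<Rightarrow> ('m \<times> rat \<Rightarrow>\<^sub>0 int) set" where
  "tensor_map M f k X =
     tensor_rels M <#>\<^bsub>tensor_gens M\<^esub> (frag_extend (\<lambda>(x, q). frag_of (f x, k q)) ` X)"

definition rationally_isomorphic ::
  "('g, 'a) monoid_scheme \<Rightarrow> ('m, 'b) monoid_scheme \<Rightarrow> ('g \<Rightarrow> 'm \<Rightarrow> 'm)
     \<Rightarrow> ('n, 'c) monoid_scheme \<Rightarrow> ('g \<Rightarrow> 'n \<Rightarrow> 'n) \<Rightarrow> bool" where
  "rationally_isomorphic G M \<rho> N \<sigma> \<longleftrightarrow>
     (\<exists>\<psi>\<in>iso (tensor_Q M) (tensor_Q N).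
        equivariant G (tensor_Q M) (\<lambda>g. tensor_map M (\<rho> g) id) (\<lambda>g. tensor_map N (\<sigma> g) id) \<psi> \<and>
        (\<forall>q. \<forall>X\<in>carrier (tensor_Q M).
           \<psi> (tensor_map M id ((*) q) X) = tensor_map N id ((*) q) (\<psi> X)))"


section \<open>The quantity attached to a map of permutation modules\<close>

definition induced_map ::
  "('p, 'b) monoid_scheme \<Rightarrow> ('p \<Rightarrow> 'q) \<Rightarrow> ('q \<Rightarrow> 'm) \<Rightarrow> 'p \<Rightarrow> 'm" where
  "induced_map P \<phi> f = (\<lambda>x\<in>carrier P. f (\<phi> x))"

definition regulator_quantity ::
  "('g, 'a) monoid_scheme \<Rightarrow> 'i set \<Rightarrow> ('i \<Rightarrow> 'g set) \<Rightarrow> 'j set \<Rightarrow> ('j \<Rightarrow> 'g set)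
     \<Rightarrow> (('i \<Rightarrow> 'g set \<Rightarrow>\<^sub>0 int) \<Rightarrow> ('j \<Rightarrow> 'g set \<Rightarrow>\<^sub>0 int))
     \<Rightarrow> ('m, 'b) monoid_scheme \<Rightarrow> ('g \<Rightarrow> 'm \<Rightarrow> 'm) \<Rightarrow> ('m \<Rightarrow> 'm \<Rightarrow> complex) \<Rightarrow> complex" where
  "regulator_quantity G I H J H' \<phi> M \<rho> B =
     (let P1M = Hom_G G (perm_module G I H) (perm_action G I H) M \<rho>;
          P2M = Hom_G G (perm_module G J H') (perm_action G J H') M \<rho>;
          \<phi>M = induced_map (perm_module G I H) \<phi>
      in regulator_constant G (subgroup_difference I H J H') M \<rho> B
         * ((of_nat (Coset.order (P1M Mod (\<phi>M ` carrier P2M))))\<^sup>2 / (of_nat (card (kernel P2M P1M \<phi>M)))\<^sup>2)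
         * ((of_nat (card (torsion P2M)))\<^sup>2 / (of_nat (card (torsion P1M)))\<^sup>2))"

end

theory Submission
  imports Defs
begin

text \<open>
  For a permutation module \<open>P\<close> with \<open>\<int>\<close>-basis \<open>X\<close> permuted by \<open>G\<close>, put
  \<open>\<langle>f, f'\<rangle>\<^sub>P = 1/|G| \<Sum>\<^sub>x\<^sub>\<in>\<^sub>X \<langle>f x, f' x\<rangle>\<close> on \<open>(P, M)\<close>. Under \<open>(P, M) = \<Oplus>\<^sub>i M\<^sup>H\<^sup>i\<close> this is
  the orthogonal sum of the pairings \<open>1/|H\<^sub>i| \<langle>\<cdot>, \<cdot>\<rangle>\<close>, so the regulator constant is the quotient of
  the determinants of \<open>\<langle>\<cdot>, \<cdot>\<rangle>\<close> on \<open>(P\<^sub>1, M)\<close> and \<open>(P\<^sub>2, M)\<close> modulo torsion. The index and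
  torsion factors are exactly what is needed to replace the determinant on \<open>(P\<^sub>1, M)\<close> by that of the
  pulled back pairing \<open>\<langle>(\<phi>, M) f, (\<phi>, M) f'\<rangle>\<close> on \<open>(P\<^sub>2, M)\<close>. The adjoint of \<open>(\<phi>, M)\<close> is induced by
  the transpose \<open>\<phi>\<^sup>T\<close> of the matrix of \<open>\<phi>\<close>, hence the quantity is the determinant of the endomorphism
  \<open>(\<phi> \<phi>\<^sup>T, M)\<close> of \<open>(P\<^sub>2, M)\<close> modulo torsion. No pairing is left, and the determinant is unchanged
  under \<open>G\<close>-maps \<open>M \<rightarrow> N\<close> and \<open>N \<rightarrow> M\<close> that are mutually inverse up to a nonzero integer; clearing
  denominators in an isomorphism \<open>M \<otimes> \<rat> \<cong> N \<otimes> \<rat>\<close> produces such maps.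
\<close>

section \<open>Lattices modulo torsion\<close>

text \<open>Origin of the factors: let f : A -> B have finite kernel and cokernel, with image C.
  Then [B : C] |C_tors| = |B_tors| |det f|, the determinant being taken modulo torsion, and |A_tors|
  = |C_tors| |ker f|. Hence |det f| = [B : C] |A_tors| / (|B_tors| |ker f|), and a Gram determinant
  sees its square. For f = (phi, M) this square is the factor next to the regulator constant. The
  weight 1/|H_i| is the size of an orbit, |G|/|H_i|, divided by |G|. A sum over the whole permuted
  basis thus normalises both permutation modules alike, and in this form the adjoint is visibly a
  transposed matrix. Torsion shapes the linear algebra: a basis of A/A_tors lifts to A only up to
  torsion, and a map lifted from the rationalisation is at first additive and equivariant only up to
  torsion. Integer-valued coordinate functions are defined on A itself and vanish on torsion, so
  matrices are built from them; lifts are repaired by a power that kills the finite torsion.\<close>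

definition additive_on :: "('m, 'b) monoid_scheme \<Rightarrow> ('m \<Rightarrow> 'r::ab_group_add) \<Rightarrow> bool" where
  "additive_on A l \<longleftrightarrow> (\<forall>x\<in>carrier A. \<forall>y\<in>carrier A. l (x \<otimes>\<^bsub>A\<^esub> y) = l x + l y)"

lemma additive_onD:
  "additive_on A l \<Longrightarrow> x \<in> carrier A \<Longrightarrow> y \<in> carrier A \<Longrightarrow> l (x \<otimes>\<^bsub>A\<^esub> y) = l x + l y"
  by (auto simp: additive_on_def)

lemma additive_on_subset:
  "additive_on A l \<Longrightarrow> C \<subseteq> carrier A \<Longrightarrow> additive_on (A\<lparr>carrier := C\<rparr>) l"
  by (auto simp: additive_on_def)

lemma additive_on_comp:
  "f \<in> hom A B \<Longrightarrow> additive_on B l \<Longrightarrow> additive_on A (\<lambda>x. l (f x))"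
  by (auto simp: additive_on_def hom_def Pi_iff)

context comm_group
begin

lemma additive_on_one: "additive_on G l \<Longrightarrow> l \<one> = 0"
  by (metis additive_onD add_cancel_left_right one_closed r_one)

lemma additive_on_inv:
  assumes "additive_on G l" "x \<in> carrier G"
  shows "l (inv x) = - l x"
  using additive_onD[OF assms(1), of x "inv x"] additive_on_one[OF assms(1)] assms(2)
  by (simp add: eq_neg_iff_add_eq_0 add.commute)

lemma additive_on_nat_pow:
  fixes l :: "'a \<Rightarrow> 'r::ring_1"
  assumes "additive_on G l" "x \<in> carrier G"
  shows "l (x [^] (n::nat)) = of_nat n * l x"
  using assms by (induction n) (auto simp: additive_on_one additive_onD algebra_simps)

lemma additive_on_int_pow:
  fixes l :: "'a \<Rightarrow> 'r::ring_1"
  assumes "additive_on G l" "x \<in> carrier G"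
  shows "l (x [^] (k::int)) = of_int k * l x"
proof (cases k)
  case (neg n)
  have "l (inv (x [^] Suc n)) = - (of_nat (Suc n) * l x)"
    using additive_on_inv[OF assms(1) nat_pow_closed[OF assms(2)]] additive_on_nat_pow[OF assms, of "Suc n"]
    by metis
  then show ?thesis using neg assms(2) by (simp add: int_pow_neg_int del: of_nat_Suc nat_pow_Suc)
qed (use assms in \<open>simp add: int_pow_int additive_on_nat_pow\<close>)

lemma additive_on_finprod:
  assumes "additive_on G l" "finite S" "f \<in> S \<rightarrow> carrier G"
  shows "l (finprod G f S) = (\<Sum>s\<in>S. l (f s))"
  using assms(2,3) by (induction S) (auto simp: additive_on_one[OF assms(1)] additive_onD[OF assms(1)])

text \<open>In a domain of characteristic 0, \<open>of_nat n * l x = 0\<close> with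
  \<open>n > 0\<close> forces \<open>l x = 0\<close>. This is why matrices and Gram determinants may
  be computed on representatives.\<close>

lemma additive_on_torsion:
  fixes l :: "'a \<Rightarrow> 'r::{idom, ring_char_0}"
  assumes "additive_on G l" "x \<in> torsion G"
  shows "l x = 0"
proof -
  obtain n :: nat where n: "n > 0" "x [^] n = \<one>" "x \<in> carrier G"
    using assms(2) by (auto simp: torsion_def)
  then have "of_nat n * l x = 0"
    using additive_on_nat_pow[OF assms(1), of x n] additive_on_one[OF assms(1)] by simp
  then show ?thesis using n by simp
qed

lemma torsionI: "x \<in> carrier G \<Longrightarrow> n > 0 \<Longrightarrow> x [^] (n::nat) = \<one> \<Longrightarrow> x \<in> torsion G"
  by (auto simp: torsion_def)

lemma subgroup_torsion: "subgroup (torsion G) G"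
proof (rule subgroupI)
  show "torsion G \<noteq> {}" using torsionI[of \<one> 1] by auto
next
  fix a assume "a \<in> torsion G"
  then show "inv a \<in> torsion G" by (auto simp: torsion_def nat_pow_inv)
next
  fix a b assume "a \<in> torsion G" "b \<in> torsion G"
  then obtain m n :: nat where mn: "a \<in> carrier G" "b \<in> carrier G" "m > 0" "n > 0" "a [^] m = \<one>" "b [^] n = \<one>"
    by (auto simp: torsion_def)
  have "(a \<otimes> b) [^] (m * n) = a [^] (m * n) \<otimes> b [^] (n * m)"
    using mn by (simp add: pow_mult_distrib m_comm mult.commute)
  also have "\<dots> = (a [^] m) [^] n \<otimes> (b [^] n) [^] m"
    using mn(1,2) by (simp only: nat_pow_pow)
  finally have "(a \<otimes> b) [^] (m * n) = (a [^] m) [^] n \<otimes> (b [^] n) [^] m" .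
  then show "a \<otimes> b \<in> torsion G" using mn by (intro torsionI[of _ "m * n"]) auto
qed (auto simp: torsion_def)

end

text \<open>Here \<open>bs\<close> represents a basis of \<open>A/A\<^sub>t\<^sub>o\<^sub>r\<^sub>s\<close> and \<open>ks\<close> lists its coordinate functions.\<close>

definition dual_basis :: "('m, 'b) monoid_scheme \<Rightarrow> 'm list \<Rightarrow> ('m \<Rightarrow> int) list \<Rightarrow> bool" where
  "dual_basis A bs ks \<longleftrightarrow> set bs \<subseteq> carrier A \<and> length ks = length bs \<and>
     (\<forall>k\<in>set ks. additive_on A k) \<and>
     (\<forall>i<length bs. \<forall>j<length bs. (ks ! i) (bs ! j) = (if i = j then 1 else 0)) \<and>
     (\<forall>x\<in>carrier A. (\<forall>k\<in>set ks. k x = 0) \<longrightarrow> x \<in> torsion A)"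

lemma dual_basisD:
  assumes "dual_basis A bs ks"
  shows "length ks = length bs" "\<And>i. i < length bs \<Longrightarrow> bs ! i \<in> carrier A"
    "\<And>i. i < length bs \<Longrightarrow> additive_on A (ks ! i)"
    "\<And>i j. i < length bs \<Longrightarrow> j < length bs \<Longrightarrow> (ks ! i) (bs ! j) = (if i = j then 1 else 0)"
    "\<And>x. x \<in> carrier A \<Longrightarrow> (\<And>i. i < length bs \<Longrightarrow> (ks ! i) x = 0) \<Longrightarrow> x \<in> torsion A"
proof -
  show "x \<in> torsion A" if "x \<in> carrier A" "\<And>i. i < length bs \<Longrightarrow> (ks ! i) x = 0" for x
  proof -
    have "k x = 0" if "k \<in> set ks" for k
      using that \<open>\<And>i. i < length bs \<Longrightarrow> (ks ! i) x = 0\<close> assms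
      by (auto simp: in_set_conv_nth dual_basis_def)
    then show ?thesis using assms that(1) by (auto simp: dual_basis_def)
  qed
qed (use assms in \<open>auto simp: dual_basis_def dest: nth_mem\<close>)

context comm_group
begin

lemma dual_basis_coord_finprod:
  assumes "dual_basis G bs ks" "i < length bs"
  shows "(ks ! i) (finprod G (\<lambda>j. (bs ! j) [^] (c j :: int)) {..<length bs}) = c i"
proof -
  note D = dual_basisD[OF assms(1)]
  have "(ks ! i) (finprod G (\<lambda>j. (bs ! j) [^] (c j :: int)) {..<length bs})
     = (\<Sum>j<length bs. (ks ! i) ((bs ! j) [^] c j))"
    using D assms(2) by (intro additive_on_finprod) auto
  also have "\<dots> = (\<Sum>j<length bs. c j * (if i = j then 1 else 0))"
    using D assms(2) by (intro sum.cong) (auto simp: additive_on_int_pow)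
  also have "\<dots> = c i"
    using assms(2) by (simp add: if_distrib[of "(*) _"] sum.delta cong: if_cong)
  finally show ?thesis .
qed

text \<open>The element and the product formed from its coordinates have the same coordinates; the
  last clause of \<open>dual_basis\<close> says that elements with vanishing coordinates are
  torsion.\<close>

lemma dual_basis_decomposition:
  assumes "dual_basis G bs ks" "x \<in> carrier G"
  shows "x \<otimes> inv (finprod G (\<lambda>j. (bs ! j) [^] ((ks ! j) x)) {..<length bs}) \<in> torsion G"
proof -
  note D = dual_basisD[OF assms(1)]
  have fc: "finprod G (\<lambda>j. (bs ! j) [^] ((ks ! j) x)) {..<length bs} \<in> carrier G"
    using D by (intro finprod_closed) auto
  show ?thesis
    using fc assms D by (auto intro!: D(5) simp: additive_onD additive_on_inv dual_basis_coord_finprod)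
qed

text \<open>Torsion is invisible to \<open>l\<close>, so the decomposition up to torsion becomes an
  exact formula. It serves for coordinate functions, for either slot of a complex pairing and for
  functionals built from these.\<close>

lemma additive_on_expand:
  fixes l :: "'a \<Rightarrow> 'r::{idom, ring_char_0}"
  assumes "dual_basis G bs ks" "additive_on G l" "x \<in> carrier G"
  shows "l x = (\<Sum>j<length bs. of_int ((ks ! j) x) * l (bs ! j))"
proof -
  note D = dual_basisD[OF assms(1)]
  let ?y = "finprod G (\<lambda>j. (bs ! j) [^] ((ks ! j) x)) {..<length bs}"
  have y: "?y \<in> carrier G" using D by (intro finprod_closed) auto
  have "l (x \<otimes> inv ?y) = 0"
    by (rule additive_on_torsion[OF assms(2) dual_basis_decomposition[OF assms(1,3)]])
  then have "l x = l ?y" using y assms by (simp add: additive_onD additive_on_inv)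
  also have "\<dots> = (\<Sum>j<length bs. l ((bs ! j) [^] ((ks ! j) x)))"
    using D assms by (intro additive_on_finprod) auto
  finally show ?thesis using D assms(2) by (simp add: additive_on_int_pow)
qed

lemma dual_basis_torsion_iff:
  assumes "dual_basis G bs ks"
  shows "x \<in> torsion G \<longleftrightarrow> x \<in> carrier G \<and> (\<forall>i<length bs. (ks ! i) x = 0)"
proof
  assume x: "x \<in> torsion G"
  then show "x \<in> carrier G \<and> (\<forall>i<length bs. (ks ! i) x = 0)"
    using additive_on_torsion[OF dual_basisD(3)[OF assms] x] by (auto simp: torsion_def)
qed (use dual_basisD(5)[OF assms] in blast)

lemma hom_finprod:
  assumes "comm_group B" "f \<in> hom G B" "finite S" "h \<in> S \<rightarrow> carrier G"
  shows "f (finprod G h S) = finprod B (\<lambda>s. f (h s)) S"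
proof -
  interpret B: comm_group B by fact
  show ?thesis
    using assms(3,4)
  proof (induction S)
    case empty
    then show ?case using assms hom_one[OF assms(2)] is_group B.is_group by simp
  next
    case (insert s S)
    then have "(\<lambda>s. f (h s)) \<in> insert s S \<rightarrow> carrier B" using assms(2) by (auto simp: hom_def)
    with insert show ?case using assms(2) by (auto simp: hom_def Pi_iff)
  qed
qed

lemma free_quotient_facts:
  shows "comm_group (free_quotient G)" "(\<lambda>x. torsion G #> x) \<in> hom G (free_quotient G)"
    "carrier (free_quotient G) = (\<lambda>x. torsion G #> x) ` carrier G"
    "\<And>x y. x \<in> carrier G \<Longrightarrow> y \<in> carrier G \<Longrightarrow>
       torsion G #> x = torsion G #> y \<longleftrightarrow> x \<otimes> inv y \<in> torsion G"
proof -
  note st = subgroup_torsion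
  interpret T: normal "torsion G" G using st by (simp add: normal_iff_subgroup)
  show "comm_group (free_quotient G)"
    unfolding free_quotient_def using abelian_FactGroup[OF st] .
  show "(\<lambda>x. torsion G #> x) \<in> hom G (free_quotient G)"
    unfolding free_quotient_def using T.r_coset_hom_Mod .
  show "carrier (free_quotient G) = (\<lambda>x. torsion G #> x) ` carrier G"
    unfolding free_quotient_def carrier_FactGroup ..
  fix x y assume xy: "x \<in> carrier G" "y \<in> carrier G"
  show "torsion G #> x = torsion G #> y \<longleftrightarrow> x \<otimes> inv y \<in> torsion G"
    using xy repr_independence[OF _ _ st, of x y] rcos_self[OF _ st, of x]
      T.rcos_module[OF is_group, of y x] by (metis repr_independence)
qed

lemma free_quotient_finprod:
  assumes "set bs \<subseteq> carrier G"
  shows "finprod (free_quotient G) (\<lambda>i. (map (\<lambda>b. torsion G #> b) bs ! i) [^]\<^bsub>free_quotient G\<^esub> (c i::int)) {..<length bs}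
     = torsion G #> finprod G (\<lambda>i. (bs ! i) [^] c i) {..<length bs}"
proof -
  interpret Q: comm_group "free_quotient G" by (rule free_quotient_facts)
  note h = free_quotient_facts(2)
  have "torsion G #> finprod G (\<lambda>i. (bs ! i) [^] c i) {..<length bs}
     = finprod (free_quotient G) (\<lambda>i. torsion G #> ((bs ! i) [^] c i)) {..<length bs}"
    using assms by (intro hom_finprod[OF Q.comm_group_axioms h]) (auto simp: subset_iff)
  also have "\<dots> = finprod (free_quotient G) (\<lambda>i. (map (\<lambda>b. torsion G #> b) bs ! i) [^]\<^bsub>free_quotient G\<^esub> (c i::int)) {..<length bs}"
    using assms hom_in_carrier[OF h]
    by (intro Q.finprod_cong') (auto simp: subset_iff Pi_iff hom_int_pow[OF h _ is_group Q.is_group])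
  finally show ?thesis by simp
qed

text \<open>Existence of the exponents is the decomposition up to torsion. For uniqueness, the i-th
  coordinate function recovers the i-th exponent, even from an element known only modulo
  torsion.\<close>

lemma dual_basis_imp_basis_mod_torsion:
  assumes "dual_basis G bs ks"
  shows "basis_mod_torsion G bs"
proof -
  note D = dual_basisD[OF assms]
  have bs: "set bs \<subseteq> carrier G" using assms by (auto simp: dual_basis_def)
  let ?t = "\<lambda>x. torsion G #> x"
  let ?p = "\<lambda>c. finprod G (\<lambda>i. (bs ! i) [^] (c ! i :: int)) {..<length bs}"
  have pc: "?p c \<in> carrier G" for c using D by (intro finprod_closed) auto
  have "\<exists>!c::int list. length c = length bs \<and> ?t x = ?t (?p c)" if x: "x \<in> carrier G" for x
  proof (rule ex1I[of _ "map (\<lambda>k. k x) ks"], intro conjI)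
    show "length (map (\<lambda>k. k x) ks) = length bs" using D by simp
    have "?p (map (\<lambda>k. k x) ks) = finprod G (\<lambda>j. (bs ! j) [^] ((ks ! j) x)) {..<length bs}"
      using D by (intro finprod_cong') auto
    then show "?t x = ?t (?p (map (\<lambda>k. k x) ks))"
      using free_quotient_facts(4)[OF x pc[of "map (\<lambda>k. k x) ks"]] dual_basis_decomposition[OF assms x] by simp
  next
    fix c :: "int list" assume c: "length c = length bs \<and> ?t x = ?t (?p c)"
    then have t: "x \<otimes> inv ?p c \<in> torsion G" using free_quotient_facts(4)[OF x pc] by simp
    have "(ks ! i) x = c ! i" if i: "i < length bs" for i
    proof -
      have "(ks ! i) (x \<otimes> inv ?p c) = 0" by (rule additive_on_torsion[OF D(3)[OF i] t])
      then show ?thesis using D(3)[OF i] x pc[of c] dual_basis_coord_finprod[OF assms i, of "\<lambda>i. c ! i"]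
        by (simp add: additive_onD additive_on_inv)
    qed
    then show "c = map (\<lambda>k. k x) ks" using c D by (auto intro: nth_equalityI)
  qed
  then show ?thesis
    unfolding basis_mod_torsion_def Z_basis_def using bs free_quotient_finprod[OF bs]
    by (auto simp: free_quotient_facts(3))
qed

text \<open>The coordinates of \<open>x\<close> are its unique exponents. They are additive by
  uniqueness: the entrywise sum of the exponent lists of \<open>x\<close> and \<open>y\<close>
  represents \<open>x \<otimes> y\<close> modulo torsion.\<close>

lemma basis_mod_torsion_imp_dual_basis:
  assumes "basis_mod_torsion G bs"
  obtains ks where "dual_basis G bs ks"
proof -
  have bs: "set bs \<subseteq> carrier G" using assms by (auto simp: basis_mod_torsion_def)
  let ?t = "\<lambda>x. torsion G #> x"
  let ?n = "length bs"
  define p where "p c = finprod G (\<lambda>i. (bs ! i) [^] (c ! i :: int)) {..<?n}" for c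
  have bc: "i < ?n \<Longrightarrow> bs ! i \<in> carrier G" for i using bs by auto
  have pc: "p c \<in> carrier G" for c unfolding p_def using bc by (intro finprod_closed) auto
  have ex1: "\<exists>!c::int list. length c = ?n \<and> ?t x = ?t (p c)" if "x \<in> carrier G" for x
    using assms that free_quotient_finprod[OF bs] unfolding p_def basis_mod_torsion_def Z_basis_def
    by (auto simp: free_quotient_facts(3))
  define c where "c x = (THE c::int list. length c = ?n \<and> ?t x = ?t (p c))" for x
  have c: "length (c x) = ?n" "?t x = ?t (p (c x))" if "x \<in> carrier G" for x
    using theI'[OF ex1[OF that]] by (auto simp: c_def)
  have cI: "c x = d" if "x \<in> carrier G" "length d = ?n" "?t x = ?t (p d)" for x d
    unfolding c_def using ex1[OF that(1)] that by (intro the1_equality) auto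
  interpret Q: comm_group "free_quotient G" by (rule free_quotient_facts)
  note h = free_quotient_facts(2)
  define ks where "ks = map (\<lambda>i x. c x ! i) [0..<?n]"
  have ks: "i < ?n \<Longrightarrow> (ks ! i) x = c x ! i" for i x by (simp add: ks_def)
  have add: "c (x \<otimes> y) = map2 (+) (c x) (c y)" if xy: "x \<in> carrier G" "y \<in> carrier G" for x y
  proof (rule cI)
    have "p (map2 (+) (c x) (c y)) = finprod G (\<lambda>i. (bs ! i) [^] (c x ! i) \<otimes> (bs ! i) [^] (c y ! i)) {..<?n}"
      unfolding p_def using c[OF xy(1)] c[OF xy(2)] bc by (intro finprod_cong') (auto simp: int_pow_mult)
    also have "\<dots> = p (c x) \<otimes> p (c y)"
      unfolding p_def using bc by (intro finprod_multf) auto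
    finally show "?t (x \<otimes> y) = ?t (p (map2 (+) (c x) (c y)))"
      using h pc xy c(2)[OF xy(1)] c(2)[OF xy(2)] by (simp add: hom_mult)
  qed (use c xy in auto)
  have "dual_basis G bs ks"
    unfolding dual_basis_def
  proof (intro conjI ballI allI impI)
    fix k assume "k \<in> set ks"
    then obtain i where i: "i < ?n" "k = (\<lambda>x. c x ! i)" by (auto simp: ks_def)
    show "additive_on G k" unfolding additive_on_def using i c by (auto simp: add)
  next
    fix i j assume ij: "i < ?n" "j < ?n"
    let ?d = "map (\<lambda>l. if l = j then 1 else 0 :: int) [0..<?n]"
    have "p ?d = finprod G (\<lambda>l. if l = j then bs ! l else \<one>) {..<?n}"
      unfolding p_def using bc by (intro finprod_cong') auto
    also have "\<dots> = bs ! j" using ij bc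
      by (subst finprod_singleton_swap[of j "{..<?n}" "\<lambda>l. bs ! l"]) (auto simp: Pi_iff)
    finally have "c (bs ! j) = ?d" using bc ij by (intro cI) auto
    then show "(ks ! i) (bs ! j) = (if i = j then 1 else 0)" using ij ks by simp
  next
    fix x assume x: "x \<in> carrier G" "\<forall>k\<in>set ks. k x = 0"
    have "p (c x) = finprod G (\<lambda>i. \<one>) {..<?n}"
      unfolding p_def using x by (intro finprod_cong') (auto simp: ks_def)
    then have "?t x = ?t \<one>" using c(2)[OF x(1)] by simp
    then show "x \<in> torsion G" using free_quotient_facts(4)[OF x(1) one_closed] x by simp
  qed (use bs in \<open>auto simp: ks_def\<close>)
  then show ?thesis using that by blast
qed

end

section \<open>Matrices of functionals, Gram matrices and base change\<close>

definition coord_mat :: "('m \<Rightarrow> 'r) list \<Rightarrow> 'm list \<Rightarrow> 'r mat" where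
  "coord_mat ls ys = mat (length ls) (length ys) (\<lambda>(i, j). (ls ! i) (ys ! j))"

definition gram :: "('m \<Rightarrow> 'm \<Rightarrow> 'r) \<Rightarrow> 'm list \<Rightarrow> 'm list \<Rightarrow> 'r mat" where
  "gram F xs ys = mat (length xs) (length ys) (\<lambda>(i, j). F (xs ! i) (ys ! j))"

lemma coord_mat_carrier [simp]: "coord_mat ls ys \<in> carrier_mat (length ls) (length ys)"
  by (simp add: coord_mat_def)

lemma gram_carrier [simp]: "gram F xs ys \<in> carrier_mat (length xs) (length ys)"
  by (simp add: gram_def)

text \<open>This is \<open>additive_on_expand\<close> in matrix form. With \<open>ls\<close> the
  coordinates precomposed with a homomorphism, it says that matrices of composed homomorphisms
  multiply.\<close>

lemma (in comm_group) coord_mat_expand: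
  fixes ls :: "('a \<Rightarrow> int) list"
  assumes "dual_basis G bs ks" "\<forall>l\<in>set ls. additive_on G l" "set ys \<subseteq> carrier G"
  shows "coord_mat ls ys = coord_mat ls bs * coord_mat ks ys"
proof (rule eq_matI)
  fix i j assume "i < dim_row (coord_mat ls bs * coord_mat ks ys)"
    "j < dim_col (coord_mat ls bs * coord_mat ks ys)"
  then have ij: "i < length ls" "j < length ys" by (auto simp: coord_mat_def)
  have "(ls ! i) (ys ! j) = (\<Sum>k<length bs. of_int ((ks ! k) (ys ! j)) * (ls ! i) (bs ! k))"
    using assms ij by (intro additive_on_expand) auto
  then show "coord_mat ls ys $$ (i, j) = (coord_mat ls bs * coord_mat ks ys) $$ (i, j)"
    using ij dual_basisD(1)[OF assms(1)]
    by (simp add: coord_mat_def scalar_prod_def lessThan_atLeast0 mult.commute)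
qed (auto simp: coord_mat_def)

lemma (in comm_group) gram_expand_right:
  fixes F :: "'a \<Rightarrow> 'a \<Rightarrow> complex"
  assumes "dual_basis G bs ks" "bilinear_pairing G F" "set xs \<subseteq> carrier G" "set ys \<subseteq> carrier G"
  shows "gram F xs ys = gram F xs bs * map_mat of_int (coord_mat ks ys)"
proof (rule eq_matI)
  fix i j assume "i < dim_row (gram F xs bs * map_mat of_int (coord_mat ks ys))"
    "j < dim_col (gram F xs bs * map_mat of_int (coord_mat ks ys))"
  then have ij: "i < length xs" "j < length ys" by (auto simp: coord_mat_def gram_def)
  have "xs ! i \<in> carrier G" using assms ij by auto
  then have "additive_on G (F (xs ! i))" using assms(2) by (auto simp: additive_on_def bilinear_pairing_def)
  then have "F (xs ! i) (ys ! j) = (\<Sum>k<length bs. of_int ((ks ! k) (ys ! j)) * F (xs ! i) (bs ! k))"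
    using assms ij by (intro additive_on_expand) auto
  then show "gram F xs ys $$ (i, j) = (gram F xs bs * map_mat of_int (coord_mat ks ys)) $$ (i, j)"
    using ij dual_basisD(1)[OF assms(1)]
    by (simp add: coord_mat_def gram_def scalar_prod_def lessThan_atLeast0 mult.commute)
qed (auto simp: coord_mat_def gram_def)

lemma gram_transpose: "transpose_mat (gram F xs ys) = gram (\<lambda>x y. F y x) ys xs"
  by (intro eq_matI) (auto simp: gram_def)

lemma (in comm_group) gram_expand_left:
  fixes F :: "'a \<Rightarrow> 'a \<Rightarrow> complex"
  assumes "dual_basis G bs ks" "bilinear_pairing G F" "set xs \<subseteq> carrier G" "set ys \<subseteq> carrier G"
  shows "gram F ys xs = transpose_mat (map_mat of_int (coord_mat ks ys)) * gram F bs xs"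
proof -
  have "gram F ys xs = transpose_mat (gram (\<lambda>x y. F y x) xs ys)" by (simp add: gram_transpose)
  also have "gram (\<lambda>x y. F y x) xs ys = gram (\<lambda>x y. F y x) xs bs * map_mat of_int (coord_mat ks ys)"
    using assms by (intro gram_expand_right) (auto simp: bilinear_pairing_def)
  also have "transpose_mat \<dots> = transpose_mat (map_mat of_int (coord_mat ks ys)) * transpose_mat (gram (\<lambda>x y. F y x) xs bs)"
    using dual_basisD(1)[OF assms(1)] by (intro transpose_mult[of _ "length xs" "length bs" _ "length ys"]) (auto simp: coord_mat_def gram_def)
  finally show ?thesis by (simp add: gram_transpose)
qed

text \<open>Base change by \<open>U\<close> turns a Gram matrix \<open>S\<close> into the congruent
  matrix \<open>U^T S U\<close>, whence the square. When \<open>ys\<close> is a basis of a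
  sublattice, the factor measures its index.\<close>

lemma (in comm_group) det_gram_expand:
  fixes F :: "'a \<Rightarrow> 'a \<Rightarrow> complex"
  assumes "dual_basis G bs ks" "bilinear_pairing G F" "set ys \<subseteq> carrier G" "length ys = length bs"
  shows "det (gram F ys ys) = (of_int (det (coord_mat ks ys)))\<^sup>2 * det (gram F bs bs)"
proof -
  let ?n = "length bs" and ?U = "map_mat of_int (coord_mat ks ys) :: complex mat"
  have bs: "set bs \<subseteq> carrier G" using assms(1) by (auto simp: dual_basis_def)
  have U: "?U \<in> carrier_mat ?n ?n" using dual_basisD(1)[OF assms(1)] assms(4) by (auto simp: coord_mat_def)
  have g: "gram F bs bs \<in> carrier_mat ?n ?n" by simp
  have "gram F ys ys = transpose_mat ?U * gram F bs ys" using assms by (intro gram_expand_left) auto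
  also have "gram F bs ys = gram F bs bs * ?U" using assms bs by (intro gram_expand_right) auto
  finally have "det (gram F ys ys) = det (transpose_mat ?U * (gram F bs bs * ?U))" by simp
  also have "\<dots> = det ?U * (det (gram F bs bs) * det ?U)"
    using det_mult[OF transpose_carrier_mat[THEN iffD2, OF U] mult_carrier_mat[OF g U]] det_mult[OF g U]
      det_transpose[OF U] by simp
  also have "det ?U = of_int (det (coord_mat ks ys))" by (rule of_int_hom.hom_det)
  finally show ?thesis by (simp add: power2_eq_square)
qed

section \<open>Homomorphisms invertible up to an integer\<close>

lemma square_of_mutual_inverse:
  fixes F F' :: "int mat"
  assumes "F \<in> carrier_mat m n" "F' \<in> carrier_mat n m" "k \<noteq> 0"
    "F * F' = k \<cdot>\<^sub>m 1\<^sub>m m" "F' * F = k \<cdot>\<^sub>m 1\<^sub>m n"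
  shows "m = n"
proof -
  \<comment> \<open>Both products have the same trace.\<close>
  have "int m * k = (\<Sum>i<m. (F * F') $$ (i, i))" using assms by simp
  also have "\<dots> = (\<Sum>i<m. \<Sum>j<n. F $$ (i, j) * F' $$ (j, i))"
    using assms(1,2) by (intro sum.cong) (auto simp: scalar_prod_def lessThan_atLeast0)
  also have "\<dots> = (\<Sum>j<n. \<Sum>i<m. F' $$ (j, i) * F $$ (i, j))"
    by (subst sum.swap) (simp add: mult.commute)
  also have "\<dots> = (\<Sum>j<n. (F' * F) $$ (j, j))"
    using assms(1,2) by (intro sum.cong) (auto simp: scalar_prod_def lessThan_atLeast0)
  also have "\<dots> = int n * k" using assms by simp
  finally show ?thesis using assms(3) by simp
qed

text \<open>In additive notation the two maps are inverse to each other up to the integer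
  \<open>k\<close>: an isomorphism after tensoring with the rationals, expressed without tensoring.
  The notion covers \<open>(phi, M)\<close>, the maps between \<open>M\<close> and \<open>N\<close>,
  and base change, where both maps are the identity and \<open>k = 1\<close>.\<close>

definition isogeny :: "('a, 'c) monoid_scheme \<Rightarrow> ('b, 'd) monoid_scheme \<Rightarrow> ('a \<Rightarrow> 'b) \<Rightarrow> ('b \<Rightarrow> 'a) \<Rightarrow> nat \<Rightarrow> bool" where
  "isogeny A B f f' k \<longleftrightarrow> comm_group A \<and> comm_group B \<and> f \<in> hom A B \<and> f' \<in> hom B A \<and> k > 0 \<and>
     (\<forall>x\<in>carrier A. f' (f x) = x [^]\<^bsub>A\<^esub> k) \<and> (\<forall>y\<in>carrier B. f (f' y) = y [^]\<^bsub>B\<^esub> k)"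

lemma isogeny_sym: "isogeny A B f f' k \<Longrightarrow> isogeny B A f' f k"
  by (auto simp: isogeny_def)

text \<open>The product is the matrix of the composition, which is the \<open>k\<close>-th power
  map; additive coordinates see it as multiplication by \<open>k\<close>.\<close>

lemma isogeny_coord_mat_mult:
  assumes "isogeny A B f f' k" "dual_basis A as ls" "dual_basis B bs ks"
  shows "coord_mat ls (map f' bs) * coord_mat ks (map f as) = int k \<cdot>\<^sub>m 1\<^sub>m (length as)"
proof -
  interpret A: comm_group A using assms(1) by (simp add: isogeny_def)
  interpret B: comm_group B using assms(1) by (simp add: isogeny_def)
  note f = assms(1)[unfolded isogeny_def]
  note DA = dual_basisD[OF assms(2)] and DB = dual_basisD[OF assms(3)]
  let ?ls = "map (\<lambda>l x. l (f' x)) ls"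
  have "coord_mat ls (map f' bs) = coord_mat ?ls bs" by (intro eq_matI) (auto simp: coord_mat_def)
  also have "\<dots> * coord_mat ks (map f as) = coord_mat ?ls (map f as)"
  proof (rule B.coord_mat_expand[OF assms(3), symmetric])
    have f': "f' \<in> hom B A" using f by blast
    show "\<forall>l\<in>set ?ls. additive_on B l"
      using assms(2) additive_on_comp[OF f'] by (auto simp: dual_basis_def)
    show "set (map f as) \<subseteq> carrier B"
      using assms(2) f by (auto simp: dual_basis_def dest: hom_in_carrier)
  qed
  also have "\<dots> = int k \<cdot>\<^sub>m 1\<^sub>m (length as)"
  proof (rule eq_matI)
    fix i j assume "i < dim_row (int k \<cdot>\<^sub>m 1\<^sub>m (length as))" "j < dim_col (int k \<cdot>\<^sub>m 1\<^sub>m (length as))"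
    then have ij: "i < length as" "j < length as" by auto
    then have "(ls ! i) (f' (f (as ! j))) = int k * (ls ! i) (as ! j)"
      using f DA by (simp add: A.additive_on_nat_pow)
    then show "coord_mat ?ls (map f as) $$ (i, j) = (int k \<cdot>\<^sub>m 1\<^sub>m (length as)) $$ (i, j)"
      using ij DA by (simp add: coord_mat_def)
  qed (use DA in \<open>auto simp: coord_mat_def\<close>)
  finally show ?thesis .
qed

text \<open>The two matrices are inverse to each other up to \<open>k\<close> in either order.
  Traces give equal ranks, so determinants make sense; these multiply to a power of
  \<open>k\<close>, which is nonzero.\<close>

lemma isogeny_rank_eq:
  assumes "isogeny A B f f' k" "dual_basis A as ls" "dual_basis B bs ks"
  shows "length as = length bs" "det (coord_mat ks (map f as)) \<noteq> 0"
    "det (coord_mat ls (map f' bs)) * det (coord_mat ks (map f as)) = int k ^ length as"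
proof -
  note l = dual_basisD(1)[OF assms(2)] dual_basisD(1)[OF assms(3)]
  have k: "k > 0" using assms(1) by (simp add: isogeny_def)
  note m = isogeny_coord_mat_mult[OF assms] isogeny_coord_mat_mult[OF isogeny_sym[OF assms(1)] assms(3,2)]
  show eq: "length as = length bs"
    using l k by (intro square_of_mutual_inverse[OF _ _ _ m]) (auto simp: coord_mat_def)
  have c: "coord_mat ls (map f' bs) \<in> carrier_mat (length as) (length as)"
     "coord_mat ks (map f as) \<in> carrier_mat (length as) (length as)"
    using l eq by (auto simp: coord_mat_def)
  show *: "det (coord_mat ls (map f' bs)) * det (coord_mat ks (map f as)) = int k ^ length as"
    using det_mult[OF c] m(1) by simp
  show "det (coord_mat ks (map f as)) \<noteq> 0" using * k by auto
qed

lemma (in comm_group) isogeny_id: "isogeny G G (\<lambda>x. x) (\<lambda>x. x) 1"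
  by (auto simp: isogeny_def comm_group_axioms hom_def)

text \<open>The identity is an isogeny with \<open>k = 1\<close>, so the determinant of the base
  change divides 1. Only its square enters.\<close>

lemma (in comm_group) det_gram_basis_independent:
  assumes "dual_basis G as ls" "dual_basis G bs ks" "bilinear_pairing G F"
  shows "det (gram F as as) = det (gram F bs bs)"
proof -
  note r = isogeny_rank_eq[OF isogeny_id assms(1,2)]
  have "det (coord_mat ls bs) * det (coord_mat ks as) = 1" using r(3) by simp
  then have "is_unit (det (coord_mat ks as))" by (metis dvd_triv_right)
  then have "(det (coord_mat ks as))\<^sup>2 = 1" by (simp add: zdvd1_eq power2_eq_1_iff abs_if split: if_splits)
  then have "(of_int (det (coord_mat ks as)))\<^sup>2 = (1::complex)" by (metis of_int_1 of_int_power)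
  then show ?thesis
    using det_gram_expand[OF assms(2,3), of as] assms(1) r(1) by (auto simp: dual_basis_def)
qed

text \<open>Replaces the arbitrary basis that \<open>SOME\<close> selects in
  \<open>pairing_det\<close> by whichever basis is at hand.\<close>

lemma (in comm_group) pairing_det_eq_det_gram:
  assumes "dual_basis G bs ks" "bilinear_pairing G F"
  shows "pairing_det G F = det (gram F bs bs)"
proof -
  define as where "as = (SOME as. basis_mod_torsion G as)"
  have "basis_mod_torsion G as"
    unfolding as_def using dual_basis_imp_basis_mod_torsion[OF assms(1)] by (rule someI)
  then obtain ls where "dual_basis G as ls" by (rule basis_mod_torsion_imp_dual_basis)
  then show ?thesis
    using det_gram_basis_independent[OF _ assms] by (simp add: pairing_det_def as_def Let_def gram_def)
qed

section \<open>Existence of bases and the covolume formula\<close>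

lemma (in group) torsion_subgroup_eq: "torsion (G\<lparr>carrier := C\<rparr>) = {x \<in> C. \<exists>n::nat. n > 0 \<and> x [^] n = \<one>}"
  by (auto simp: torsion_def nat_pow_consistent[symmetric])

lemma (in group) torsion_subgroup:
  assumes "C \<subseteq> carrier G"
  shows "torsion (G\<lparr>carrier := C\<rparr>) = torsion G \<inter> C"
  using assms by (auto simp: torsion_subgroup_eq) (auto simp: torsion_def)

lemma (in comm_group) comm_group_subgroup: "subgroup C G \<Longrightarrow> comm_group (G\<lparr>carrier := C\<rparr>)"
  by (rule group.group_comm_groupI[OF subgroup_imp_group]) (auto dest: subgroup.subset intro: m_comm)

lemma (in comm_group) subgroup_additive_kernel:
  assumes "additive_on G k"
  shows "subgroup {x \<in> carrier G. k x = 0} G"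
  using assms by (intro subgroupI) (auto simp: additive_on_inv additive_onD additive_on_one intro: exI[of _ \<one>])

text \<open>The element \<open>v\<close> splits off the kernel of \<open>k\<close>: dividing
  \<open>x\<close> by the power of \<open>v\<close> with exponent \<open>k x div d\<close> leaves an
  element of that kernel, where the coordinates \<open>ls\<close> are available. The division by
  \<open>d\<close> is exact because \<open>d\<close> divides every value of
  \<open>k\<close>.\<close>

lemma (in comm_group) dual_basis_Cons:
  fixes k :: "'a \<Rightarrow> int"
  assumes k: "additive_on G k" and v: "v \<in> carrier G" "k v = d" "d > 0" "\<And>x. x \<in> carrier G \<Longrightarrow> d dvd k x"
    and db: "dual_basis (G\<lparr>carrier := {x \<in> carrier G. k x = 0}\<rparr>) bs ls"
  shows "dual_basis G (v # bs) ((\<lambda>x. k x div d) # map (\<lambda>l x. l (x \<otimes> inv (v [^] (k x div d)))) ls)"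
proof -
  let ?K = "{x \<in> carrier G. k x = 0}"
  note D = dual_basisD[OF db]
  have bs: "set bs \<subseteq> ?K" using db by (simp add: dual_basis_def)
  define r where "r x = x \<otimes> inv (v [^] (k x div d))" for x
  have r: "r x \<in> ?K" if "x \<in> carrier G" for x
    using that v k by (auto simp: r_def additive_onD additive_on_inv additive_on_int_pow)
  have kd: "k (x \<otimes> y) div d = k x div d + k y div d" if "x \<in> carrier G" "y \<in> carrier G" for x y
    using that v(4) k by (simp add: additive_onD)
  have radd: "r (x \<otimes> y) = r x \<otimes> r y" if "x \<in> carrier G" "y \<in> carrier G" for x y
    unfolding r_def kd[OF that] using that v(1) by (simp add: int_pow_mult inv_mult m_ac)
  have rK: "r x = x" if "x \<in> ?K" for x using that v by (simp add: r_def)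
  have rv: "r v = \<one>" using v by (simp add: r_def)
  show ?thesis
    unfolding r_def[symmetric] dual_basis_def
  proof (intro conjI ballI allI impI)
    show "set (v # bs) \<subseteq> carrier G" using v bs by auto
    show "length ((\<lambda>x. k x div d) # map (\<lambda>l x. l (r x)) ls) = length (v # bs)" using D by simp
  next
    fix l assume "l \<in> set ((\<lambda>x. k x div d) # map (\<lambda>l x. l (r x)) ls)"
    then consider "l = (\<lambda>x. k x div d)" | l' where "l' \<in> set ls" "l = (\<lambda>x. l' (r x))" by auto
    then show "additive_on G l"
    proof cases
      case 1
      then show ?thesis using kd by (simp add: additive_on_def)
    next
      case 2
      then have "additive_on (G\<lparr>carrier := ?K\<rparr>) l'" using db by (auto simp: dual_basis_def)
      then show ?thesis using 2 r radd by (auto simp: additive_on_def)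
    qed
  next
    fix i j assume ij: "i < length (v # bs)" "j < length (v # bs)"
    have b: "bs ! j \<in> ?K" if "j < length bs" for j using bs nth_mem[OF that] by blast
    have l1: "l \<one> = 0" if "l \<in> set ls" for l
    proof -
      have "additive_on (G\<lparr>carrier := ?K\<rparr>) l" using db that by (auto simp: dual_basis_def)
      then have "l (\<one> \<otimes> \<one>) = l \<one> + l \<one>"
        using r[OF v(1)] rv additive_onD[of "G\<lparr>carrier := ?K\<rparr>" l \<one> \<one>] by (simp del: r_one l_one)
      then show ?thesis by simp
    qed
    show "(((\<lambda>x. k x div d) # map (\<lambda>l x. l (r x)) ls) ! i) ((v # bs) ! j) = (if i = j then 1 else 0)"
      using ij v D b by (cases i; cases j) (auto simp: rK rv l1)
  next
    fix x assume x: "x \<in> carrier G" and 0: "\<forall>l\<in>set ((\<lambda>x. k x div d) # map (\<lambda>l x. l (r x)) ls). l x = 0"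
    have "k x = 0" using dvd_div_mult_self[OF v(4)[OF x]] 0 by auto
    then have "r x = x" using x rK by auto
    then have "x \<in> torsion (G\<lparr>carrier := ?K\<rparr>)" using 0 x \<open>k x = 0\<close> db by (auto simp: dual_basis_def)
    then show "x \<in> torsion G" by (subst (asm) torsion_subgroup) auto
  qed
qed

text \<open>The values of \<open>k\<close> form a nonzero subgroup of the integers. Its least
  positive element divides all others, because the remainder on division by it is again a
  value.\<close>

lemma (in comm_group) additive_image_generator:
  fixes k :: "'a \<Rightarrow> int"
  assumes k: "additive_on G k" and "w \<in> carrier G" "k w \<noteq> 0"
  obtains v where "v \<in> carrier G" "k v > 0" "\<And>x. x \<in> carrier G \<Longrightarrow> k v dvd k x"
proof -
  define S where "S = {n::nat. n > 0 \<and> (\<exists>x\<in>carrier G. k x = int n)}"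
  have "S \<noteq> {}"
  proof (cases "k w > 0")
    case True
    then have "nat (k w) \<in> S" using assms by (auto simp: S_def)
    then show ?thesis by auto
  next
    case False
    then have "nat (- k w) \<in> S" using assms by (auto simp: S_def additive_on_inv intro!: bexI[of _ "inv w"])
    then show ?thesis by auto
  qed
  then have "Least (\<lambda>n. n \<in> S) \<in> S" by (metis LeastI ex_in_conv)
  then obtain v where v: "v \<in> carrier G" "k v = int (Least (\<lambda>n. n \<in> S))" "k v > 0" by (auto simp: S_def)
  have "k v dvd k x" if x: "x \<in> carrier G" for x
  proof (rule ccontr)
    assume n: "\<not> k v dvd k x"
    let ?y = "x \<otimes> inv (v [^] (k x div k v))"
    have y: "k ?y = k x mod k v"
      using x v(1) k by (simp add: additive_onD additive_on_inv additive_on_int_pow minus_div_mult_eq_mod)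
    have "k x mod k v > 0" "k x mod k v < k v"
      using n v(3) pos_mod_bound[OF v(3), of "k x"] pos_mod_sign[OF v(3), of "k x"] by (simp_all add: dvd_eq_mod_eq_0)
    then have "nat (k x mod k v) \<in> S" using y x v by (auto simp: S_def intro!: bexI[of _ ?y])
    then have "Least (\<lambda>n. n \<in> S) \<le> nat (k x mod k v)" by (rule Least_le)
    then show False using v \<open>k x mod k v < k v\<close> \<open>k x mod k v > 0\<close> by linarith
  qed
  then show ?thesis using that v by blast
qed

text \<open>Functionals whose common kernel is torsion embed \<open>A\<close> modulo torsion into a
  power of the integers, and subgroups of such a power are free: one functional is split off at a
  time. The use is for the invariants under a subgroup, on which the coordinates of \<open>M\<close>
  are functionals of this kind.\<close>

lemma exists_dual_basis:
  fixes ks :: "('m \<Rightarrow> int) list" and A :: "('m, 'b) monoid_scheme"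
  assumes "comm_group A" "\<forall>k\<in>set ks. additive_on A k"
    "\<forall>x\<in>carrier A. (\<forall>k\<in>set ks. k x = 0) \<longrightarrow> x \<in> torsion A"
  shows "\<exists>bs ls. dual_basis A bs ls"
  using assms
proof (induction ks arbitrary: A)
  case Nil
  then have "dual_basis A [] []" by (auto simp: dual_basis_def)
  then show ?case by blast
next
  case (Cons k ks)
  interpret A: comm_group A by fact
  let ?K = "{x \<in> carrier A. k x = 0}"
  let ?A = "A\<lparr>carrier := ?K\<rparr>"
  have k: "additive_on A k" using Cons by simp
  have "\<exists>bs ls. dual_basis ?A bs ls"
  proof (rule Cons.IH)
    show "comm_group ?A" by (rule A.comm_group_subgroup[OF A.subgroup_additive_kernel[OF k]])
    show "\<forall>k'\<in>set ks. additive_on ?A k'" using Cons.prems by (auto intro: additive_on_subset)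
    have "torsion ?A = torsion A \<inter> ?K" by (rule A.torsion_subgroup) auto
    then show "\<forall>x\<in>carrier ?A. (\<forall>k'\<in>set ks. k' x = 0) \<longrightarrow> x \<in> torsion ?A"
      using Cons.prems(3) by auto
  qed
  then obtain bs ls where db: "dual_basis ?A bs ls" by blast
  show ?case
  proof (cases "\<exists>w\<in>carrier A. k w \<noteq> 0")
    case True
    then obtain v where "v \<in> carrier A" "k v > 0" "\<And>x. x \<in> carrier A \<Longrightarrow> k v dvd k x"
      using A.additive_image_generator[OF k] by metis
    then show ?thesis using A.dual_basis_Cons[OF k _ refl _ _ db, of v] by blast
  next
    \<comment> \<open>A functional that vanishes identically contributes no basis element and is
      dropped.\<close>
    case False
    then have K: "?K = carrier A" by auto
    have "?A = A" unfolding K by simp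
    then show ?thesis using db by metis
  qed
qed

section \<open>Counting cosets and the index of a sublattice\<close>

lemma (in group) card_rcosets_eq_transversal:
  assumes "subgroup C G" "R \<subseteq> carrier G" "\<And>x. x \<in> carrier G \<Longrightarrow> \<exists>!r. r \<in> R \<and> x \<otimes> inv r \<in> C"
  shows "card (rcosets C) = card R"
proof -
  interpret C: subgroup C G by fact
  have mem: "x \<in> C #> r \<longleftrightarrow> x \<otimes> inv r \<in> C" if "x \<in> carrier G" "r \<in> carrier G" for x r
    using C.rcos_module[OF is_group that(2,1)] .
  have "bij_betw (\<lambda>r. C #> r) R (rcosets C)"
    unfolding bij_betw_def
  proof
    show "inj_on (\<lambda>r. C #> r) R"
    proof (rule inj_onI)
      fix r s assume rs: "r \<in> R" "s \<in> R" "C #> r = C #> s"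
      then have c: "r \<in> carrier G" "s \<in> carrier G" using assms(2) by auto
      then have "r \<otimes> inv s \<in> C" "r \<otimes> inv r \<in> C"
        using rcos_self[OF c(1) assms(1)] mem[OF c] rs(3) by auto
      then show "r = s" using assms(3)[of r] rs assms(2) by auto
    qed
    show "(\<lambda>r. C #> r) ` R = rcosets C"
    proof
      show "(\<lambda>r. C #> r) ` R \<subseteq> rcosets C" using assms(2) by (auto simp: RCOSETS_def)
      show "rcosets C \<subseteq> (\<lambda>r. C #> r) ` R"
      proof
        fix X assume "X \<in> rcosets C"
        then obtain x where x: "x \<in> carrier G" "X = C #> x" by (auto simp: RCOSETS_def)
        obtain r where "r \<in> R" "x \<otimes> inv r \<in> C" using assms(3)[OF x(1)] by blast
        then show "X \<in> (\<lambda>r. C #> r) ` R"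
          using x repr_independence[of x C r] assms(1) subsetD[OF assms(2)] mem[of x r] by blast
      qed
    qed
  qed
  then show ?thesis by (metis bij_betw_same_card)
qed

lemma (in group) exists_transversal:
  assumes "subgroup C G"
  obtains R where "R \<subseteq> carrier G" "\<And>x. x \<in> carrier G \<Longrightarrow> \<exists>!r. r \<in> R \<and> x \<otimes> inv r \<in> C"
proof -
  interpret C: subgroup C G by fact
  define c where "c X = (SOME x. x \<in> carrier G \<and> X = C #> x)" for X
  have c: "c X \<in> carrier G" "X = C #> c X" if "X \<in> rcosets C" for X
    using that someI_ex[of "\<lambda>x. x \<in> carrier G \<and> X = C #> x"] by (auto simp: c_def RCOSETS_def)
  have mem: "x \<otimes> inv r \<in> C \<longleftrightarrow> C #> x = C #> r" if "x \<in> carrier G" "r \<in> carrier G" for x r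
    using C.rcos_module[OF is_group that(2,1)] repr_independence[OF _ that(2) assms]
      rcos_self[OF that(1) assms] by metis
  show ?thesis
  proof (rule that[of "c ` (rcosets C)"])
    show "c ` (rcosets C) \<subseteq> carrier G" using c by auto
    fix x assume x: "x \<in> carrier G"
    then have X: "C #> x \<in> rcosets C" by (auto simp: RCOSETS_def)
    show "\<exists>!r. r \<in> c ` (rcosets C) \<and> x \<otimes> inv r \<in> C"
    proof (rule ex1I[of _ "c (C #> x)"])
      show "c (C #> x) \<in> c ` (rcosets C) \<and> x \<otimes> inv c (C #> x) \<in> C"
        using X c[OF X] mem[OF x] by auto
      fix r assume r: "r \<in> c ` (rcosets C) \<and> x \<otimes> inv r \<in> C"
      then obtain Y where Y: "Y \<in> rcosets C" "r = c Y" by auto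
      then show "r = c (C #> x)" using r c[OF Y(1)] mem[OF x] by auto
    qed
  qed
qed

text \<open>The first row is \<open>k v\<close> followed by zeros, so the matrix is block lower
  triangular.\<close>

lemma det_coord_mat_Cons:
  fixes ks :: "('m \<Rightarrow> int) list"
  assumes "length ks = length cs" "\<And>c. c \<in> set cs \<Longrightarrow> k c = 0"
  shows "det (coord_mat (k # ks) (v # cs)) = k v * det (coord_mat ks cs)"
proof -
  let ?n = "length cs"
  let ?A = "mat 1 1 (\<lambda>_. k v)" and ?C = "mat ?n 1 (\<lambda>(i, _). (ks ! i) v)"
  have "coord_mat (k # ks) (v # cs) = four_block_mat ?A (0\<^sub>m 1 ?n) ?C (coord_mat ks cs)"
    using assms by (intro eq_matI) (auto simp: coord_mat_def nth_Cons split: nat.split)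
  then have "det (coord_mat (k # ks) (v # cs)) = det ?A * det (coord_mat ks cs)"
    using assms(1) by (subst det_four_block_mat_upper_right_zero[of ?A 1 "0\<^sub>m 1 ?n" ?n ?C "coord_mat ks cs", symmetric])
      (auto simp: coord_mat_def)
  then show ?thesis by (simp add: det_single)
qed

lemma (in comm_group) div_mult_div_mult_cancel:
  assumes "x \<in> carrier G" "v \<in> carrier G" "t \<in> carrier G" "r \<in> carrier G"
  shows "x \<otimes> inv v \<otimes> inv t \<otimes> inv r \<otimes> v = x \<otimes> inv (t \<otimes> r)"
proof -
  have "x \<otimes> inv v \<otimes> inv t \<otimes> inv r \<otimes> v = x \<otimes> (inv t \<otimes> inv r) \<otimes> (inv v \<otimes> v)"
    using assms by (simp only: m_ac m_closed inv_closed)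
  then show ?thesis using assms by (simp add: inv_mult)
qed

lemma (in comm_group) inv_div_mult_div:
  assumes "x \<in> carrier G" "r \<in> carrier G" "t \<in> carrier G" "s \<in> carrier G"
  shows "inv (x \<otimes> inv (t \<otimes> r)) \<otimes> (x \<otimes> inv (t \<otimes> s)) = r \<otimes> inv s"
proof -
  have "inv (x \<otimes> inv (t \<otimes> r)) \<otimes> (x \<otimes> inv (t \<otimes> s))
     = (inv x \<otimes> x) \<otimes> ((t \<otimes> inv t) \<otimes> (r \<otimes> inv s))"
    using assms by (simp only: inv_mult inv_inv m_ac m_closed inv_closed)
  then show ?thesis using assms by simp
qed

text \<open>Put \<open>d = k v\<close>. As \<open>k b = 1\<close>, the functional is surjective, and
  it maps \<open>C\<close> onto the multiples of \<open>d\<close>; so \<open>G / C\<close> is an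
  extension of the integers modulo \<open>d\<close> by the quotient of the kernel of
  \<open>k\<close> by its intersection with \<open>C\<close>. The proof exhibits a transversal; for
  infinite index both cardinalities are 0.\<close>

lemma (in comm_group) card_rcosets_kernel:
  fixes k :: "'a \<Rightarrow> int"
  assumes C: "subgroup C G" and k: "additive_on G k" and b: "b \<in> carrier G" "k b = 1"
    and v: "v \<in> C" "k v > 0" "\<And>x. x \<in> C \<Longrightarrow> k v dvd k x"
  shows "int (card (rcosets C)) = k v * int (card (rcosets\<^bsub>G\<lparr>carrier := {x \<in> carrier G. k x = 0}\<rparr>\<^esub> {x \<in> C. k x = 0}))"
proof -
  interpret C: subgroup C G by fact
  let ?K = "{x \<in> carrier G. k x = 0}" and ?C = "{x \<in> C. k x = 0}"
  let ?B = "G\<lparr>carrier := ?K\<rparr>"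
  have sK: "subgroup ?K G" by (rule subgroup_additive_kernel[OF k])
  interpret B0: comm_group ?B by (rule comm_group_subgroup[OF sK])
  have "?C = C \<inter> ?K" using C.subset by auto
  then have "subgroup ?C G" using subgroups_Inter_pair[OF C sK] by simp
  then have sC0: "subgroup ?C ?B" using C.subset by (intro subgroup_incl sK) auto
  define d where "d = k v"
  have vG: "v \<in> carrier G" using v C.subset by auto
  obtain R0 where R0: "R0 \<subseteq> ?K" "\<And>x. x \<in> ?K \<Longrightarrow> \<exists>!r. r \<in> R0 \<and> x \<otimes> inv r \<in> ?C"
  proof (rule B0.exists_transversal[OF sC0])
    fix R assume R: "R \<subseteq> carrier ?B" "\<And>x. x \<in> carrier ?B \<Longrightarrow> \<exists>!r. r \<in> R \<and> x \<otimes>\<^bsub>?B\<^esub> inv\<^bsub>?B\<^esub> r \<in> ?C"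
    have "\<exists>!r. r \<in> R \<and> x \<otimes> inv r \<in> ?C" if x: "x \<in> ?K" for x
    proof -
      have eq: "inv\<^bsub>?B\<^esub> r = inv r" if "r \<in> R" for r
        using m_inv_consistent[OF sK] R(1) that by auto
      have "\<exists>!r. r \<in> R \<and> x \<otimes> inv\<^bsub>?B\<^esub> r \<in> ?C" using R(2)[of x] x by simp
      moreover have "r \<in> R \<and> x \<otimes> inv\<^bsub>?B\<^esub> r \<in> ?C \<longleftrightarrow> r \<in> R \<and> x \<otimes> inv r \<in> ?C" for r
        using eq by auto
      ultimately show ?thesis by (simp only:)
    qed
    then show thesis using that R(1) by simp
  qed
  have cR0: "card (rcosets\<^bsub>?B\<^esub> ?C) = card R0"
  proof (rule B0.card_rcosets_eq_transversal[OF sC0])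
    show "R0 \<subseteq> carrier ?B" using R0 by simp
    fix x assume "x \<in> carrier ?B"
    then have x: "x \<in> ?K" by simp
    have "r \<in> R0 \<and> x \<otimes> inv\<^bsub>?B\<^esub> r \<in> ?C \<longleftrightarrow> r \<in> R0 \<and> x \<otimes> inv r \<in> ?C" for r
      using m_inv_consistent[OF sK] R0(1) by auto
    then show "\<exists>!r. r \<in> R0 \<and> x \<otimes>\<^bsub>?B\<^esub> inv\<^bsub>?B\<^esub> r \<in> ?C" using R0(2)[OF x] by simp
  qed
  \<comment> \<open>The power \<open>b [^] t\<close> has value \<open>t\<close> under
    \<open>k\<close> and so supplies the residue, while \<open>R0\<close> represents the cosets
    inside the kernel.\<close>
  define h where "h = (\<lambda>(t::int, r). b [^] t \<otimes> r)"
  have R0G: "r \<in> carrier G" "k r = 0" if "r \<in> R0" for r using R0(1) that by auto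
  have hG: "h (t, r) \<in> carrier G" "k (h (t, r)) = t" if "r \<in> R0" for t r
    using R0G[OF that] b k by (auto simp: h_def additive_onD additive_on_int_pow)
  have hinj: "inj_on h ({0..<d} \<times> R0)"
  proof (rule inj_onI, clarify)
    fix t r t' r' assume *: "h (t, r) = h (t', r')" "r \<in> R0" "r' \<in> R0"
    then have "t = t'" using hG(2) by metis
    then show "t = t' \<and> r = r'" using * R0G b by (auto simp: h_def)
  qed
  have "card (rcosets C) = card (h ` ({0..<d} \<times> R0))"
  proof (rule card_rcosets_eq_transversal[OF C])
    show "h ` ({0..<d} \<times> R0) \<subseteq> carrier G" using hG by auto
    fix x assume x: "x \<in> carrier G"
    define t q where "t = k x mod d" and "q = k x div d"
    \<comment> \<open>The quotient of \<open>k x\<close> by \<open>d\<close> is removed by a power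
      of \<open>v\<close>, which lies in \<open>C\<close>, and the remainder by a power of
      \<open>b\<close>; what is left lies in the kernel of \<open>k\<close>.\<close>
    define y where "y = x \<otimes> inv (v [^] q) \<otimes> inv (b [^] t)"
    have t: "t \<in> {0..<d}" using v(2) by (auto simp: t_def d_def)
    have kx: "k x = q * d + t" by (simp add: t_def q_def)
    have y: "y \<in> ?K"
      using x vG b k kx by (auto simp: y_def additive_onD additive_on_inv additive_on_int_pow d_def)
    obtain r where r: "r \<in> R0" "y \<otimes> inv r \<in> ?C" using R0(2)[OF y] by blast
    have vq: "v [^] q \<in> C" using v(1) C by (rule subgroup_int_pow_closed[rotated])
    have "x \<otimes> inv h (t, r) = (y \<otimes> inv r) \<otimes> v [^] q"
      unfolding y_def h_def using x vG b R0G[OF r(1)] by (simp add: div_mult_div_mult_cancel)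
    also have "\<dots> \<in> C" using r vq C.m_closed by blast
    finally have ex: "h (t, r) \<in> h ` ({0..<d} \<times> R0) \<and> x \<otimes> inv h (t, r) \<in> C" using t r by blast
    show "\<exists>!s. s \<in> h ` ({0..<d} \<times> R0) \<and> x \<otimes> inv s \<in> C"
    proof (rule ex1I[of _ "h (t, r)"], rule ex)
      fix s assume s: "s \<in> h ` ({0..<d} \<times> R0) \<and> x \<otimes> inv s \<in> C"
      then obtain t' r' where s': "s = h (t', r')" "t' \<in> {0..<d}" "r' \<in> R0" by auto
      \<comment> \<open>Values of \<open>k\<close> on \<open>C\<close> are divisible by
        \<open>d\<close>, so the first component of a representative of \<open>x\<close> is forced
        to be the residue of \<open>k x\<close>.\<close>
      have "d dvd k x - t'"
        using v(3)[of "x \<otimes> inv s"] s s' hG[OF s'(3)] x k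
        by (simp add: d_def additive_onD additive_on_inv)
      then have "k x mod d = t' mod d" by (simp add: mod_eq_dvd_iff)
      then have tt: "t' = t" using s'(2) by (simp add: t_def)
      have "inv (x \<otimes> inv h (t, r)) \<otimes> (x \<otimes> inv s) \<in> C"
        using s ex C.m_closed C.m_inv_closed by blast
      also have "inv (x \<otimes> inv h (t, r)) \<otimes> (x \<otimes> inv s) = r \<otimes> inv r'"
        unfolding s'(1) tt h_def using x b R0G[OF r(1)] R0G[OF s'(3)] by (simp add: inv_div_mult_div)
      finally have "r \<otimes> inv r' \<in> ?C"
        using R0G[OF r(1)] R0G[OF s'(3)] k by (simp add: additive_onD additive_on_inv)
      moreover have "r \<otimes> inv r \<in> ?C"
        using R0G[OF r(1)] additive_on_one[OF k] by simp
      moreover have "\<exists>!z. z \<in> R0 \<and> r \<otimes> inv z \<in> ?C" using R0(2)[of r] R0G[OF r(1)] by simp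
      ultimately have "r' = r" using r(1) s'(3) by blast
      then show "s = h (t, r)" using s' tt by simp
    qed
  qed
  also have "\<dots> = nat d * card R0" using hinj by (simp add: card_image card_cartesian_product)
  finally show ?thesis
    using cR0 v(2) by (simp add: d_def)
qed

text \<open>Induction on the rank; the basis of \<open>C\<close> so constructed is triangular with respect to \<open>bs\<close>.\<close>

lemma sublattice_index:
  fixes B :: "('m, 'b) monoid_scheme"
  assumes "comm_group B" "dual_basis B bs ks" "subgroup C B" "finite (torsion B)" "n > 0"
    "\<And>x. x \<in> carrier B \<Longrightarrow> x [^]\<^bsub>B\<^esub> (n::nat) \<in> C"
  shows "\<exists>cs ls. dual_basis (B\<lparr>carrier := C\<rparr>) cs ls \<and> length cs = length bs \<and>
    int (card (rcosets\<^bsub>B\<^esub> C) * card (torsion B \<inter> C)) = int (card (torsion B)) * \<bar>det (coord_mat ks cs)\<bar>"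
  using assms
proof (induction bs arbitrary: ks B C)
  case Nil
  interpret B: comm_group B by fact
  have ks: "ks = []" using Nil(2) by (simp add: dual_basis_def)
  have tB: "torsion B = carrier B"
    using Nil(2) ks by (auto simp: dual_basis_def torsion_def)
  have C: "C \<subseteq> carrier B" using Nil(3) by (rule subgroup.subset)
  have "dual_basis (B\<lparr>carrier := C\<rparr>) [] []"
    using C tB by (auto simp: dual_basis_def B.torsion_subgroup)
  \<comment> \<open>In rank 0 all of \<open>B\<close> is torsion and the determinant is 1; the
    formula is Lagrange's theorem.\<close>
  moreover have "card (rcosets\<^bsub>B\<^esub> C) * card (torsion B \<inter> C) = card (torsion B)"
    using B.lagrange[OF Nil(3)] C tB by (simp add: Int_absorb1 Coset.order_def)
  moreover have "det (coord_mat ks []) = 1" using ks by (simp add: coord_mat_def det_dim_zero)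
  ultimately show ?case by (intro exI[of _ "[]"]) auto
next
  case (Cons b bs)
  interpret B: comm_group B by fact
  interpret C: subgroup C B by fact
  obtain k ks' where ks: "ks = k # ks'" using Cons.prems(2) by (cases ks) (auto simp: dual_basis_def)
  note D = dual_basisD[OF Cons.prems(2)]
  have k: "additive_on B k" using D(3)[of 0] ks by simp
  have b: "b \<in> carrier B" "k b = 1" using D(2)[of 0] D(4)[of 0 0] ks by auto
  let ?K = "{x \<in> carrier B. k x = 0}"
  let ?B = "B\<lparr>carrier := ?K\<rparr>" and ?C = "{x \<in> C. k x = 0}"
  have sK: "subgroup ?K B" by (rule B.subgroup_additive_kernel[OF k])
  have gB: "comm_group ?B" by (rule B.comm_group_subgroup[OF sK])
  interpret B0: comm_group ?B by (rule gB)
  interpret C': comm_group "B\<lparr>carrier := C\<rparr>" by (rule B.comm_group_subgroup) fact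
  have tB: "torsion ?B = torsion B"
    using B.torsion_subgroup[of ?K] B.additive_on_torsion[OF k] by (auto simp: torsion_def[of B])
  have sC: "subgroup ?C B"
  proof -
    have "?C = C \<inter> ?K" using C.subset by auto
    then show ?thesis using B.subgroups_Inter_pair[OF Cons.prems(3) sK] by simp
  qed
  have sC0: "subgroup ?C ?B"
    using sC C.subset by (intro B.subgroup_incl sK) auto
  have db0: "dual_basis ?B bs ks'"
    unfolding dual_basis_def
  proof (intro conjI ballI allI impI)
    show "set bs \<subseteq> carrier ?B"
    proof
      fix x assume "x \<in> set bs"
      then obtain j where j: "j < length bs" "x = bs ! j" by (auto simp: in_set_conv_nth)
      then show "x \<in> carrier ?B" using D(2)[of "Suc j"] D(4)[of 0 "Suc j"] ks by auto
    qed
    show "length ks' = length bs" using D(1) ks by simp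
    show "additive_on ?B l" if "l \<in> set ks'" for l
      using that Cons.prems(2) ks by (auto simp: dual_basis_def intro: additive_on_subset)
    show "(ks' ! i) (bs ! j) = (if i = j then 1 else 0)" if "i < length bs" "j < length bs" for i j
      using D(4)[of "Suc i" "Suc j"] that ks by simp
    show "x \<in> torsion ?B" if "x \<in> carrier ?B" "\<forall>l\<in>set ks'. l x = 0" for x
      using Cons.prems(2) that ks by (auto simp: tB dual_basis_def)
  qed
  have "\<exists>cs ls. dual_basis (?B\<lparr>carrier := ?C\<rparr>) cs ls \<and> length cs = length bs \<and>
    int (card (rcosets\<^bsub>?B\<^esub> ?C) * card (torsion ?B \<inter> ?C)) = int (card (torsion ?B)) * \<bar>det (coord_mat ks' cs)\<bar>"
  proof (rule Cons.IH[OF gB db0 sC0])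
    show "finite (torsion ?B)" using tB Cons.prems by simp
    fix x assume "x \<in> carrier ?B"
    then show "x [^]\<^bsub>?B\<^esub> n \<in> ?C"
      using Cons.prems(6) k by (auto simp: B.nat_pow_consistent[symmetric] B.additive_on_nat_pow)
  qed (rule Cons.prems)
  then obtain cs ls where cs: "dual_basis (B\<lparr>carrier := ?C\<rparr>) cs ls" "length cs = length bs"
    "int (card (rcosets\<^bsub>?B\<^esub> ?C) * card (torsion B \<inter> ?C)) = int (card (torsion B)) * \<bar>det (coord_mat ks' cs)\<bar>"
    using tB by auto
  have kC: "additive_on (B\<lparr>carrier := C\<rparr>) k" using k C.subset by (rule additive_on_subset)
  \<comment> \<open>The \<open>n\<close>-th power of \<open>b\<close> lies in \<open>C\<close> and
    has value \<open>n\<close>, so \<open>k\<close> does not vanish on \<open>C\<close> and its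
    image there has a positive generator.\<close>
  have "b [^]\<^bsub>B\<^esub> n \<in> C" "k (b [^]\<^bsub>B\<^esub> n) \<noteq> 0"
    using Cons.prems b B.additive_on_nat_pow[OF k b(1)] by auto
  then obtain v where v: "v \<in> C" "k v > 0" "\<And>x. x \<in> C \<Longrightarrow> k v dvd k x"
    using C'.additive_image_generator[OF kC] by auto
  define d where "d = k v"
  have dC: "dual_basis (B\<lparr>carrier := C\<rparr>) (v # cs)
      ((\<lambda>x. k x div d) # map (\<lambda>l x. l (x \<otimes>\<^bsub>B\<lparr>carrier := C\<rparr>\<^esub> inv\<^bsub>B\<lparr>carrier := C\<rparr>\<^esub> (v [^]\<^bsub>B\<lparr>carrier := C\<rparr>\<^esub> (k x div d)))) ls)"
    using cs v by (intro C'.dual_basis_Cons[OF kC]) (auto simp: d_def)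
  have kcs: "k c = 0" if "c \<in> set cs" for c using cs(1) that by (auto simp: dual_basis_def)
  have det: "det (coord_mat ks (v # cs)) = d * det (coord_mat ks' cs)"
    unfolding ks d_def using kcs cs(2) db0 by (intro det_coord_mat_Cons) (auto simp: dual_basis_def)
  \<comment> \<open>Torsion lies in the kernel of \<open>k\<close>, so the torsion factors are those
    of the induction hypothesis; the index and the determinant both acquire the factor
    \<open>d\<close>.\<close>
  have tC: "torsion B \<inter> ?C = torsion B \<inter> C" using B.additive_on_torsion[OF k] by auto
  have idx: "int (card (rcosets\<^bsub>B\<^esub> C)) = d * int (card (rcosets\<^bsub>?B\<^esub> ?C))"
    unfolding d_def using v by (intro B.card_rcosets_kernel[OF Cons.prems(3) k b])
  have "int (card (rcosets\<^bsub>B\<^esub> C) * card (torsion B \<inter> C)) = d * int (card (rcosets\<^bsub>?B\<^esub> ?C) * card (torsion B \<inter> ?C))"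
    using idx tC by simp
  also have "\<dots> = int (card (torsion B)) * \<bar>det (coord_mat ks (v # cs))\<bar>"
    using cs(3) det v(2) by (simp add: d_def abs_mult)
  finally show ?case using dC cs(2) by (intro exI conjI) auto
qed

section \<open>Determinant of a pairing pulled back along an isogeny\<close>

lemma (in group_hom) card_image_times_kernel:
  "card (h ` carrier G) * card (kernel G H h) = card (carrier G)"
proof -
  have "card (rcosets (kernel G H h)) * card (kernel G H h) = card (carrier G)"
    using G.lagrange[OF subgroup_kernel] by (simp add: Coset.order_def)
  moreover have "group_hom G (H\<lparr>carrier := h ` carrier G\<rparr>) h"
    using img_is_subgroup by (intro group_hom.intro group_hom_axioms.intro)
      (auto simp: H.subgroup_imp_group hom_def)
  then have "(\<lambda>X. the_elem (h ` X)) \<in> iso (G Mod (kernel G (H\<lparr>carrier := h ` carrier G\<rparr>) h)) (H\<lparr>carrier := h ` carrier G\<rparr>)"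
    by (rule group_hom.FactGroup_iso_set) simp
  then have "card (rcosets (kernel G H h)) = card (h ` carrier G)"
    using iso_same_order by (fastforce simp: Coset.order_def FactGroup_def kernel_def)
  ultimately show ?thesis by simp
qed

lemma bilinear_pairing_comp:
  assumes f: "f \<in> hom A B" and F: "bilinear_pairing B F"
  shows "bilinear_pairing A (\<lambda>x y. F (f x) (f y))"
  unfolding bilinear_pairing_def
  using F[unfolded bilinear_pairing_def] by (simp add: hom_mult[OF f] hom_in_carrier[OF f])

text \<open>With \<open>C\<close> the image of \<open>f\<close>, a basis of \<open>C\<close> modulo
  torsion lifts along \<open>f\<close> to one of \<open>A\<close>, and the pulled back pairing has
  the same Gram matrix on the lift. \<open>sublattice_index\<close> converts the determinant of the
  base change into the index, and the torsion of \<open>C\<close> is eliminated by restricting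
  \<open>f\<close> to torsion. Stating the formula without division keeps it free of conditions on
  the cardinalities.\<close>

lemma isogeny_pairing_det:
  assumes iso: "isogeny A B f f' k" and dA: "dual_basis A as as'" and dB: "dual_basis B bs ks"
    and fin: "finite (torsion A)" "finite (torsion B)" and F: "bilinear_pairing B F"
  shows "pairing_det A (\<lambda>x y. F (f x) (f y)) * (of_nat (card (torsion B)))\<^sup>2 * (of_nat (card (kernel A B f)))\<^sup>2
     = pairing_det B F * (of_nat (Coset.order (B Mod (f ` carrier A))))\<^sup>2 * (of_nat (card (torsion A)))\<^sup>2"
proof -
  interpret A: comm_group A using iso by (simp add: isogeny_def)
  interpret B: comm_group B using iso by (simp add: isogeny_def)
  have f: "f \<in> hom A B" "f' \<in> hom B A" "k > 0" and ff: "\<And>x. x \<in> carrier A \<Longrightarrow> f' (f x) = x [^]\<^bsub>A\<^esub> k"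
    "\<And>y. y \<in> carrier B \<Longrightarrow> f (f' y) = y [^]\<^bsub>B\<^esub> k" using iso by (auto simp: isogeny_def)
  interpret f: group_hom A B f using f by unfold_locales
  let ?C = "f ` carrier A"
  have sC: "subgroup ?C B" by (rule f.img_is_subgroup)
  have "\<exists>cs ls. dual_basis (B\<lparr>carrier := ?C\<rparr>) cs ls \<and> length cs = length bs \<and>
    int (card (rcosets\<^bsub>B\<^esub> ?C) * card (torsion B \<inter> ?C)) = int (card (torsion B)) * \<bar>det (coord_mat ks cs)\<bar>"
  proof (rule sublattice_index[OF _ dB sC fin(2) f(3)])
    show "x [^]\<^bsub>B\<^esub> k \<in> ?C" if "x \<in> carrier B" for x
      using ff(2)[OF that] hom_in_carrier[OF f(2) that] by (metis imageI)
  qed (rule B.comm_group_axioms)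
  then obtain cs ls where cs: "dual_basis (B\<lparr>carrier := ?C\<rparr>) cs ls" "length cs = length bs"
    "int (card (rcosets\<^bsub>B\<^esub> ?C) * card (torsion B \<inter> ?C)) = int (card (torsion B)) * \<bar>det (coord_mat ks cs)\<bar>"
    by blast
  note DC = dual_basisD[OF cs(1)]
  define g where "g c = (SOME a. a \<in> carrier A \<and> f a = c)" for c
  have g: "g c \<in> carrier A" "f (g c) = c" if "c \<in> ?C" for c
    using that someI_ex[of "\<lambda>a. a \<in> carrier A \<and> f a = c"] by (auto simp: g_def)
  let ?as = "map g cs" and ?ls = "map (\<lambda>l x. l (f x)) ls"
  have csC: "set cs \<subseteq> ?C" using cs(1) by (simp add: dual_basis_def)
  \<comment> \<open>If \<open>n\<close> is an exponent of \<open>f x\<close>, applying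
    \<open>f'\<close> shows that \<open>n * k\<close> is an exponent of \<open>x\<close>.\<close>
  have torsA: "x \<in> torsion A" if x: "x \<in> carrier A" "f x \<in> torsion B" for x
  proof -
    obtain n :: nat where n: "n > 0" "f x [^]\<^bsub>B\<^esub> n = \<one>\<^bsub>B\<^esub>" using x(2) by (auto simp: torsion_def)
    have "f (x [^]\<^bsub>A\<^esub> n) = \<one>\<^bsub>B\<^esub>" using n that by (simp add: f.hom_nat_pow)
    then have "x [^]\<^bsub>A\<^esub> (n * k) = \<one>\<^bsub>A\<^esub>"
      using ff(1)[of "x [^]\<^bsub>A\<^esub> n"] that hom_one[OF f(2) B.is_group A.is_group] by (simp add: A.nat_pow_pow)
    then show ?thesis using n f(3) that by (intro A.torsionI[of x "n * k"]) auto
  qed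
  have fC: "f \<in> hom A (B\<lparr>carrier := ?C\<rparr>)" using f(1) by (auto simp: hom_def)
  have torsC: "torsion (B\<lparr>carrier := ?C\<rparr>) = torsion B \<inter> ?C"
    by (rule B.torsion_subgroup) (use sC in \<open>auto dest: subgroup.subset\<close>)
  have d: "dual_basis A ?as ?ls"
    unfolding dual_basis_def
  proof (intro conjI ballI allI impI)
    show "set ?as \<subseteq> carrier A" using g csC by auto
    show "length ?ls = length ?as" using DC by simp
    show "additive_on A l" if "l \<in> set ?ls" for l
      using that cs(1) additive_on_comp[OF fC] by (auto simp: dual_basis_def)
    show "(?ls ! i) (?as ! j) = (if i = j then 1 else 0)" if "i < length ?as" "j < length ?as" for i j
    proof -
      have "cs ! j \<in> ?C" using that(2) csC by (auto simp: subset_iff)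
      then show ?thesis using that DC g by simp
    qed
    show "x \<in> torsion A" if "x \<in> carrier A" "\<forall>l\<in>set ?ls. l x = 0" for x
    proof (rule torsA[OF that(1)])
      have "f x \<in> torsion (B\<lparr>carrier := ?C\<rparr>)" using that cs(1) by (auto simp: dual_basis_def)
      then show "f x \<in> torsion B" using torsC by auto
    qed
  qed
  have bF: "bilinear_pairing A (\<lambda>x y. F (f x) (f y))"
    by (rule bilinear_pairing_comp[OF f(1) F])
  have csB: "set cs \<subseteq> carrier B" using csC sC by (auto dest: subgroup.subset)
  have "pairing_det A (\<lambda>x y. F (f x) (f y)) = det (gram (\<lambda>x y. F (f x) (f y)) ?as ?as)"
    by (rule A.pairing_det_eq_det_gram[OF d bF])
  also have "gram (\<lambda>x y. F (f x) (f y)) ?as ?as = gram F cs cs"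
    using csC g(2) by (intro eq_matI) (auto simp: gram_def subset_iff)
  also have "det (gram F cs cs) = (of_int (det (coord_mat ks cs)))\<^sup>2 * pairing_det B F"
    using B.det_gram_expand[OF dB F csB cs(2)] B.pairing_det_eq_det_gram[OF dB F] by simp
  finally have pd: "pairing_det A (\<lambda>x y. F (f x) (f y)) = (of_int \<bar>det (coord_mat ks cs)\<bar>)\<^sup>2 * pairing_det B F"
    by (metis of_int_power power2_abs)
  \<comment> \<open>Restricted to torsion, \<open>f\<close> keeps its whole kernel, which consists
    of torsion, and its image is all torsion of \<open>C\<close>. Counting fibres relates the two
    torsion orders.\<close>
  let ?T = "A\<lparr>carrier := torsion A\<rparr>"
  interpret T: group_hom ?T B f
    using f(1) A.subgroup_torsion
    by (intro group_hom.intro group_hom_axioms.intro) (auto simp: A.subgroup_imp_group hom_def torsion_def)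
  have kT: "kernel ?T B f = kernel A B f"
  proof -
    have "\<one>\<^bsub>B\<^esub> \<in> torsion B" using B.subgroup_torsion by (rule subgroup.one_closed)
    then have "x \<in> torsion A" if "x \<in> carrier A" "f x = \<one>\<^bsub>B\<^esub>" for x using torsA that by simp
    moreover have "torsion A \<subseteq> carrier A" by (auto simp: torsion_def)
    ultimately show ?thesis by (auto simp: kernel_def)
  qed
  have iT: "f ` torsion A = torsion B \<inter> ?C"
  proof
    show "f ` torsion A \<subseteq> torsion B \<inter> ?C"
      by (auto simp: torsion_def f.hom_nat_pow[symmetric])
    show "torsion B \<inter> ?C \<subseteq> f ` torsion A" using torsA by auto
  qed
  have tA: "card (torsion B \<inter> ?C) * card (kernel A B f) = card (torsion A)"
    using T.card_image_times_kernel kT iT by simp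
  have index: "int (card (torsion B)) * \<bar>det (coord_mat ks cs)\<bar> * int (card (kernel A B f))
     = int (card (rcosets\<^bsub>B\<^esub> ?C)) * int (card (torsion A))"
    using cs(3) tA by (simp flip: tA add: algebra_simps)
  have "of_nat (card (torsion B)) * of_int \<bar>det (coord_mat ks cs)\<bar> * of_nat (card (kernel A B f))
     = of_nat (card (rcosets\<^bsub>B\<^esub> ?C)) * (of_nat (card (torsion A)) :: complex)"
    using arg_cong[OF index, of of_int] by simp
  then have *: "(of_nat (card (torsion B)) * of_int \<bar>det (coord_mat ks cs)\<bar> * of_nat (card (kernel A B f)))\<^sup>2
     = (of_nat (card (rcosets\<^bsub>B\<^esub> ?C)) * (of_nat (card (torsion A)) :: complex))\<^sup>2"
    by simp
  show ?thesis
    unfolding pd using * by (simp add: Coset.order_def FactGroup_def power_mult_distrib mult_ac)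
qed

section \<open>Permutation modules and their equivariant homomorphisms\<close>

lemma gmoduleD:
  assumes "gmodule G M \<rho>"
  shows "group G" "comm_group M" "\<And>g. g \<in> carrier G \<Longrightarrow> \<rho> g \<in> hom M M"
    "\<And>g x. g \<in> carrier G \<Longrightarrow> x \<in> carrier M \<Longrightarrow> \<rho> g x \<in> carrier M"
    "\<And>g h x. g \<in> carrier G \<Longrightarrow> h \<in> carrier G \<Longrightarrow> x \<in> carrier M \<Longrightarrow> \<rho> (g \<otimes>\<^bsub>G\<^esub> h) x = \<rho> g (\<rho> h x)"
    "\<And>x. x \<in> carrier M \<Longrightarrow> \<rho> \<one>\<^bsub>G\<^esub> x = x"
    "\<And>g. g \<in> carrier G \<Longrightarrow> \<rho> g \<one>\<^bsub>M\<^esub> = \<one>\<^bsub>M\<^esub>"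
proof -
  interpret gm: gmodule G M \<rho> by fact
  show "group G" using gm.group_hom by (simp add: group_hom_def)
  show "comm_group M" by (rule gm.comm_group_axioms)
  show "\<rho> g \<in> hom M M" if "g \<in> carrier G" for g using that by (rule gm.act_hom)
  then show "\<rho> g x \<in> carrier M" if "g \<in> carrier G" "x \<in> carrier M" for g x
    using that hom_in_carrier by metis
  show "\<rho> (g \<otimes>\<^bsub>G\<^esub> h) x = \<rho> g (\<rho> h x)" if "g \<in> carrier G" "h \<in> carrier G" "x \<in> carrier M" for g h x
    using gm.composition_rule[OF that(3,1,2)] .
  show "\<rho> \<one>\<^bsub>G\<^esub> x = x" if "x \<in> carrier M" for x
    using gm.id_eq_one that by (metis restrict_apply')
  show "\<rho> g \<one>\<^bsub>M\<^esub> = \<one>\<^bsub>M\<^esub>" if "g \<in> carrier G" for g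
    using gm.act_hom[OF that] gm.is_group by (simp add: hom_one)
qed

locale perm_lattice = group G for G :: "('g, 'a) monoid_scheme" (structure) +
  fixes I :: "'i set" and H :: "'i \<Rightarrow> 'g set"
  assumes fin_G: "finite (carrier G)" and fin_I: "finite I"
    and sub_H: "i \<in> I \<Longrightarrow> subgroup (H i) G"
begin

abbreviation "P \<equiv> perm_module G I H"

text \<open>\<open>X\<close> is the disjoint union of the G-sets \<open>G / H i\<close>. It indexes
  the basis \<open>eps\<close> of \<open>P\<close> and the dual coordinates \<open>chi\<close>;
  \<open>base i\<close> is the trivial coset, one point in each orbit.\<close>

definition X where "X = Sigma I (\<lambda>i. lcosets (H i))"

definition act where "act g = (\<lambda>(i::'i, C). (i, g <#\<^bsub>G\<^esub> C))"

definition eps where "eps = (\<lambda>(i, C). \<lambda>i'\<in>I. if i' = i then frag_of C else 0)"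

definition chi where "chi = (\<lambda>(i, C) (p :: 'i \<Rightarrow> 'g set \<Rightarrow>\<^sub>0 int). Poly_Mapping.lookup (p i) C)"

definition base where "base i = (i, H i)"

lemma lcosets_finite: "i \<in> I \<Longrightarrow> finite (lcosets (H i))"
  using lcosets_subset_PowG[OF sub_H] fin_G by (meson finite_Pow_iff finite_subset)

lemma fin_X: "finite X"
  unfolding X_def using fin_I lcosets_finite by blast

lemma base_in_X: "i \<in> I \<Longrightarrow> base i \<in> X"
  using lcos_mult_one[of "H i"] sub_H[of i] subgroup.subset
  by (auto simp: base_def X_def LCOSETS_def intro!: bexI[of _ \<one>])

lemma act_X: "g \<in> carrier G \<Longrightarrow> x \<in> X \<Longrightarrow> act g x \<in> X"
  using sub_H subgroup.subset
  by (fastforce simp: act_def X_def LCOSETS_def lcos_m_assoc)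

lemma X_subset: "(i, C) \<in> X \<Longrightarrow> i \<in> I \<and> C \<subseteq> carrier G"
  using sub_H subgroup.lcosets_carrier[OF _ is_group] by (auto simp: X_def)

lemma act_mult: "g \<in> carrier G \<Longrightarrow> h \<in> carrier G \<Longrightarrow> x \<in> X \<Longrightarrow> act (g \<otimes> h) x = act g (act h x)"
  by (cases x) (auto simp: act_def lcos_m_assoc dest: X_subset)

lemma act_one: "x \<in> X \<Longrightarrow> act \<one> x = x"
  by (cases x) (auto simp: act_def lcos_mult_one dest: X_subset)

lemma act_inj: "g \<in> carrier G \<Longrightarrow> x \<in> X \<Longrightarrow> y \<in> X \<Longrightarrow> act g x = act g y \<longleftrightarrow> x = y"
  by (metis act_mult act_one inv_closed l_inv)

lemma act_bij: "g \<in> carrier G \<Longrightarrow> bij_betw (act g) X X"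
  by (rule bij_betw_byWitness[where f' = "act (inv g)"]) (auto simp: act_X act_mult[symmetric] act_one)

lemma X_orbit:
  assumes "x \<in> X" obtains g i where "g \<in> carrier G" "i \<in> I" "x = act g (base i)"
  using assms by (auto simp: X_def act_def base_def LCOSETS_def)

lemma act_base_eq_iff:
  assumes "g \<in> carrier G" "h \<in> carrier G" "i \<in> I" "j \<in> I"
  shows "act g (base i) = act h (base j) \<longleftrightarrow> i = j \<and> inv h \<otimes> g \<in> H i"
proof -
  interpret Hi: subgroup "H i" G by (rule sub_H) fact
  have "g <#\<^bsub>G\<^esub> H i = h <#\<^bsub>G\<^esub> H i \<longleftrightarrow> inv h \<otimes> g \<in> H i"
  proof
    assume "g <#\<^bsub>G\<^esub> H i = h <#\<^bsub>G\<^esub> H i"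
    then have "g \<in> h <#\<^bsub>G\<^esub> H i" using lcos_self[OF assms(1) sub_H[OF assms(3)]] by simp
    then show "inv h \<otimes> g \<in> H i" using Hi.lcos_module_imp[OF is_group assms(2)] by simp
  next
    assume "inv h \<otimes> g \<in> H i"
    then have "g \<in> h <#\<^bsub>G\<^esub> H i" using Hi.lcos_module_rev[OF is_group assms(2,1)] by simp
    then show "g <#\<^bsub>G\<^esub> H i = h <#\<^bsub>G\<^esub> H i" using l_repr_independence[OF _ assms(2) sub_H[OF assms(3)]] by simp
  qed
  then show ?thesis by (auto simp: act_def base_def)
qed

lemma P_carrier: "carrier P = (\<Pi>\<^sub>E i\<in>I. {c. Poly_Mapping.keys c \<subseteq> lcosets (H i)})"
  unfolding perm_module_def using fin_I by (subst carrier_sum_group) (auto simp: PiE_iff extensional_def)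

lemma P_mult: "p \<otimes>\<^bsub>P\<^esub> q = (\<lambda>i\<in>I. p i + q i)"
  by (simp add: perm_module_def)

lemma comm_group_P: "comm_group P"
proof (rule group.group_comm_groupI)
  show "group P" unfolding perm_module_def by (rule sum_group) simp
qed (auto simp: P_mult add.commute)

sublocale P: comm_group P by (rule comm_group_P)

lemma chi_additive: "x \<in> X \<Longrightarrow> additive_on P (chi x)"
  by (auto simp: additive_on_def chi_def P_mult X_def lookup_add)

lemma eps_P: "x \<in> X \<Longrightarrow> eps x \<in> carrier P"
  by (auto simp: eps_def P_carrier X_def keys_frag_of split: if_splits)

lemma chi_eps: "x \<in> X \<Longrightarrow> y \<in> X \<Longrightarrow> chi x (eps y) = (if x = y then 1 else 0)"
  by (auto simp: chi_def eps_def X_def split: if_splits)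

lemma chi_eqI:
  assumes "p \<in> carrier P" "q \<in> carrier P" "\<And>x. x \<in> X \<Longrightarrow> chi x p = chi x q"
  shows "p = q"
proof (rule PiE_ext[OF assms(1,2)[unfolded P_carrier]])
  fix i assume i: "i \<in> I"
  have k: "Poly_Mapping.keys (p i) \<subseteq> lcosets (H i)" "Poly_Mapping.keys (q i) \<subseteq> lcosets (H i)"
    using assms(1,2) i by (auto simp: P_carrier)
  show "p i = q i"
  proof (rule poly_mapping_eqI)
    fix C
    show "Poly_Mapping.lookup (p i) C = Poly_Mapping.lookup (q i) C"
    proof (cases "C \<in> lcosets (H i)")
      case True
      then show ?thesis using assms(3)[of "(i, C)"] i by (simp add: X_def chi_def)
    next
      case False
      then have "C \<notin> Poly_Mapping.keys (p i)" "C \<notin> Poly_Mapping.keys (q i)" using k by auto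
      then show ?thesis by (simp add: in_keys_iff)
    qed
  qed
qed

lemma P_expand: "p \<in> carrier P \<Longrightarrow> p = finprod P (\<lambda>x. eps x [^]\<^bsub>P\<^esub> chi x p) X"
proof (rule chi_eqI)
  fix x assume p: "p \<in> carrier P" and x: "x \<in> X"
  have "chi x (finprod P (\<lambda>x. eps x [^]\<^bsub>P\<^esub> chi x p) X) = (\<Sum>y\<in>X. chi x (eps y [^]\<^bsub>P\<^esub> chi y p))"
    using eps_P by (intro P.additive_on_finprod chi_additive x fin_X) auto
  also have "\<dots> = (\<Sum>y\<in>X. if y = x then chi x p else 0)"
    using x eps_P by (intro sum.cong) (auto simp: P.additive_on_int_pow[OF chi_additive] chi_eps)
  finally show "chi x p = chi x (finprod P (\<lambda>x. eps x [^]\<^bsub>P\<^esub> chi x p) X)" using x fin_X by simp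
qed (auto intro!: P.finprod_closed eps_P)

lemma hom_P_expand:
  assumes "comm_group M" "f \<in> hom P M" "p \<in> carrier P"
  shows "f p = finprod M (\<lambda>x. f (eps x) [^]\<^bsub>M\<^esub> chi x p) X"
proof -
  interpret M: comm_group M by fact
  have "f p = f (finprod P (\<lambda>x. eps x [^]\<^bsub>P\<^esub> chi x p) X)" using P_expand[OF assms(3)] by simp
  also have "\<dots> = finprod M (\<lambda>x. f (eps x [^]\<^bsub>P\<^esub> chi x p)) X"
    using eps_P by (intro P.hom_finprod assms fin_X) auto
  also have "\<dots> = finprod M (\<lambda>x. f (eps x) [^]\<^bsub>M\<^esub> chi x p) X"
    using eps_P hom_in_carrier[OF assms(2)]
    by (intro M.finprod_cong') (auto simp: hom_int_pow[OF assms(2) _ P.is_group M.is_group])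
  finally show ?thesis .
qed

lemma additive_P_expand:
  fixes l :: "_ \<Rightarrow> 'r::ring_1"
  assumes "additive_on P l" "p \<in> carrier P"
  shows "l p = (\<Sum>x\<in>X. of_int (chi x p) * l (eps x))"
proof -
  have "l p = l (finprod P (\<lambda>x. eps x [^]\<^bsub>P\<^esub> chi x p) X)" using P_expand[OF assms(2)] by simp
  also have "\<dots> = (\<Sum>x\<in>X. l (eps x [^]\<^bsub>P\<^esub> chi x p))"
    using eps_P by (intro P.additive_on_finprod assms fin_X) auto
  also have "\<dots> = (\<Sum>x\<in>X. of_int (chi x p) * l (eps x))"
    using eps_P by (intro sum.cong) (auto simp: P.additive_on_int_pow[OF assms(1)])
  finally show ?thesis .
qed

lemma hom_P_ext:
  assumes "comm_group M" "f \<in> hom P M" "f' \<in> hom P M" "\<And>x. x \<in> X \<Longrightarrow> f (eps x) = f' (eps x)" "p \<in> carrier P"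
  shows "f p = f' p"
proof -
  interpret M: comm_group M by fact
  show ?thesis
    unfolding hom_P_expand[OF assms(1,2,5)] hom_P_expand[OF assms(1,3,5)]
    using assms(4) hom_in_carrier[OF assms(3)] eps_P by (intro M.finprod_cong') auto
qed

text \<open>The linear extension of prescribed values on the basis, cut off outside
  \<open>carrier P\<close> because the elements of \<open>Hom_G\<close> are extensional.\<close>

definition extend :: "('m, 'b) monoid_scheme \<Rightarrow> ('i \<times> 'g set \<Rightarrow> 'm) \<Rightarrow> ('i \<Rightarrow> 'g set \<Rightarrow>\<^sub>0 int) \<Rightarrow> 'm" where
  "extend M m = (\<lambda>p\<in>carrier P. finprod M (\<lambda>x. m x [^]\<^bsub>M\<^esub> chi x p) X)"

lemma extend_hom:
  assumes "comm_group M" "\<And>x. x \<in> X \<Longrightarrow> m x \<in> carrier M"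
  shows "extend M m \<in> hom P M" "\<And>x. x \<in> X \<Longrightarrow> extend M m (eps x) = m x"
proof -
  interpret M: comm_group M by fact
  show "extend M m \<in> hom P M"
  proof (rule homI)
    fix p assume "p \<in> carrier P"
    then show "extend M m p \<in> carrier M" using assms(2) by (auto simp: extend_def intro!: M.finprod_closed)
  next
    fix p q assume pq: "p \<in> carrier P" "q \<in> carrier P"
    have "extend M m (p \<otimes>\<^bsub>P\<^esub> q) = finprod M (\<lambda>x. m x [^]\<^bsub>M\<^esub> chi x (p \<otimes>\<^bsub>P\<^esub> q)) X"
      unfolding extend_def using P.m_closed[OF pq] by simp
    also have "\<dots> = finprod M (\<lambda>x. m x [^]\<^bsub>M\<^esub> chi x p \<otimes>\<^bsub>M\<^esub> m x [^]\<^bsub>M\<^esub> chi x q) X"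
      using assms(2) pq by (intro M.finprod_cong') (auto simp: additive_onD[OF chi_additive] M.int_pow_mult)
    also have "\<dots> = finprod M (\<lambda>x. m x [^]\<^bsub>M\<^esub> chi x p) X \<otimes>\<^bsub>M\<^esub> finprod M (\<lambda>x. m x [^]\<^bsub>M\<^esub> chi x q) X"
      using assms(2) by (intro M.finprod_multf) auto
    also have "\<dots> = extend M m p \<otimes>\<^bsub>M\<^esub> extend M m q"
      unfolding extend_def using pq by simp
    finally show "extend M m (p \<otimes>\<^bsub>P\<^esub> q) = extend M m p \<otimes>\<^bsub>M\<^esub> extend M m q" .
  qed
  fix x assume x: "x \<in> X"
  have "extend M m (eps x) = finprod M (\<lambda>y. m y [^]\<^bsub>M\<^esub> chi y (eps x)) X"
    unfolding extend_def using eps_P[OF x] by simp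
  also have "\<dots> = finprod M (\<lambda>y. if y = x then m y else \<one>\<^bsub>M\<^esub>) X"
    using x assms(2) by (intro M.finprod_cong') (auto simp: chi_eps)
  also have "\<dots> = m x" using x assms(2)
    by (subst M.finprod_singleton_swap[of x X m]) (auto simp: fin_X Pi_iff)
  finally show "extend M m (eps x) = m x" .
qed

abbreviation "\<pi> \<equiv> perm_action G I H"

lemma perm_action_hom:
  assumes g: "g \<in> carrier G"
  shows "\<pi> g \<in> hom P P"
proof (rule homI)
  fix p assume p: "p \<in> carrier P"
  have "Poly_Mapping.keys (frag_extend (\<lambda>C. frag_of (g <#\<^bsub>G\<^esub> C)) (p i)) \<subseteq> lcosets (H i)" if i: "i \<in> I" for i
  proof -
    have "g <#\<^bsub>G\<^esub> C \<in> lcosets (H i)" if "C \<in> Poly_Mapping.keys (p i)" for C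
      using p i that act_X[OF g, of "(i, C)"] by (auto simp: P_carrier X_def act_def)
    then show ?thesis using keys_frag_extend[of "\<lambda>C. frag_of (g <#\<^bsub>G\<^esub> C)" "p i"] by (auto simp: keys_frag_of)
  qed
  then show "\<pi> g p \<in> carrier P" using p by (auto simp: perm_action_def P_carrier)
next
  fix p q assume "p \<in> carrier P" "q \<in> carrier P"
  then show "\<pi> g (p \<otimes>\<^bsub>P\<^esub> q) = \<pi> g p \<otimes>\<^bsub>P\<^esub> \<pi> g q"
    by (simp add: perm_action_def frag_extend_add) (auto simp: P_mult frag_extend_add)
qed

lemma perm_action_eps: "x \<in> X \<Longrightarrow> \<pi> g (eps x) = eps (act g x)"
  by (auto simp: perm_action_def eps_P) (auto simp: eps_def act_def X_def)

text \<open>\<open>G\<close> permutes the basis, and the coordinates with it. As a consequence, the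
  matrix of an equivariant map is constant on the orbits of \<open>G\<close> on pairs of basis
  vectors.\<close>

lemma chi_perm_action:
  assumes "g \<in> carrier G" "x \<in> X" "p \<in> carrier P"
  shows "chi (act g x) (\<pi> g p) = chi x p"
proof -
  have "additive_on P (\<lambda>p. chi (act g x) (\<pi> g p))"
    by (rule additive_on_comp[OF perm_action_hom[OF assms(1)] chi_additive[OF act_X[OF assms(1,2)]]])
  then have "chi (act g x) (\<pi> g p) = (\<Sum>y\<in>X. chi y p * chi (act g x) (\<pi> g (eps y)))"
    using additive_P_expand[OF _ assms(3)] by fastforce
  also have "\<dots> = (\<Sum>y\<in>X. if y = x then chi x p else 0)"
    using assms by (intro sum.cong) (auto simp: perm_action_eps chi_eps act_X act_inj)
  finally show ?thesis using assms fin_X by simp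
qed

lemma equivariant_iff_eps:
  assumes "gmodule G M \<rho>" "f \<in> hom P M"
  shows "equivariant G P \<pi> \<rho> f \<longleftrightarrow> (\<forall>g\<in>carrier G. \<forall>x\<in>X. f (eps (act g x)) = \<rho> g (f (eps x)))"
proof
  assume "equivariant G P \<pi> \<rho> f"
  then show "\<forall>g\<in>carrier G. \<forall>x\<in>X. f (eps (act g x)) = \<rho> g (f (eps x))"
    by (auto simp: equivariant_def eps_P simp flip: perm_action_eps)
next
  note M = gmoduleD[OF assms(1)]
  assume *: "\<forall>g\<in>carrier G. \<forall>x\<in>X. f (eps (act g x)) = \<rho> g (f (eps x))"
  show "equivariant G P \<pi> \<rho> f"
    unfolding equivariant_def
  proof (intro ballI)
    fix g p assume g: "g \<in> carrier G" and p: "p \<in> carrier P"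
    show "f (\<pi> g p) = \<rho> g (f p)"
      by (rule hom_P_ext[OF M(2), of "\<lambda>p. f (\<pi> g p)" "\<lambda>p. \<rho> g (f p)"])
        (use g p * assms(2) perm_action_hom[OF g] M(3)[OF g] in
          \<open>auto simp: perm_action_eps hom_def Pi_iff\<close>)
  qed
qed

end

section \<open>Concatenated bases and block determinants\<close>

definition biorth :: "'m list \<Rightarrow> ('m \<Rightarrow> int) list \<Rightarrow> bool" where
  "biorth bs ks \<longleftrightarrow> length ks = length bs \<and>
     (\<forall>i<length bs. \<forall>j<length bs. (ks ! i) (bs ! j) = (if i = j then 1 else 0))"

lemma biorth_append:
  assumes "biorth bs ks" "biorth cs ls" "\<And>k c. k \<in> set ks \<Longrightarrow> c \<in> set cs \<Longrightarrow> k c = 0"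
    "\<And>l b. l \<in> set ls \<Longrightarrow> b \<in> set bs \<Longrightarrow> l b = 0"
  shows "biorth (bs @ cs) (ks @ ls)"
  using assms unfolding biorth_def by (auto simp: nth_append)

lemma biorth_concat:
  assumes "distinct is" "\<And>i. i \<in> set is \<Longrightarrow> biorth (b i) (k i)"
    "\<And>i j x l. i \<in> set is \<Longrightarrow> j \<in> set is \<Longrightarrow> i \<noteq> j \<Longrightarrow> l \<in> set (k i) \<Longrightarrow> x \<in> set (b j) \<Longrightarrow> l x = 0"
  shows "biorth (concat (map b is)) (concat (map k is))"
  using assms
proof (induction "is")
  case Nil
  then show ?case by (simp add: biorth_def)
next
  case (Cons i "is")
  have "biorth (concat (map b is)) (concat (map k is))"
  proof (rule Cons.IH)
    fix i j x l assume "i \<in> set is" "j \<in> set is" "i \<noteq> j" "l \<in> set (k i)" "x \<in> set (b j)"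
    then show "l x = 0" using Cons.prems(3)[of i j l x] by simp
  qed (use Cons.prems in auto)
  moreover have "l x = 0" if "l \<in> set (k i)" "x \<in> set (concat (map b is))" for l x
    using that Cons.prems(1,3) by fastforce
  moreover have "l x = 0" if "l \<in> set (concat (map k is))" "x \<in> set (b i)" for l x
    using that Cons.prems(1,3) by fastforce
  moreover have "biorth (b i) (k i)" using Cons.prems(2) by simp
  ultimately show ?case using biorth_append[of "b i" "k i" "concat (map b is)" "concat (map k is)"] by simp
qed

text \<open>The vanishing of \<open>F\<close> on \<open>xs\<close> against \<open>ys\<close> makes
  the Gram matrix block lower triangular; \<open>F\<close> may fail to be symmetric.\<close>

lemma det_gram_append:
  fixes F :: "'m \<Rightarrow> 'm \<Rightarrow> 'r::idom"
  assumes "\<And>x y. x \<in> set xs \<Longrightarrow> y \<in> set ys \<Longrightarrow> F x y = 0"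
  shows "det (gram F (xs @ ys) (xs @ ys)) = det (gram F xs xs) * det (gram F ys ys)"
proof -
  let ?m = "length xs" and ?n = "length ys"
  have "gram F (xs @ ys) (xs @ ys) = four_block_mat (gram F xs xs) (0\<^sub>m ?m ?n) (gram F ys xs) (gram F ys ys)"
    using assms by (intro eq_matI) (auto simp: gram_def nth_append)
  then show ?thesis
    by (simp add: det_four_block_mat_upper_right_zero[of "gram F xs xs" ?m "0\<^sub>m ?m ?n" ?n "gram F ys xs" "gram F ys ys"])
qed

lemma det_gram_concat:
  fixes F :: "'m \<Rightarrow> 'm \<Rightarrow> 'r::idom"
  assumes "distinct is"
    "\<And>i j x y. i \<in> set is \<Longrightarrow> j \<in> set is \<Longrightarrow> i \<noteq> j \<Longrightarrow> x \<in> set (b i) \<Longrightarrow> y \<in> set (b j) \<Longrightarrow> F x y = 0"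
  shows "det (gram F (concat (map b is)) (concat (map b is))) = (\<Prod>i\<in>set is. det (gram F (b i) (b i)))"
  using assms
proof (induction "is")
  case Nil
  then show ?case by (simp add: gram_def)
next
  case (Cons i "is")
  have "F x y = 0" if "x \<in> set (b i)" "y \<in> set (concat (map b is))" for x y
    using that Cons.prems by fastforce
  then have "det (gram F (concat (map b (i # is))) (concat (map b (i # is))))
     = det (gram F (b i) (b i)) * det (gram F (concat (map b is)) (concat (map b is)))"
    using det_gram_append[of "b i" "concat (map b is)" F] by simp
  also have "det (gram F (concat (map b is)) (concat (map b is))) = (\<Prod>i\<in>set is. det (gram F (b i) (b i)))"
  proof (rule Cons.IH)
    fix i j x y assume "i \<in> set is" "j \<in> set is" "i \<noteq> j" "x \<in> set (b i)" "y \<in> set (b j)"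
    then show "F x y = 0" using Cons.prems(2)[of i j x y] by simp
  qed (use Cons.prems in auto)
  finally show ?case using Cons.prems(1) by simp
qed

section \<open>Invariants under a subgroup\<close>

lemma subgroup_fixed:
  assumes "gmodule G M \<rho>" "K \<subseteq> carrier G"
  shows "subgroup {m \<in> carrier M. \<forall>h\<in>K. \<rho> h m = m} M"
proof -
  note M = gmoduleD[OF assms(1)]
  interpret M: comm_group M by fact
  show ?thesis
  proof (rule M.subgroupI)
    have "\<one>\<^bsub>M\<^esub> \<in> {m \<in> carrier M. \<forall>h\<in>K. \<rho> h m = m}" using M(7) assms(2) by auto
    then show "{m \<in> carrier M. \<forall>h\<in>K. \<rho> h m = m} \<noteq> {}" by blast
  next
    fix a assume a: "a \<in> {m \<in> carrier M. \<forall>h\<in>K. \<rho> h m = m}"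
    have "\<rho> h (inv\<^bsub>M\<^esub> a) = inv\<^bsub>M\<^esub> (\<rho> h a)" if "h \<in> K" for h
      using M(3)[of h] a that assms(2) M.is_group
      by (intro group_hom.hom_inv) (auto simp: group_hom_def group_hom_axioms_def)
    then show "inv\<^bsub>M\<^esub> a \<in> {m \<in> carrier M. \<forall>h\<in>K. \<rho> h m = m}" using a by auto
  next
    fix a b assume ab: "a \<in> {m \<in> carrier M. \<forall>h\<in>K. \<rho> h m = m}" "b \<in> {m \<in> carrier M. \<forall>h\<in>K. \<rho> h m = m}"
    have "\<rho> h (a \<otimes>\<^bsub>M\<^esub> b) = a \<otimes>\<^bsub>M\<^esub> b" if "h \<in> K" for h
      using hom_mult[OF M(3)[of h]] ab that assms(2) by auto
    then show "a \<otimes>\<^bsub>M\<^esub> b \<in> {m \<in> carrier M. \<forall>h\<in>K. \<rho> h m = m}" using ab by auto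
  qed auto
qed

lemma comm_group_fixed_submodule:
  assumes "gmodule G M \<rho>" "K \<subseteq> carrier G"
  shows "comm_group (fixed_submodule M \<rho> K)"
  unfolding fixed_submodule_def
  by (rule comm_group.comm_group_subgroup[OF gmoduleD(2)[OF assms(1)] subgroup_fixed[OF assms]])

lemma carrier_fixed_submodule [simp]:
  "x \<in> carrier (fixed_submodule M \<rho> K) \<longleftrightarrow> x \<in> carrier M \<and> (\<forall>h\<in>K. \<rho> h x = x)"
  by (simp add: fixed_submodule_def)

lemma fixed_submodule_simps [simp]:
  "x \<otimes>\<^bsub>fixed_submodule M \<rho> K\<^esub> y = x \<otimes>\<^bsub>M\<^esub> y" "\<one>\<^bsub>fixed_submodule M \<rho> K\<^esub> = \<one>\<^bsub>M\<^esub>"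
  by (simp_all add: fixed_submodule_def)

lemma torsion_fixed_submodule_subset: "comm_group M \<Longrightarrow> torsion (fixed_submodule M \<rho> K) \<subseteq> torsion M"
  using group.torsion_subgroup[of M "{m \<in> carrier M. \<forall>h\<in>K. \<rho> h m = m}"]
  by (auto simp: fixed_submodule_def comm_group_def)

section \<open>Evaluation at the base points and Frobenius reciprocity\<close>

context perm_lattice
begin

abbreviation "HomP M \<rho> \<equiv> Hom_G G P \<pi> M \<rho>"
abbreviation "ev i f \<equiv> f (eps (base i))"

lemma Hom_G_mem: "f \<in> carrier (HomP M \<rho>) \<longleftrightarrow> f \<in> hom P M \<and> f \<in> extensional (carrier P) \<and> equivariant G P \<pi> \<rho> f"
  by (auto simp: Hom_G_def)

lemma Hom_G_closed: "f \<in> carrier (HomP M \<rho>) \<Longrightarrow> p \<in> carrier P \<Longrightarrow> f p \<in> carrier M"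
  unfolding Hom_G_mem using hom_in_carrier[of f P M p] by blast

lemma Hom_G_mult: "f \<otimes>\<^bsub>HomP M \<rho>\<^esub> f' = (\<lambda>x\<in>carrier P. f x \<otimes>\<^bsub>M\<^esub> f' x)"
  by (simp add: Hom_G_def)

lemma Hom_G_one: "\<one>\<^bsub>HomP M \<rho>\<^esub> = (\<lambda>x\<in>carrier P. \<one>\<^bsub>M\<^esub>)"
  by (simp add: Hom_G_def)

lemma perm_action_closed: "g \<in> carrier G \<Longrightarrow> p \<in> carrier P \<Longrightarrow> \<pi> g p \<in> carrier P"
  using perm_action_hom hom_in_carrier by metis

lemma comm_group_Hom_G:
  assumes "gmodule G M \<rho>"
  shows "comm_group (HomP M \<rho>)"
proof -
  note M = gmoduleD[OF assms]
  interpret M: comm_group M by fact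
  have cl: "f x \<in> carrier M" if "f \<in> carrier (HomP M \<rho>)" "x \<in> carrier P" for f x
    using that by (rule Hom_G_closed)
  show ?thesis
  proof (rule comm_groupI)
    fix f f' assume f: "f \<in> carrier (HomP M \<rho>)" "f' \<in> carrier (HomP M \<rho>)"
    have "(\<lambda>x\<in>carrier P. f x \<otimes>\<^bsub>M\<^esub> f' x) \<in> hom P M"
      using f cl by (intro homI) (auto simp: Hom_G_mem hom_mult M.m_ac)
    moreover have "equivariant G P \<pi> \<rho> (\<lambda>x\<in>carrier P. f x \<otimes>\<^bsub>M\<^esub> f' x)"
      using f cl by (auto simp: Hom_G_mem equivariant_def perm_action_closed hom_mult[OF M(3)])
    ultimately show "f \<otimes>\<^bsub>HomP M \<rho>\<^esub> f' \<in> carrier (HomP M \<rho>)"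
      by (simp add: Hom_G_mem Hom_G_mult)
    show "f \<otimes>\<^bsub>HomP M \<rho>\<^esub> f' = f' \<otimes>\<^bsub>HomP M \<rho>\<^esub> f"
      using f cl by (auto simp: Hom_G_mult M.m_comm)
    fix f'' assume "f'' \<in> carrier (HomP M \<rho>)"
    then show "f \<otimes>\<^bsub>HomP M \<rho>\<^esub> f' \<otimes>\<^bsub>HomP M \<rho>\<^esub> f'' = f \<otimes>\<^bsub>HomP M \<rho>\<^esub> (f' \<otimes>\<^bsub>HomP M \<rho>\<^esub> f'')"
      using f cl by (auto simp: Hom_G_mult M.m_assoc)
  next
    show "\<one>\<^bsub>HomP M \<rho>\<^esub> \<in> carrier (HomP M \<rho>)"
      using M(7) by (auto simp: Hom_G_mem Hom_G_one equivariant_def perm_action_closed intro!: homI)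
  next
    fix f assume f: "f \<in> carrier (HomP M \<rho>)"
    show "\<one>\<^bsub>HomP M \<rho>\<^esub> \<otimes>\<^bsub>HomP M \<rho>\<^esub> f = f"
      using f cl by (intro extensionalityI[of _ "carrier P"]) (auto simp: Hom_G_mult Hom_G_one Hom_G_mem)
    let ?f = "\<lambda>x\<in>carrier P. inv\<^bsub>M\<^esub> f x"
    have "?f \<in> hom P M"
      using f cl by (intro homI) (auto simp: Hom_G_mem hom_mult M.inv_mult)
    moreover have "equivariant G P \<pi> \<rho> ?f"
    proof -
      have "\<rho> g (inv\<^bsub>M\<^esub> f x) = inv\<^bsub>M\<^esub> (\<rho> g (f x))" if "g \<in> carrier G" "x \<in> carrier P" for g x
        using M(3)[OF that(1)] cl[OF f that(2)] M.is_group
        by (intro group_hom.hom_inv) (auto simp: group_hom_def group_hom_axioms_def)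
      then show ?thesis using f by (auto simp: Hom_G_mem equivariant_def perm_action_closed)
    qed
    ultimately have "?f \<in> carrier (HomP M \<rho>)" by (simp add: Hom_G_mem)
    moreover have "?f \<otimes>\<^bsub>HomP M \<rho>\<^esub> f = \<one>\<^bsub>HomP M \<rho>\<^esub>" using f cl by (auto simp: Hom_G_mult Hom_G_one)
    ultimately show "\<exists>f'\<in>carrier (HomP M \<rho>). f' \<otimes>\<^bsub>HomP M \<rho>\<^esub> f = \<one>\<^bsub>HomP M \<rho>\<^esub>" by blast
  qed
qed

lemma eval_hom: "x \<in> carrier P \<Longrightarrow> (\<lambda>f. f x) \<in> hom (HomP M \<rho>) M"
  by (intro homI) (auto simp: Hom_G_mult Hom_G_closed)

lemma eval_pow:
  assumes "gmodule G M \<rho>" "f \<in> carrier (HomP M \<rho>)" "x \<in> carrier P"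
  shows "(f [^]\<^bsub>HomP M \<rho>\<^esub> (n::nat)) x = f x [^]\<^bsub>M\<^esub> n"
proof -
  have "group_hom (HomP M \<rho>) M (\<lambda>f. f x)"
    using comm_group_Hom_G[OF assms(1)] gmoduleD(2)[OF assms(1)] eval_hom[OF assms(3)]
    by (auto simp: group_hom_def group_hom_axioms_def comm_group_def)
  from group_hom.hom_nat_pow[OF this assms(2)] show ?thesis .
qed

text \<open>Every basis vector is a translate of some \<open>base i\<close>, and equivariance
  determines the value on translates.\<close>

lemma Hom_G_eqI:
  assumes "gmodule G M \<rho>" "f \<in> carrier (HomP M \<rho>)" "f' \<in> carrier (HomP M \<rho>)" "\<And>i. i \<in> I \<Longrightarrow> ev i f = ev i f'"
  shows "f = f'"
proof (rule extensionalityI[of _ "carrier P"])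
  show "f \<in> extensional (carrier P)" "f' \<in> extensional (carrier P)" using assms by (auto simp: Hom_G_mem)
  note M = gmoduleD[OF assms(1)]
  have h: "f \<in> hom P M" "f' \<in> hom P M" using assms by (auto simp: Hom_G_mem)
  have e: "f (eps (act g x)) = \<rho> g (f (eps x))" "f' (eps (act g x)) = \<rho> g (f' (eps x))" if "g \<in> carrier G" "x \<in> X" for g x
    using that equivariant_iff_eps[OF assms(1)] h assms(2,3) by (auto simp: Hom_G_mem)
  fix p assume p: "p \<in> carrier P"
  show "f p = f' p"
  proof (rule hom_P_ext[OF M(2) h _ p])
    fix x assume "x \<in> X"
    then obtain g i where "g \<in> carrier G" "i \<in> I" "x = act g (base i)" by (rule X_orbit)
    then show "f (eps x) = f' (eps x)" using e base_in_X assms(4) by simp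
  qed
qed

lemma ev_act:
  assumes "gmodule G M \<rho>" "f \<in> carrier (HomP M \<rho>)" "g \<in> carrier G" "i \<in> I"
  shows "f (eps (act g (base i))) = \<rho> g (ev i f)"
  using equivariant_iff_eps[OF assms(1), of f] assms base_in_X by (auto simp: Hom_G_mem)

lemma act_base_H:
  assumes "i \<in> I" "h \<in> H i" shows "act h (base i) = base i"
proof -
  interpret Hi: subgroup "H i" G by (rule sub_H) fact
  have "act h (base i) = act \<one> (base i)" using assms by (subst act_base_eq_iff) auto
  then show ?thesis using act_one[OF base_in_X[OF assms(1)]] by simp
qed

text \<open>\<open>H i\<close> stabilises \<open>base i\<close>, and equivariance carries this over
  to the value.\<close>

lemma ev_fixed:
  assumes "gmodule G M \<rho>" "f \<in> carrier (HomP M \<rho>)" "i \<in> I"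
  shows "ev i f \<in> carrier (fixed_submodule M \<rho> (H i))"
proof -
  have "\<rho> h (ev i f) = ev i f" if "h \<in> H i" for h
    using ev_act[OF assms(1,2) _ assms(3), of h] act_base_H[OF assms(3) that] sub_H[OF assms(3)] that
    by (metis subgroup.mem_carrier)
  then show ?thesis using Hom_G_closed[OF assms(2) eps_P[OF base_in_X[OF assms(3)]]] by simp
qed

text \<open>Frobenius reciprocity: the coset \<open>g H i\<close> is sent to
  \<open>\<rho> g (m i)\<close>. \<open>SOME\<close> selects a representative of the coset; two of
  them differ by an element of \<open>H i\<close>, so the choice is immaterial once
  \<open>m i\<close> is fixed by \<open>H i\<close>.\<close>

definition hom_of :: "('m, 'b) monoid_scheme \<Rightarrow> ('g \<Rightarrow> 'm \<Rightarrow> 'm) \<Rightarrow> ('i \<Rightarrow> 'm) \<Rightarrow> ('i \<Rightarrow> 'g set \<Rightarrow>\<^sub>0 int) \<Rightarrow> 'm" where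
  "hom_of M \<rho> m = extend M (\<lambda>x. \<rho> (SOME g. g \<in> carrier G \<and> x = act g (base (fst x))) (m (fst x)))"

lemma hom_of:
  assumes M: "gmodule G M \<rho>" and m: "\<And>i. i \<in> I \<Longrightarrow> m i \<in> carrier (fixed_submodule M \<rho> (H i))"
  shows "hom_of M \<rho> m \<in> carrier (HomP M \<rho>)" "\<And>i. i \<in> I \<Longrightarrow> ev i (hom_of M \<rho> m) = m i"
proof -
  note MD = gmoduleD[OF M]
  define v where "v x = \<rho> (SOME g. g \<in> carrier G \<and> x = act g (base (fst x))) (m (fst x))" for x
  have v: "v (act g (base i)) = \<rho> g (m i)" if g: "g \<in> carrier G" and i: "i \<in> I" for g i
  proof -
    define k where "k = (SOME k. k \<in> carrier G \<and> act g (base i) = act k (base (fst (act g (base i)))))"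
    have fi: "fst (act g (base i)) = i" by (simp add: act_def base_def)
    have k: "k \<in> carrier G" "act g (base i) = act k (base i)"
      using someI[of "\<lambda>k. k \<in> carrier G \<and> act g (base i) = act k (base (fst (act g (base i))))" g] g fi
      by (auto simp: k_def)
    then have h: "inv k \<otimes> g \<in> H i" using act_base_eq_iff[OF g k(1) i i] by simp
    have "\<rho> g (m i) = \<rho> (k \<otimes> (inv k \<otimes> g)) (m i)" using g k by (simp add: m_assoc[symmetric])
    also have "\<dots> = \<rho> k (\<rho> (inv k \<otimes> g) (m i))" using MD(5) g k m[OF i] by simp
    also have "\<dots> = \<rho> k (m i)" using m[OF i] h by simp
    finally show ?thesis unfolding v_def fi k_def[symmetric, unfolded fi] using k_def fi by simp
  qed
  have vX: "v x \<in> carrier M" if x: "x \<in> X" for x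
  proof -
    obtain g i where "g \<in> carrier G" "i \<in> I" "x = act g (base i)" using x by (rule X_orbit)
    then show ?thesis using v m MD(4) by simp
  qed
  have hv: "hom_of M \<rho> m = extend M v" by (simp add: hom_of_def v_def[abs_def])
  have ex: "extend M v \<in> hom P M" "\<And>x. x \<in> X \<Longrightarrow> extend M v (eps x) = v x"
    using extend_hom[OF MD(2), of v] vX by auto
  have ev: "extend M v (eps (act g x)) = \<rho> g (extend M v (eps x))" if gx: "g \<in> carrier G" "x \<in> X" for g x
  proof -
    obtain h i where hi: "h \<in> carrier G" "i \<in> I" "x = act h (base i)" using gx(2) by (rule X_orbit)
    have "act g x = act (g \<otimes> h) (base i)" using hi gx base_in_X by (simp add: act_mult)
    moreover have "act (g \<otimes> h) (base i) \<in> X" using gx hi base_in_X act_X by simp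
    ultimately show ?thesis using ex(2) gx hi v[of h i] v[of "g \<otimes> h" i] MD(5)[of g h "m i"] m[of i] by simp
  qed
  then have "equivariant G P \<pi> \<rho> (extend M v)" using equivariant_iff_eps[OF M] ex(1) by blast
  then show "hom_of M \<rho> m \<in> carrier (HomP M \<rho>)"
    using ex(1) unfolding hv by (auto simp: Hom_G_mem extend_def)
  fix i assume i: "i \<in> I"
  show "ev i (hom_of M \<rho> m) = m i"
    using ex(2)[OF base_in_X[OF i]] v[OF one_closed i] act_one[OF base_in_X[OF i]] MD(6)[of "m i"] m[OF i]
    unfolding hv by simp
qed

end

section \<open>The orthogonal decomposition of \<open>(P, M)\<close> into invariants\<close>

context perm_lattice
begin

text \<open>The inclusion of the i-th summand: extension by the neutral element on the other
  orbits.\<close>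

definition single :: "('m, 'b) monoid_scheme \<Rightarrow> ('g \<Rightarrow> 'm \<Rightarrow> 'm) \<Rightarrow> 'i \<Rightarrow> 'm \<Rightarrow> ('i \<Rightarrow> 'g set \<Rightarrow>\<^sub>0 int) \<Rightarrow> 'm" where
  "single M \<rho> i m = hom_of M \<rho> (\<lambda>j. if j = i then m else \<one>\<^bsub>M\<^esub>)"

lemma single:
  assumes "gmodule G M \<rho>" "i \<in> I" "m \<in> carrier (fixed_submodule M \<rho> (H i))"
  shows "single M \<rho> i m \<in> carrier (HomP M \<rho>)"
    "\<And>j. j \<in> I \<Longrightarrow> ev j (single M \<rho> i m) = (if j = i then m else \<one>\<^bsub>M\<^esub>)"
proof -
  have "(if j = i then m else \<one>\<^bsub>M\<^esub>) \<in> carrier (fixed_submodule M \<rho> (H j))" if "j \<in> I" for j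
  proof -
    interpret comm_group "fixed_submodule M \<rho> (H j)"
      by (rule comm_group_fixed_submodule[OF assms(1) subgroup.subset[OF sub_H[OF that]]])
    show ?thesis using assms(3) one_closed by (auto simp del: one_closed)
  qed
  note * = hom_of[OF assms(1), of "\<lambda>j. if j = i then m else \<one>\<^bsub>M\<^esub>", OF this]
  show "single M \<rho> i m \<in> carrier (HomP M \<rho>)" unfolding single_def by (rule *(1))
  show "ev j (single M \<rho> i m) = (if j = i then m else \<one>\<^bsub>M\<^esub>)" if "j \<in> I" for j
    unfolding single_def by (rule *(2)[OF _ that])
qed

lemma ev_hom:
  assumes "gmodule G M \<rho>" "i \<in> I"
  shows "(\<lambda>f. ev i f) \<in> hom (HomP M \<rho>) (fixed_submodule M \<rho> (H i))"
  using hom_mult[OF eval_hom[OF eps_P[OF base_in_X[OF assms(2)]], of M \<rho>]] ev_fixed[OF assms(1) _ assms(2)]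
  by (intro homI) (auto simp del: carrier_fixed_submodule)

lemma torsion_Hom_G:
  assumes "gmodule G M \<rho>" "f \<in> carrier (HomP M \<rho>)"
  shows "f \<in> torsion (HomP M \<rho>) \<longleftrightarrow> (\<forall>i\<in>I. ev i f \<in> torsion M)"
proof
  assume "f \<in> torsion (HomP M \<rho>)"
  then obtain n :: nat where n: "n > 0" "f [^]\<^bsub>HomP M \<rho>\<^esub> n = \<one>\<^bsub>HomP M \<rho>\<^esub>" by (auto simp: torsion_def)
  show "\<forall>i\<in>I. ev i f \<in> torsion M"
  proof
    fix i assume i: "i \<in> I"
    then have e: "eps (base i) \<in> carrier P" using eps_P base_in_X by auto
    have "ev i f [^]\<^bsub>M\<^esub> n = \<one>\<^bsub>M\<^esub>" using eval_pow[OF assms e, of n] n e by (simp add: Hom_G_one)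
    then show "ev i f \<in> torsion M" using ev_fixed[OF assms i] n by (auto simp: torsion_def)
  qed
next
  assume *: "\<forall>i\<in>I. ev i f \<in> torsion M"
  interpret A: comm_group "HomP M \<rho>" by (rule comm_group_Hom_G) fact
  interpret M: comm_group M by (rule gmoduleD) fact
  obtain n :: "'i \<Rightarrow> nat" where n: "\<And>i. i \<in> I \<Longrightarrow> n i > 0 \<and> ev i f [^]\<^bsub>M\<^esub> n i = \<one>\<^bsub>M\<^esub>"
    using bchoice[of I "\<lambda>i n. n > 0 \<and> ev i f [^]\<^bsub>M\<^esub> (n::nat) = \<one>\<^bsub>M\<^esub>"] * unfolding torsion_def by blast
  \<comment> \<open>The exponents vary with \<open>i\<close>; their product over the finite set
    \<open>I\<close> is a common one.\<close>
  let ?n = "prod n I"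
  have "ev i f [^]\<^bsub>M\<^esub> ?n = \<one>\<^bsub>M\<^esub>" if i: "i \<in> I" for i
  proof -
    obtain q where q: "?n = n i * q" using fin_I i by (meson dvdE dvd_prodI)
    have c: "ev i f \<in> carrier M" using ev_fixed[OF assms i] by simp
    show ?thesis unfolding q using n[OF i] by (simp flip: M.nat_pow_pow[OF c])
  qed
  then have "f [^]\<^bsub>HomP M \<rho>\<^esub> ?n = \<one>\<^bsub>HomP M \<rho>\<^esub>"
    using eval_pow[OF assms eps_P[OF base_in_X]] eps_P[OF base_in_X] assms(2)
    by (intro Hom_G_eqI[OF assms(1)] A.nat_pow_closed A.one_closed) (auto simp: Hom_G_one)
  moreover have "?n > 0" using n by (auto intro!: prod_pos)
  ultimately show "f \<in> torsion (HomP M \<rho>)" using assms(2) by (auto simp: torsion_def)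
qed

lemma finite_torsion_Hom_G:
  assumes "gmodule G M \<rho>" "finite (torsion M)"
  shows "finite (torsion (HomP M \<rho>))"
proof (rule inj_on_finite[of "\<lambda>f. \<lambda>i\<in>I. ev i f" _ "\<Pi>\<^sub>E i\<in>I. torsion M"])
  have sub: "f \<in> carrier (HomP M \<rho>)" if "f \<in> torsion (HomP M \<rho>)" for f using that by (auto simp: torsion_def)
  show "inj_on (\<lambda>f. \<lambda>i\<in>I. ev i f) (torsion (HomP M \<rho>))"
  proof (rule inj_onI)
    fix f f' assume ff: "f \<in> torsion (HomP M \<rho>)" "f' \<in> torsion (HomP M \<rho>)" "(\<lambda>i\<in>I. ev i f) = (\<lambda>i\<in>I. ev i f')"
    show "f = f'"
    proof (rule Hom_G_eqI[OF assms(1) sub[OF ff(1)] sub[OF ff(2)]])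
      fix i assume "i \<in> I"
      then show "ev i f = ev i f'" using fun_cong[OF ff(3), of i] by simp
    qed
  qed
  show "(\<lambda>f. \<lambda>i\<in>I. ev i f) ` torsion (HomP M \<rho>) \<subseteq> (\<Pi>\<^sub>E i\<in>I. torsion M)"
    using torsion_Hom_G[OF assms(1) sub] by auto
  show "finite (\<Pi>\<^sub>E i\<in>I. torsion M)" using fin_I assms(2) by (intro finite_PiE) auto
qed

text \<open>Bases of the summands are concatenated, and their coordinates are composed with
  evaluation at the base points. Blocks of different orbits do not meet, since \<open>single\<close>
  is neutral on the other orbits.\<close>

lemma dual_basis_Hom_G:
  assumes M: "gmodule G M \<rho>" and ixs: "distinct ixs" "set ixs = I"
    and db: "\<And>i. i \<in> I \<Longrightarrow> dual_basis (fixed_submodule M \<rho> (H i)) (b i) (k i)"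
  shows "dual_basis (HomP M \<rho>) (concat (map (\<lambda>i. map (single M \<rho> i) (b i)) ixs))
           (concat (map (\<lambda>i. map (\<lambda>l f. l (ev i f)) (k i)) ixs))"
proof -
  interpret Mg: comm_group M by (rule gmoduleD) fact
  have bM: "m \<in> carrier (fixed_submodule M \<rho> (H i))" if "i \<in> I" "m \<in> set (b i)" for i m
    using db[OF that(1)] that(2) unfolding dual_basis_def by blast
  have kadd: "additive_on (fixed_submodule M \<rho> (H i)) l" if "i \<in> I" "l \<in> set (k i)" for i l
    using db[OF that(1)] that(2) unfolding dual_basis_def by blast
  have k1: "l \<one>\<^bsub>M\<^esub> = 0" if "i \<in> I" "l \<in> set (k i)" for i l
    using comm_group.additive_on_one[OF comm_group_fixed_submodule[OF M subgroup.subset[OF sub_H[OF that(1)]]] kadd[OF that]]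
    by simp
  have "biorth (concat (map (\<lambda>i. map (single M \<rho> i) (b i)) ixs)) (concat (map (\<lambda>i. map (\<lambda>l f. l (ev i f)) (k i)) ixs))"
  proof (rule biorth_concat[OF ixs(1)])
    fix i assume "i \<in> set ixs"
    then have i: "i \<in> I" using ixs by simp
    note D = dual_basisD[OF db[OF i]]
    show "biorth (map (single M \<rho> i) (b i)) (map (\<lambda>l f. l (ev i f)) (k i))"
      unfolding biorth_def
    proof (intro conjI allI impI)
      show "length (map (\<lambda>l f. l (ev i f)) (k i)) = length (map (single M \<rho> i) (b i))" using D by simp
      fix s t assume "s < length (map (single M \<rho> i) (b i))" "t < length (map (single M \<rho> i) (b i))"
      then show "(map (\<lambda>l f. l (ev i f)) (k i) ! s) (map (single M \<rho> i) (b i) ! t) = (if s = t then 1 else 0)"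
        using D single(2)[OF M i D(2) i] by simp
    qed
  next
    fix i j x l assume "i \<in> set ixs" "j \<in> set ixs" and ij: "i \<noteq> j"
      and l: "l \<in> set (map (\<lambda>l f. l (ev i f)) (k i))" and x: "x \<in> set (map (single M \<rho> j) (b j))"
    then have IJ: "i \<in> I" "j \<in> I" using ixs by auto
    obtain l' m where lm: "l' \<in> set (k i)" "l = (\<lambda>f. l' (ev i f))" "m \<in> set (b j)" "x = single M \<rho> j m"
      using l x by auto
    show "l x = 0" using single(2)[OF M IJ(2) bM[OF IJ(2) lm(3)] IJ(1)] ij lm k1[OF IJ(1) lm(1)] by simp
  qed
  moreover have "set (concat (map (\<lambda>i. map (single M \<rho> i) (b i)) ixs)) \<subseteq> carrier (HomP M \<rho>)"
    using single(1)[OF M _ bM] ixs by auto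
  moreover have "additive_on (HomP M \<rho>) l" if "l \<in> set (concat (map (\<lambda>i. map (\<lambda>l f. l (ev i f)) (k i)) ixs))" for l
    using that ixs additive_on_comp[OF ev_hom[OF M] kadd] by auto
  moreover have "f \<in> torsion (HomP M \<rho>)"
    if f: "f \<in> carrier (HomP M \<rho>)" "\<forall>l\<in>set (concat (map (\<lambda>i. map (\<lambda>l f. l (ev i f)) (k i)) ixs)). l f = 0" for f
  proof -
    have "ev i f \<in> torsion M" if i: "i \<in> I" for i
    proof -
      have "\<forall>l\<in>set (k i). l (ev i f) = 0" using f(2) i ixs by auto
      then have "ev i f \<in> torsion (fixed_submodule M \<rho> (H i))"
        using db[OF i] ev_fixed[OF M f(1) i] unfolding dual_basis_def by blast
      then show ?thesis using torsion_fixed_submodule_subset[OF Mg.comm_group_axioms] by blast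
    qed
    then show ?thesis using torsion_Hom_G[OF M f(1)] by simp
  qed
  ultimately show ?thesis unfolding dual_basis_def biorth_def by blast
qed

text \<open>The pairing of the overview, folded to one term for each orbit. The weight is the one by
  which \<open>regulator_constant\<close> rescales \<open>B\<close> on the invariants.\<close>

definition hom_pairing :: "('m \<Rightarrow> 'm \<Rightarrow> complex) \<Rightarrow> (('i \<Rightarrow> 'g set \<Rightarrow>\<^sub>0 int) \<Rightarrow> 'm) \<Rightarrow> (('i \<Rightarrow> 'g set \<Rightarrow>\<^sub>0 int) \<Rightarrow> 'm) \<Rightarrow> complex" where
  "hom_pairing B f f' = (\<Sum>i\<in>I. 1 / of_nat (card (H i)) * B (ev i f) (ev i f'))"

lemma bilinear_hom_pairing:
  assumes "gmodule G M \<rho>" "bilinear_pairing M B"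
  shows "bilinear_pairing (HomP M \<rho>) (hom_pairing B)"
proof -
  have e: "ev i f \<in> carrier M" if "f \<in> carrier (HomP M \<rho>)" "i \<in> I" for i f
    using ev_fixed[OF assms(1) that] by simp
  have m: "ev i (f \<otimes>\<^bsub>HomP M \<rho>\<^esub> f') = ev i f \<otimes>\<^bsub>M\<^esub> ev i f'" if "i \<in> I" for i f f'
    using eps_P[OF base_in_X[OF that]] by (simp add: Hom_G_mult)
  show ?thesis
    unfolding bilinear_pairing_def hom_pairing_def
  proof (intro ballI conjI)
    fix x y z assume xyz: "x \<in> carrier (HomP M \<rho>)" "y \<in> carrier (HomP M \<rho>)" "z \<in> carrier (HomP M \<rho>)"
    show "(\<Sum>i\<in>I. 1 / of_nat (card (H i)) * B (ev i (x \<otimes>\<^bsub>HomP M \<rho>\<^esub> y)) (ev i z)) =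
       (\<Sum>i\<in>I. 1 / of_nat (card (H i)) * B (ev i x) (ev i z)) + (\<Sum>i\<in>I. 1 / of_nat (card (H i)) * B (ev i y) (ev i z))"
      unfolding sum.distrib[symmetric] using assms(2) e xyz m
      by (intro sum.cong) (auto simp: bilinear_pairing_def algebra_simps add_divide_distrib)
    show "(\<Sum>i\<in>I. 1 / of_nat (card (H i)) * B (ev i z) (ev i (x \<otimes>\<^bsub>HomP M \<rho>\<^esub> y))) =
       (\<Sum>i\<in>I. 1 / of_nat (card (H i)) * B (ev i z) (ev i x)) + (\<Sum>i\<in>I. 1 / of_nat (card (H i)) * B (ev i z) (ev i y))"
      unfolding sum.distrib[symmetric] using assms(2) e xyz m
      by (intro sum.cong) (auto simp: bilinear_pairing_def algebra_simps add_divide_distrib)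
  qed
qed

text \<open>Homomorphisms supported on different orbits pair to 0, so the Gram matrix is block
  diagonal, and its blocks are the rescaled Gram matrices on the invariants.\<close>

lemma pairing_det_Hom_G:
  assumes M: "gmodule G M \<rho>" and B: "bilinear_pairing M B"
    and db: "\<And>i. i \<in> I \<Longrightarrow> dual_basis (fixed_submodule M \<rho> (H i)) (b i) (k i)"
  shows "pairing_det (HomP M \<rho>) (hom_pairing B)
     = (\<Prod>i\<in>I. pairing_det (fixed_submodule M \<rho> (H i)) (\<lambda>x y. 1 / of_nat (card (H i)) * B x y))"
proof -
  interpret Mg: comm_group M by (rule gmoduleD) fact
  obtain ixs where ixs: "distinct ixs" "set ixs = I" using finite_distinct_list[OF fin_I] by blast
  let ?b = "\<lambda>i. map (single M \<rho> i) (b i)"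
  have bM: "m \<in> carrier (fixed_submodule M \<rho> (H i))" if "i \<in> I" "m \<in> set (b i)" for i m
    using db[OF that(1)] that(2) unfolding dual_basis_def by blast
  have B1: "B \<one>\<^bsub>M\<^esub> x = 0" "B x \<one>\<^bsub>M\<^esub> = 0" if "x \<in> carrier M" for x
    using B that Mg.additive_on_one[of "\<lambda>y. B y x"] Mg.additive_on_one[of "B x"]
    by (auto simp: bilinear_pairing_def additive_on_def)
  have "pairing_det (HomP M \<rho>) (hom_pairing B) = det (gram (hom_pairing B) (concat (map ?b ixs)) (concat (map ?b ixs)))"
    by (rule comm_group.pairing_det_eq_det_gram[OF comm_group_Hom_G[OF M] dual_basis_Hom_G[OF M ixs db] bilinear_hom_pairing[OF M B]])
  also have "\<dots> = (\<Prod>i\<in>set ixs. det (gram (hom_pairing B) (?b i) (?b i)))"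
  proof (rule det_gram_concat[OF ixs(1)])
    fix i j x y assume "i \<in> set ixs" "j \<in> set ixs" and ij: "i \<noteq> j" and xy: "x \<in> set (?b i)" "y \<in> set (?b j)"
    then have IJ: "i \<in> I" "j \<in> I" using ixs by auto
    obtain m n where mn: "m \<in> set (b i)" "n \<in> set (b j)" "x = single M \<rho> i m" "y = single M \<rho> j n" using xy by auto
    have c: "m \<in> carrier M" "n \<in> carrier M" using bM IJ mn by auto
    have "B (ev l x) (ev l y) = 0" if "l \<in> I" for l
      using single(2)[OF M IJ(1) bM[OF IJ(1) mn(1)] that] single(2)[OF M IJ(2) bM[OF IJ(2) mn(2)] that] ij mn(3,4) B1 c by auto
    then show "hom_pairing B x y = 0" by (simp add: hom_pairing_def)
  qed
  also have "\<dots> = (\<Prod>i\<in>I. pairing_det (fixed_submodule M \<rho> (H i)) (\<lambda>x y. 1 / of_nat (card (H i)) * B x y))"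
    unfolding ixs(2)
  proof (rule prod.cong[OF refl])
    fix i assume i: "i \<in> I"
    interpret F: comm_group "fixed_submodule M \<rho> (H i)"
      by (rule comm_group_fixed_submodule[OF M subgroup.subset[OF sub_H[OF i]]])
    let ?F = "\<lambda>x y. 1 / of_nat (card (H i)) * B x y"
    have "gram (hom_pairing B) (?b i) (?b i) = gram ?F (b i) (b i)"
    proof (rule eq_matI)
      fix s t assume "s < dim_row (gram ?F (b i) (b i))" "t < dim_col (gram ?F (b i) (b i))"
      then have st: "s < length (b i)" "t < length (b i)" by (auto simp: gram_def)
      have c: "b i ! s \<in> carrier (fixed_submodule M \<rho> (H i))" "b i ! t \<in> carrier (fixed_submodule M \<rho> (H i))"
        using bM[OF i] st by auto
      have "hom_pairing B (single M \<rho> i (b i ! s)) (single M \<rho> i (b i ! t))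
         = (\<Sum>j\<in>I. if j = i then ?F (b i ! s) (b i ! t) else 0)"
        unfolding hom_pairing_def
        using single(2)[OF M i c(1)] single(2)[OF M i c(2)] B1[of "\<one>\<^bsub>M\<^esub>"] by (intro sum.cong) auto
      then show "gram (hom_pairing B) (?b i) (?b i) $$ (s, t) = gram ?F (b i) (b i) $$ (s, t)"
        using st i fin_I by (simp add: gram_def)
    qed (auto simp: gram_def)
    moreover have "bilinear_pairing (fixed_submodule M \<rho> (H i)) ?F"
      using B by (auto simp: bilinear_pairing_def algebra_simps add_divide_distrib)
    ultimately show "det (gram (hom_pairing B) (?b i) (?b i)) = pairing_det (fixed_submodule M \<rho> (H i)) ?F"
      using F.pairing_det_eq_det_gram[OF db[OF i], of ?F] by simp
  qed
  finally show ?thesis .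
qed

text \<open>By invariance of \<open>B\<close> all points of an orbit contribute equally, and the
  orbit of \<open>base i\<close> has \<open>|G| / |H i|\<close> points. The weights that depend on
  the orbit give way to one common factor.\<close>

lemma hom_pairing_sum_eps:
  assumes M: "gmodule G M \<rho>" and f: "f \<in> carrier (HomP M \<rho>)" "f' \<in> carrier (HomP M \<rho>)"
    and inv: "\<forall>g\<in>carrier G. \<forall>x\<in>carrier M. \<forall>y\<in>carrier M. B (\<rho> g x) (\<rho> g y) = B x y"
  shows "hom_pairing B f f' = 1 / of_nat (Coset.order G) * (\<Sum>x\<in>X. B (f (eps x)) (f' (eps x)))"
proof -
  have "(\<Sum>x\<in>X. B (f (eps x)) (f' (eps x))) = (\<Sum>i\<in>I. \<Sum>C\<in>lcosets (H i). B (f (eps (i, C))) (f' (eps (i, C))))"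
    unfolding X_def using lcosets_finite by (subst sum.Sigma[OF fin_I]) (auto simp: case_prod_unfold)
  also have "\<dots> = (\<Sum>i\<in>I. of_nat (Coset.order G) * (1 / of_nat (card (H i)) * B (ev i f) (ev i f')))"
  proof (rule sum.cong[OF refl])
    fix i assume i: "i \<in> I"
    have "B (f (eps (i, C))) (f' (eps (i, C))) = B (ev i f) (ev i f')" if C: "C \<in> lcosets (H i)" for C
    proof -
      obtain g where g: "g \<in> carrier G" "C = g <#\<^bsub>G\<^esub> H i" using C by (auto simp: LCOSETS_def)
      then have "(i, C) = act g (base i)" by (simp add: act_def base_def)
      then show ?thesis using ev_act[OF M f(1) g(1) i] ev_act[OF M f(2) g(1) i] inv g ev_fixed[OF M f(1) i] ev_fixed[OF M f(2) i] by simp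
    qed
    then have "(\<Sum>C\<in>lcosets (H i). B (f (eps (i, C))) (f' (eps (i, C)))) = of_nat (card (lcosets (H i))) * B (ev i f) (ev i f')"
      by simp
    moreover have "of_nat (Coset.order G) = of_nat (card (lcosets (H i))) * (of_nat (card (H i)) :: complex)"
      using l_lagrange[OF fin_G sub_H[OF i]] by (metis of_nat_mult)
    moreover have "card (H i) \<noteq> 0"
      using sub_H[OF i] fin_G by (metis card_0_eq empty_iff finite_subset subgroup.one_closed subgroup.subset)
    ultimately show "(\<Sum>C\<in>lcosets (H i). B (f (eps (i, C))) (f' (eps (i, C))))
       = of_nat (Coset.order G) * (1 / of_nat (card (H i)) * B (ev i f) (ev i f'))" by simp
  qed
  finally have "(\<Sum>x\<in>X. B (f (eps x)) (f' (eps x))) = of_nat (Coset.order G) * hom_pairing B f f'"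
    by (simp add: hom_pairing_def sum_distrib_left)
  moreover have "Coset.order G \<noteq> 0" using fin_G order_gt_0_iff_finite by simp
  ultimately show ?thesis by simp
qed

end

section \<open>Finiteness of torsion and non-degeneracy on invariants\<close>

text \<open>A further torsion generator enlarges the group at most to its product with a finite
  cyclic subgroup, and in a commutative group that product is again a subgroup.\<close>

lemma (in comm_group) finite_generate_torsion:
  assumes "finite T" "T \<subseteq> torsion G"
  shows "finite (generate G T)"
  using assms
proof (induction T)
  case empty
  then show ?case by (simp add: generate_empty)
next
  case (insert t T)
  then obtain n :: nat where t: "t \<in> carrier G" "n > 0" "t [^] n = \<one>" by (auto simp: torsion_def)
  have T: "T \<subseteq> carrier G" using insert.prems by (auto simp: torsion_def)
  have "generate G {t} \<subseteq> (\<lambda>k::int. t [^] k) ` {0..<int n}"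
  proof
    fix x assume "x \<in> generate G {t}"
    then obtain k :: int where k: "x = t [^] k" using generate_pow[OF t(1)] by auto
    have "t [^] k = t [^] (int n * (k div int n) + k mod int n)" by simp
    also have "\<dots> = (t [^] int n) [^] (k div int n) \<otimes> t [^] (k mod int n)"
      using t(1) by (simp only: int_pow_mult int_pow_pow)
    also have "\<dots> = t [^] (k mod int n)" using t by (simp add: int_pow_int)
    finally show "x \<in> (\<lambda>k::int. t [^] k) ` {0..<int n}" using k t(2) by auto
  qed
  then have f1: "finite (generate G {t})" by (rule finite_subset) simp
  have f2: "finite (generate G T)" using insert by auto
  have s1: "subgroup (generate G {t}) G" using t by (intro generate_is_subgroup) auto
  have s2: "subgroup (generate G T) G" using T by (intro generate_is_subgroup) auto
  have "generate G (insert t T) \<subseteq> generate G {t} <#> generate G T"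
  proof (rule generate_subgroup_incl[OF _ mult_subgroups[OF s1 s2]])
    have "t \<in> generate G {t} <#> generate G T"
      unfolding set_mult_def using t subgroup.one_closed[OF s2] generate.incl[of t "{t}" G] r_one[OF t(1)] by fastforce
    moreover have "x \<in> generate G {t} <#> generate G T" if "x \<in> T" for x
      unfolding set_mult_def using that subgroup.one_closed[OF s1] generate.incl[of x T G] l_one[OF subsetD[OF T that]] by fastforce
    ultimately show "insert t T \<subseteq> generate G {t} <#> generate G T" by auto
  qed
  moreover have "finite (generate G {t} <#> generate G T)" unfolding set_mult_def using f1 f2 by auto
  ultimately show ?case by (rule finite_subset)
qed

lemma (in comm_group) mult_div_mult:
  assumes "x \<in> carrier G" "y \<in> carrier G" "a \<in> carrier G" "b \<in> carrier G"
  shows "x \<otimes> y \<otimes> inv (a \<otimes> b) = x \<otimes> inv a \<otimes> (y \<otimes> inv b)"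
  using assms by (simp add: inv_mult m_ac)

text \<open>Removing from \<open>x\<close> the product given by its coordinates defines an
  endomorphism \<open>r\<close> with torsion image that is the identity on torsion. Hence the
  torsion is generated by the images under \<open>r\<close> of finitely many generators of
  \<open>M\<close>, and these are torsion elements.\<close>

lemma finite_torsion:
  assumes fg: "finitely_generated_gmodule G M \<rho>" and "finite (carrier G)" and db: "dual_basis M bs ks"
  shows "finite (torsion M)"
proof -
  obtain S where gm: "gmodule G M \<rho>" and S: "finite S" "S \<subseteq> carrier M"
    "generate M (\<Union>g\<in>carrier G. \<rho> g ` S) = carrier M"
    using fg by (auto simp: finitely_generated_gmodule_def)
  note MD = gmoduleD[OF gm]
  interpret M: comm_group M by fact
  let ?S = "\<Union>g\<in>carrier G. \<rho> g ` S"
  have SM: "?S \<subseteq> carrier M" using MD(4) S(2) by auto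
  note D = dual_basisD[OF db]
  define p where "p x = finprod M (\<lambda>j. (bs ! j) [^]\<^bsub>M\<^esub> ((ks ! j) x)) {..<length bs}" for x
  have pM: "p x \<in> carrier M" for x unfolding p_def using D by (intro M.finprod_closed) auto
  have pm: "p (x \<otimes>\<^bsub>M\<^esub> y) = p x \<otimes>\<^bsub>M\<^esub> p y" if "x \<in> carrier M" "y \<in> carrier M" for x y
  proof -
    have "p (x \<otimes>\<^bsub>M\<^esub> y) = finprod M (\<lambda>j. (bs ! j) [^]\<^bsub>M\<^esub> ((ks ! j) x) \<otimes>\<^bsub>M\<^esub> (bs ! j) [^]\<^bsub>M\<^esub> ((ks ! j) y)) {..<length bs}"
      unfolding p_def using D that by (intro M.finprod_cong') (auto simp: additive_onD M.int_pow_mult)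
    also have "\<dots> = p x \<otimes>\<^bsub>M\<^esub> p y" unfolding p_def using D by (intro M.finprod_multf) auto
    finally show ?thesis .
  qed
  define r where "r x = x \<otimes>\<^bsub>M\<^esub> inv\<^bsub>M\<^esub> p x" for x
  have rh: "r \<in> hom M M"
  proof (rule homI)
    fix x y assume xy: "x \<in> carrier M" "y \<in> carrier M"
    show "r (x \<otimes>\<^bsub>M\<^esub> y) = r x \<otimes>\<^bsub>M\<^esub> r y"
      unfolding r_def pm[OF xy] by (rule M.mult_div_mult[OF xy pM pM])
  next
    fix x assume "x \<in> carrier M"
    then show "r x \<in> carrier M" unfolding r_def by (intro M.m_closed M.inv_closed pM)
  qed
  interpret r: group_hom M M r using rh by unfold_locales
  have rt: "r x \<in> torsion M" if "x \<in> carrier M" for x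
    using M.dual_basis_decomposition[OF db that] by (simp add: r_def p_def)
  have "torsion M \<subseteq> r ` carrier M"
  proof
    fix x assume x: "x \<in> torsion M"
    then have "(ks ! j) x = 0" if "j < length bs" for j using M.dual_basis_torsion_iff[OF db] that by auto
    then have "p x = finprod M (\<lambda>j. \<one>\<^bsub>M\<^esub>) {..<length bs}" unfolding p_def by (intro M.finprod_cong') auto
    moreover have xM: "x \<in> carrier M" using x by (simp add: torsion_def)
    ultimately have "r x = x" by (simp add: r_def)
    then show "x \<in> r ` carrier M" using xM by (intro image_eqI[of _ _ x]) auto
  qed
  also have "r ` carrier M = generate M (r ` ?S)"
    using r.generate_img[OF SM] S(3) by simp
  finally have "torsion M \<subseteq> generate M (r ` ?S)" .
  moreover have "finite (generate M (r ` ?S))"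
  proof (rule M.finite_generate_torsion)
    show "finite (r ` ?S)" using S(1) assms(2) by auto
    show "r ` ?S \<subseteq> torsion M" using rt SM by blast
  qed
  ultimately show ?thesis by (rule finite_subset)
qed

section \<open>Non-degeneracy of the pairing on invariants\<close>

lemma exists_dual_basis_fixed:
  assumes "gmodule G M \<rho>" "K \<subseteq> carrier G" "dual_basis M bs ks"
  shows "\<exists>cs ls. dual_basis (fixed_submodule M \<rho> K) cs ls"
proof (rule exists_dual_basis[of _ ks])
  interpret M: comm_group M by (rule gmoduleD) fact
  show "comm_group (fixed_submodule M \<rho> K)" using assms by (intro comm_group_fixed_submodule)
  show "\<forall>k\<in>set ks. additive_on (fixed_submodule M \<rho> K) k"
    using assms(3) by (auto simp: dual_basis_def additive_on_def)
  have "torsion (fixed_submodule M \<rho> K) = torsion M \<inter> {m \<in> carrier M. \<forall>h\<in>K. \<rho> h m = m}"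
    unfolding fixed_submodule_def by (rule M.torsion_subgroup) auto
  then show "\<forall>x\<in>carrier (fixed_submodule M \<rho> K). (\<forall>k\<in>set ks. k x = 0) \<longrightarrow> x \<in> torsion (fixed_submodule M \<rho> K)"
    using assms(3) by (auto simp: dual_basis_def)
qed

text \<open>The average over \<open>K\<close> multiplied by the order of \<open>K\<close>, so that
  it takes values in \<open>M\<close> itself.\<close>

definition norm_map :: "('m, 'b) monoid_scheme \<Rightarrow> ('g \<Rightarrow> 'm \<Rightarrow> 'm) \<Rightarrow> 'g set \<Rightarrow> 'm \<Rightarrow> 'm" where
  "norm_map M \<rho> K z = finprod M (\<lambda>h. \<rho> h z) K"

lemma norm_map:
  assumes gm: "gmodule G M \<rho>" and K: "subgroup K G" "finite (carrier G)"
  shows "norm_map M \<rho> K \<in> hom M (fixed_submodule M \<rho> K)"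
    "\<And>z. z \<in> carrier (fixed_submodule M \<rho> K) \<Longrightarrow> norm_map M \<rho> K z = z [^]\<^bsub>M\<^esub> card K"
proof -
  note MD = gmoduleD[OF gm]
  interpret M: comm_group M by fact
  interpret G: group G by fact
  interpret K: subgroup K G by fact
  have fK: "finite K" using K K.subset finite_subset by blast
  have fc: "(\<lambda>h. \<rho> h z) \<in> K \<rightarrow> carrier M" if "z \<in> carrier M" for z using MD(4) that K.subset by auto
  have fixd: "\<rho> g (norm_map M \<rho> K z) = norm_map M \<rho> K z" if g: "g \<in> K" and z: "z \<in> carrier M" for g z
  proof -
    have gG: "g \<in> carrier G" using g K.subset by auto
    have "\<rho> g (norm_map M \<rho> K z) = finprod M (\<lambda>h. \<rho> g (\<rho> h z)) K"
      unfolding norm_map_def by (rule M.hom_finprod[OF M.comm_group_axioms MD(3)[OF gG] fK fc[OF z]])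
    also have "\<dots> = finprod M (\<lambda>h. \<rho> (g \<otimes>\<^bsub>G\<^esub> h) z) K"
      using MD(4,5) K.subset gG z by (intro M.finprod_cong') auto
    also have "\<dots> = finprod M (\<lambda>h. \<rho> h z) ((\<lambda>h. g \<otimes>\<^bsub>G\<^esub> h) ` K)"
    proof (rule M.finprod_reindex[symmetric])
      show "(\<lambda>h. \<rho> h z) \<in> (\<lambda>h. g \<otimes>\<^bsub>G\<^esub> h) ` K \<rightarrow> carrier M" using fc[OF z] g by auto
      show "inj_on ((\<otimes>\<^bsub>G\<^esub>) g) K" using gG K.subset by (auto simp: inj_on_def)
    qed
    also have "(\<lambda>h. g \<otimes>\<^bsub>G\<^esub> h) ` K = K"
    proof
      show "K \<subseteq> (\<lambda>h. g \<otimes>\<^bsub>G\<^esub> h) ` K"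
      proof
        fix k assume k: "k \<in> K"
        then have "k = g \<otimes>\<^bsub>G\<^esub> (inv\<^bsub>G\<^esub> g \<otimes>\<^bsub>G\<^esub> k)" using gG K.subset by (auto simp: G.m_assoc[symmetric])
        then show "k \<in> (\<lambda>h. g \<otimes>\<^bsub>G\<^esub> h) ` K" using g k by blast
      qed
    qed (use g in auto)
    finally show ?thesis by (simp add: norm_map_def)
  qed
  show "norm_map M \<rho> K \<in> hom M (fixed_submodule M \<rho> K)"
  proof (rule homI)
    fix z assume z: "z \<in> carrier M"
    then show "norm_map M \<rho> K z \<in> carrier (fixed_submodule M \<rho> K)"
      using fixd fc by (auto simp: norm_map_def intro!: M.finprod_closed)
  next
    fix y z assume yz: "y \<in> carrier M" "z \<in> carrier M"
    have "norm_map M \<rho> K (y \<otimes>\<^bsub>M\<^esub> z) = finprod M (\<lambda>h. \<rho> h y \<otimes>\<^bsub>M\<^esub> \<rho> h z) K"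
      unfolding norm_map_def using yz MD(4) K.subset hom_mult[OF MD(3)]
      by (intro M.finprod_cong') auto
    then show "norm_map M \<rho> K (y \<otimes>\<^bsub>M\<^esub> z) = norm_map M \<rho> K y \<otimes>\<^bsub>fixed_submodule M \<rho> K\<^esub> norm_map M \<rho> K z"
      using M.finprod_multf[OF fc[OF yz(1)] fc[OF yz(2)]] by (simp add: norm_map_def)
  qed
  fix z assume z: "z \<in> carrier (fixed_submodule M \<rho> K)"
  then have "norm_map M \<rho> K z = finprod M (\<lambda>h. z) K"
    unfolding norm_map_def by (intro M.finprod_cong') auto
  then show "norm_map M \<rho> K z = z [^]\<^bsub>M\<^esub> card K" using z by (simp add: M.finprod_const)
qed

text \<open>Averaging over \<open>K\<close> shows that a vector orthogonal to \<open>M\<^sup>K\<close> is orthogonal to \<open>M\<close>.\<close>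

lemma pairing_det_fixed_nonzero:
  assumes gm: "gmodule G M \<rho>" and rp: "regulator_pairing G M \<rho> B" and K: "subgroup K G" "finite (carrier G)"
  shows "pairing_det (fixed_submodule M \<rho> K) (\<lambda>x y. 1 / of_nat (card K) * B x y) \<noteq> 0"
proof
  note MD = gmoduleD[OF gm]
  interpret M: comm_group M by fact
  interpret G: group G by fact
  interpret K: subgroup K G by fact
  let ?A = "fixed_submodule M \<rho> K" and ?F = "\<lambda>x y. 1 / of_nat (card K) * B x y"
  interpret A: comm_group ?A by (rule comm_group_fixed_submodule[OF gm K.subset])
  have fK: "finite K" using K K.subset finite_subset by blast
  have cK: "card K \<noteq> 0" using fK K.one_closed by (metis card_0_eq empty_iff)
  have bil: "bilinear_pairing M B" and inv: "\<And>g x y. g \<in> carrier G \<Longrightarrow> x \<in> carrier M \<Longrightarrow> y \<in> carrier M \<Longrightarrow> B (\<rho> g x) (\<rho> g y) = B x y"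
    using rp by (auto simp: regulator_pairing_def)
  obtain es where es: "basis_mod_torsion M es"
    "\<And>c. (\<forall>i<length es. (\<Sum>j<length es. c j * B (es ! i) (es ! j)) = 0) \<Longrightarrow> (\<forall>j<length es. c j = 0)"
    using rp unfolding regulator_pairing_def nondegenerate_mod_torsion_def by blast
  obtain ks where de: "dual_basis M es ks" using es(1) by (rule M.basis_mod_torsion_imp_dual_basis)
  obtain cs ls where dc: "dual_basis ?A cs ls" using exists_dual_basis_fixed[OF gm K.subset de] by blast
  note DE = dual_basisD[OF de] and DC = dual_basisD[OF dc]
  let ?m = "length cs" and ?n = "length es"
  have cA: "cs ! j \<in> carrier ?A" "cs ! j \<in> carrier M" if "j < ?m" for j using DC(2)[OF that] by auto
  have Badd1: "additive_on M (\<lambda>x. B x y)" if "y \<in> carrier M" for y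
    using bil that by (auto simp: bilinear_pairing_def additive_on_def)
  have Badd2: "additive_on M (B x)" if "x \<in> carrier M" for x
    using bil that by (auto simp: bilinear_pairing_def additive_on_def)
  note nm = norm_map[OF gm K]
  assume "pairing_det ?A ?F = 0"
  moreover have "pairing_det ?A ?F = det (gram ?F cs cs)"
    using bil by (intro A.pairing_det_eq_det_gram[OF dc]) (auto simp: bilinear_pairing_def algebra_simps add_divide_distrib)
  ultimately obtain v where v: "v \<in> carrier_vec ?m" "v \<noteq> 0\<^sub>v ?m" "gram ?F cs cs *\<^sub>v v = 0\<^sub>v ?m"
    using det_0_iff_vec_prod_zero[OF gram_carrier[of ?F cs cs]] by auto
  \<comment> \<open>The kernel vector \<open>v\<close> stands for the combination of the
    \<open>cs ! j\<close> with coefficients \<open>v $ j\<close> in the complexified invariants, and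
    \<open>L z\<close> is the pairing of \<open>z\<close> with it.\<close>
  define L where "L z = (\<Sum>j<?m. v $ j * B z (cs ! j))" for z
  have L: "additive_on M L"
    using additive_onD[OF Badd1[OF cA(2)]] by (auto simp: additive_on_def L_def algebra_simps sum.distrib)
  have "L (cs ! i) = 0" if i: "i < ?m" for i
  proof -
    have "(gram ?F cs cs *\<^sub>v v) $ i = (\<Sum>j<?m. 1 / of_nat (card K) * (v $ j * B (cs ! i) (cs ! j)))"
      using i v(1) by (auto simp: gram_def scalar_prod_def lessThan_atLeast0 algebra_simps intro!: sum.cong)
    then have "1 / of_nat (card K) * L (cs ! i) = 0" using v(3) i by (simp add: L_def sum_distrib_left)
    then show ?thesis using cK by simp
  qed
  moreover have "additive_on ?A L" using L by (auto simp: additive_on_def)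
  ultimately have LA: "L x = 0" if "x \<in> carrier ?A" for x
    using A.additive_on_expand[OF dc _ that, of L] by simp
  \<comment> \<open>The \<open>cs ! j\<close> are fixed and \<open>B\<close> is invariant, so
    \<open>z\<close> and its translates under \<open>K\<close> pair alike with them. Hence
    \<open>L\<close> takes the value \<open>card K * L z\<close> on the norm of \<open>z\<close>,
    where it is already known to vanish.\<close>
  have LM: "L z = 0" if z: "z \<in> carrier M" for z
  proof -
    have "B (norm_map M \<rho> K z) (cs ! j) = of_nat (card K) * B z (cs ! j)" if j: "j < ?m" for j
    proof -
      have "B (norm_map M \<rho> K z) (cs ! j) = (\<Sum>h\<in>K. B (\<rho> h z) (cs ! j))"
        unfolding norm_map_def using MD(4) z K.subset by (intro M.additive_on_finprod[OF Badd1[OF cA(2)[OF j]] fK]) auto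
      also have "\<dots> = (\<Sum>h\<in>K. B z (cs ! j))"
      proof (rule sum.cong[OF refl])
        fix h assume h: "h \<in> K"
        have "B (\<rho> h z) (cs ! j) = B (\<rho> h z) (\<rho> h (cs ! j))" using cA(1)[OF j] h by simp
        then show "B (\<rho> h z) (cs ! j) = B z (cs ! j)" using inv[OF _ z cA(2)[OF j]] h K.subset by auto
      qed
      finally show ?thesis by simp
    qed
    then have "L (norm_map M \<rho> K z) = of_nat (card K) * L z"
      by (simp add: L_def sum_distrib_left algebra_simps)
    then show ?thesis using LA[OF hom_in_carrier[OF nm(1) z]] cK by simp
  qed
  \<comment> \<open>The coordinates of the same element with respect to the basis \<open>es\<close>
    of \<open>M\<close>. They vanish because the right kernel of \<open>B\<close> is trivial over
    the complex numbers.\<close>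
  define d where "d k = (\<Sum>j<?m. v $ j * of_int ((ks ! k) (cs ! j)))" for k
  have d0: "d k = 0" if "k < ?n" for k
  proof -
    have "(\<Sum>k<?n. d k * B (es ! i) (es ! k)) = 0" if i: "i < ?n" for i
    proof -
      have "L (es ! i) = (\<Sum>j<?m. v $ j * (\<Sum>k<?n. of_int ((ks ! k) (cs ! j)) * B (es ! i) (es ! k)))"
        unfolding L_def using M.additive_on_expand[OF de Badd2[OF DE(2)[OF i]]] cA(2)
        by (intro sum.cong) auto
      also have "\<dots> = (\<Sum>k<?n. d k * B (es ! i) (es ! k))"
        unfolding d_def sum_distrib_left sum_distrib_right by (subst sum.swap) (simp add: mult.assoc)
      finally show ?thesis using LM[OF DE(2)[OF i]] by simp
    qed
    then show ?thesis using es(2)[of d] that by blast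
  qed
  \<comment> \<open>It remains to recover \<open>v\<close> from \<open>d\<close>. The coordinate
    \<open>ls ! i\<close> lives on the invariants only; composed with the norm it becomes a
    functional on \<open>M\<close> with value \<open>card K\<close> on \<open>cs ! i\<close> and 0
    on the other \<open>cs ! j\<close>.\<close>
  have "v $ i = 0" if i: "i < ?m" for i
  proof -
    have ladd: "additive_on M (\<lambda>x. of_int ((ls ! i) (norm_map M \<rho> K x)) :: complex)"
      using additive_on_comp[OF nm(1) DC(3)[OF i]] by (auto simp: additive_on_def)
    have "of_nat (card K) * v $ i = (\<Sum>j<?m. v $ j * (if i = j then of_nat (card K) else 0))"
      using i by (simp add: if_distrib[of "(*) _"] mult.commute cong: if_cong)
    also have "\<dots> = (\<Sum>j<?m. v $ j * of_int ((ls ! i) (norm_map M \<rho> K (cs ! j))))"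
    proof (rule sum.cong[OF refl])
      fix j assume "j \<in> {..<?m}"
      then have j: "j < ?m" by simp
      have "norm_map M \<rho> K (cs ! j) = (cs ! j) [^]\<^bsub>?A\<^esub> card K"
        using nm(2)[OF cA(1)[OF j]] M.nat_pow_consistent[of "cs ! j" "card K"] by (simp add: fixed_submodule_def)
      then have "(ls ! i) (norm_map M \<rho> K (cs ! j)) = int (card K) * (ls ! i) (cs ! j)"
        using A.additive_on_nat_pow[OF DC(3)[OF i] cA(1)[OF j]] by simp
      then show "v $ j * (if i = j then of_nat (card K) else 0) = v $ j * of_int ((ls ! i) (norm_map M \<rho> K (cs ! j)))"
        using DC(4)[OF i j] by simp
    qed
    also have "\<dots> = (\<Sum>j<?m. v $ j * (\<Sum>k<?n. of_int ((ks ! k) (cs ! j)) * of_int ((ls ! i) (norm_map M \<rho> K (es ! k)))))"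
      using M.additive_on_expand[OF de ladd] cA(2) by (intro sum.cong) auto
    also have "\<dots> = (\<Sum>k<?n. d k * of_int ((ls ! i) (norm_map M \<rho> K (es ! k))))"
      unfolding d_def sum_distrib_left sum_distrib_right by (subst sum.swap) (simp add: mult.assoc)
    also have "\<dots> = 0" using d0 by simp
    finally show ?thesis using cK by simp
  qed
  then have "v = 0\<^sub>v ?m" using v(1) by (intro eq_vecI) auto
  then show False using v(2) by simp
qed

section \<open>Rational isomorphisms and isogenies\<close>

text \<open>The class of the generator \<open>(x, q)\<close>, that is, the pure tensor of
  \<open>x\<close> and \<open>q\<close>.\<close>

definition tensor_elem :: "('m, 'b) monoid_scheme \<Rightarrow> 'm \<Rightarrow> rat \<Rightarrow> ('m \<times> rat \<Rightarrow>\<^sub>0 int) set" where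
  "tensor_elem M x q = tensor_rels M #>\<^bsub>tensor_gens M\<^esub> frag_of (x, q)"

abbreviation rel_gens :: "('m, 'b) monoid_scheme \<Rightarrow> ('m \<times> rat \<Rightarrow>\<^sub>0 int) set" where
  "rel_gens M \<equiv>
     {frag_of (x \<otimes>\<^bsub>M\<^esub> y, q) - frag_of (x, q) - frag_of (y, q) | x y q.
         x \<in> carrier M \<and> y \<in> carrier M} \<union>
      {frag_of (x, q + r) - frag_of (x, q) - frag_of (x, r) | x q r. x \<in> carrier M}"

lemma comm_group_tensor_gens: "comm_group (tensor_gens M)"
  by (simp add: tensor_gens_def abelian_free_Abelian_group)

context comm_group
begin

lemma frag_of_tensor_gens: "x \<in> carrier G \<Longrightarrow> frag_of (x, q) \<in> carrier (tensor_gens G)"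
  by (simp add: tensor_gens_def)

lemma diff_tensor_gens:
  assumes "s \<in> carrier (tensor_gens G)" "t \<in> carrier (tensor_gens G)"
  shows "s - t \<in> carrier (tensor_gens G)"
proof -
  interpret T: comm_group "tensor_gens G" by (rule comm_group_tensor_gens)
  have "inv\<^bsub>tensor_gens G\<^esub> t = - t" using assms(2) by (simp add: tensor_gens_def)
  then have "s \<otimes>\<^bsub>tensor_gens G\<^esub> inv\<^bsub>tensor_gens G\<^esub> t = s - t" by (simp add: tensor_gens_def)
  then show ?thesis using T.m_closed[OF assms(1) T.inv_closed[OF assms(2)]] by simp
qed

lemma rel_gens_subset: "rel_gens G \<subseteq> carrier (tensor_gens G)"
  by (auto intro!: diff_tensor_gens frag_of_tensor_gens)

lemma subgroup_tensor_rels: "subgroup (tensor_rels G) (tensor_gens G)"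
proof -
  interpret T: comm_group "tensor_gens G" by (rule comm_group_tensor_gens)
  show ?thesis unfolding tensor_rels_def using rel_gens_subset by (rule T.generate_is_subgroup)
qed

lemma comm_group_tensor_Q: "comm_group (tensor_Q G)"
  unfolding tensor_Q_def by (rule comm_group.abelian_FactGroup[OF comm_group_tensor_gens subgroup_tensor_rels])

lemma tensor_class_hom: "(\<lambda>t. tensor_rels G #>\<^bsub>tensor_gens G\<^esub> t) \<in> hom (tensor_gens G) (tensor_Q G)"
  unfolding tensor_Q_def
  by (rule normal.r_coset_hom_Mod) (simp add: comm_group.normal_iff_subgroup[OF comm_group_tensor_gens] subgroup_tensor_rels)

lemma tensor_class_eq_iff:
  assumes "s \<in> carrier (tensor_gens G)" "t \<in> carrier (tensor_gens G)"
  shows "tensor_rels G #>\<^bsub>tensor_gens G\<^esub> s = tensor_rels G #>\<^bsub>tensor_gens G\<^esub> t \<longleftrightarrow> s - t \<in> tensor_rels G"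
proof -
  interpret T: comm_group "tensor_gens G" by (rule comm_group_tensor_gens)
  interpret R: subgroup "tensor_rels G" "tensor_gens G" by (rule subgroup_tensor_rels)
  have "inv\<^bsub>tensor_gens G\<^esub> t = - t" using assms(2) by (simp add: tensor_gens_def)
  then have "s \<otimes>\<^bsub>tensor_gens G\<^esub> inv\<^bsub>tensor_gens G\<^esub> t = s - t" by (simp add: tensor_gens_def)
  then show ?thesis
    using R.rcos_module[OF T.is_group assms(2,1)] T.repr_independence[OF _ assms(2) R.subgroup_axioms]
      T.rcos_self[OF assms(1) R.subgroup_axioms] by metis
qed

lemma tensor_elem_closed: "x \<in> carrier G \<Longrightarrow> tensor_elem G x q \<in> carrier (tensor_Q G)"
  unfolding tensor_elem_def by (rule hom_in_carrier[OF tensor_class_hom frag_of_tensor_gens])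

text \<open>Handles both families of relations at once, since each of them writes one pure tensor as
  a sum of two.\<close>

lemma tensor_elem_rel:
  assumes "x \<in> carrier G" "y \<in> carrier G" "z \<in> carrier G"
    and "frag_of (x, p) - frag_of (y, q) - frag_of (z, r) \<in> rel_gens G"
  shows "tensor_elem G x p = tensor_elem G y q \<otimes>\<^bsub>tensor_Q G\<^esub> tensor_elem G z r"
proof -
  have "frag_of (x, p) - frag_of (y, q) - frag_of (z, r) \<in> tensor_rels G"
    unfolding tensor_rels_def using assms(4) by (rule generate.incl)
  then have "frag_of (x, p) - frag_of (y, q) \<otimes>\<^bsub>tensor_gens G\<^esub> frag_of (z, r) \<in> tensor_rels G"
    by (simp add: tensor_gens_def algebra_simps)
  moreover have "frag_of (y, q) \<otimes>\<^bsub>tensor_gens G\<^esub> frag_of (z, r) \<in> carrier (tensor_gens G)"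
    using assms by (intro monoid.m_closed group.is_monoid comm_group.axioms comm_group_tensor_gens frag_of_tensor_gens)
  ultimately have "tensor_elem G x p
     = tensor_rels G #>\<^bsub>tensor_gens G\<^esub> (frag_of (y, q) \<otimes>\<^bsub>tensor_gens G\<^esub> frag_of (z, r))"
    unfolding tensor_elem_def using tensor_class_eq_iff frag_of_tensor_gens assms by simp
  then show ?thesis
    unfolding tensor_elem_def using hom_mult[OF tensor_class_hom] frag_of_tensor_gens assms by simp
qed

lemma tensor_elem_mult:
  assumes "x \<in> carrier G" "y \<in> carrier G"
  shows "tensor_elem G (x \<otimes> y) q = tensor_elem G x q \<otimes>\<^bsub>tensor_Q G\<^esub> tensor_elem G y q"
  using assms by (intro tensor_elem_rel m_closed) blast+

lemma tensor_elem_add: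
  assumes "x \<in> carrier G"
  shows "tensor_elem G x (q + r) = tensor_elem G x q \<otimes>\<^bsub>tensor_Q G\<^esub> tensor_elem G x r"
  using assms by (intro tensor_elem_rel) blast+

lemma tensor_elem_hom: "(\<lambda>x. tensor_elem G x q) \<in> hom G (tensor_Q G)"
  by (intro homI tensor_elem_closed tensor_elem_mult)

lemma tensor_elem_group_hom: "group_hom G (tensor_Q G) (\<lambda>x. tensor_elem G x q)"
  using tensor_elem_hom comm_group_tensor_Q is_group
  by (auto simp: group_hom_def group_hom_axioms_def comm_group_def)

lemma tensor_elem_pow:
  assumes "x \<in> carrier G"
  shows "tensor_elem G (x [^] (n::nat)) q = tensor_elem G x q [^]\<^bsub>tensor_Q G\<^esub> n"
    "tensor_elem G (x [^] n) q = tensor_elem G x (of_nat n * q)"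
proof -
  interpret h: group_hom G "tensor_Q G" "\<lambda>x. tensor_elem G x q" by (rule tensor_elem_group_hom)
  show 1: "tensor_elem G (x [^] (n::nat)) q = tensor_elem G x q [^]\<^bsub>tensor_Q G\<^esub> n" for n
    using assms by (rule h.hom_nat_pow)
  have "tensor_elem G x 0 = \<one>\<^bsub>tensor_Q G\<^esub>"
    using tensor_elem_add[OF assms, of 0 0] tensor_elem_closed[OF assms, of 0] by (simp add: h.H.l_cancel_one')
  then show "tensor_elem G (x [^] n) q = tensor_elem G x (of_nat n * q)"
    by (induction n) (use assms in \<open>auto simp: tensor_elem_mult tensor_elem_add[symmetric] algebra_simps\<close>)
qed

lemma tensor_elem_inv:
  assumes "x \<in> carrier G"
  shows "tensor_elem G (inv x) q = inv\<^bsub>tensor_Q G\<^esub> tensor_elem G x q"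
    "tensor_elem G (inv x) q = tensor_elem G x (- q)"
proof -
  interpret h: group_hom G "tensor_Q G" "\<lambda>x. tensor_elem G x q" by (rule tensor_elem_group_hom)
  show 1: "tensor_elem G (inv x) q = inv\<^bsub>tensor_Q G\<^esub> tensor_elem G x q"
    using assms by (rule h.hom_inv)
  have "tensor_elem G x 0 = \<one>\<^bsub>tensor_Q G\<^esub>"
    using tensor_elem_add[OF assms, of 0 0] tensor_elem_closed[OF assms, of 0] by (simp add: h.H.l_cancel_one')
  then have "tensor_elem G x (- q) \<otimes>\<^bsub>tensor_Q G\<^esub> tensor_elem G x q = \<one>\<^bsub>tensor_Q G\<^esub>"
    using tensor_elem_add[OF assms, of "- q" q] by simp
  then show "tensor_elem G (inv x) q = tensor_elem G x (- q)"
    unfolding 1 using h.H.inv_equality tensor_elem_closed[OF assms] by auto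
qed

text \<open>A common denominator: tensors with second factors \<open>1 / m\<close> and
  \<open>1 / n\<close> are both rewritten with \<open>1 / (m * n)\<close>, so their difference is
  again pure. For a single generator the numerator of \<open>q\<close> moves into the first factor,
  through the inverse if it is negative.\<close>

lemma tensor_Q_elem_exists:
  assumes "X \<in> carrier (tensor_Q G)"
  obtains y n where "y \<in> carrier G" "n > 0" "X = tensor_elem G y (1 / of_nat n)"
proof -
  interpret Q: comm_group "tensor_Q G" by (rule comm_group_tensor_Q)
  let ?c = "\<lambda>t. tensor_rels G #>\<^bsub>tensor_gens G\<^esub> t"
  obtain t where t: "t \<in> carrier (tensor_gens G)" "X = ?c t"
    using assms unfolding tensor_Q_def carrier_FactGroup by auto
  have "\<exists>y n. y \<in> carrier G \<and> n > 0 \<and> ?c t = tensor_elem G y (1 / of_nat n)"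
  proof (rule free_Abelian_group_induct[of t "carrier G \<times> UNIV" "\<lambda>t. \<exists>y n. y \<in> carrier G \<and> n > 0 \<and> ?c t = tensor_elem G y (1 / of_nat n)"])
    show "Poly_Mapping.keys t \<subseteq> carrier G \<times> UNIV" using t by (simp add: tensor_gens_def)
    have "?c 0 = \<one>\<^bsub>tensor_Q G\<^esub>"
      using hom_one[OF tensor_class_hom] comm_group_tensor_gens Q.is_group
      by (simp add: comm_group_def tensor_gens_def)
    also have "\<dots> = tensor_elem G \<one> 1"
      using group_hom.hom_one[OF tensor_elem_group_hom] by simp
    finally show "\<exists>y n. y \<in> carrier G \<and> n > 0 \<and> ?c 0 = tensor_elem G y (1 / of_nat n)"
      by (intro exI[of _ \<one>] exI[of _ 1]) simp
  next
    fix s u assume su: "Poly_Mapping.keys s \<subseteq> carrier G \<times> (UNIV::rat set)" "Poly_Mapping.keys u \<subseteq> carrier G \<times> (UNIV::rat set)"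
      and ex: "\<exists>y n. y \<in> carrier G \<and> n > 0 \<and> ?c s = tensor_elem G y (1 / of_nat n)"
         "\<exists>y n. y \<in> carrier G \<and> n > 0 \<and> ?c u = tensor_elem G y (1 / of_nat n)"
    obtain y m z n where y: "y \<in> carrier G" "m > 0" "?c s = tensor_elem G y (1 / of_nat m)"
      and z: "z \<in> carrier G" "n > 0" "?c u = tensor_elem G z (1 / of_nat n)" using ex by blast
    have sT: "s \<in> carrier (tensor_gens G)" "u \<in> carrier (tensor_gens G)" using su by (auto simp: tensor_gens_def)
    have d: "s = (s - u) \<otimes>\<^bsub>tensor_gens G\<^esub> u" by (simp add: tensor_gens_def)
    have "?c s = ?c (s - u) \<otimes>\<^bsub>tensor_Q G\<^esub> ?c u"
      using hom_mult[OF tensor_class_hom diff_tensor_gens[OF sT] sT(2)] d by simp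
    then have "?c (s - u) = ?c s \<otimes>\<^bsub>tensor_Q G\<^esub> inv\<^bsub>tensor_Q G\<^esub> ?c u"
      using hom_in_carrier[OF tensor_class_hom] diff_tensor_gens[OF sT] sT by (simp add: Q.m_assoc)
    also have "?c s = tensor_elem G (y [^] n) (1 / of_nat (m * n))"
      using y z by (simp add: tensor_elem_pow(2))
    also have "?c u = tensor_elem G (z [^] m) (1 / of_nat (m * n))"
      using y z by (simp add: tensor_elem_pow(2))
    finally have "?c (s - u) = tensor_elem G (y [^] n \<otimes> inv (z [^] m)) (1 / of_nat (m * n))"
      using y z by (simp add: tensor_elem_mult tensor_elem_inv(1))
    then show "\<exists>y n. y \<in> carrier G \<and> n > 0 \<and> ?c (s - u) = tensor_elem G y (1 / of_nat n)"
      using y z by (intro exI[of _ "y [^] n \<otimes> inv (z [^] m)"] exI[of _ "m * n"]) auto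
  next
    fix a :: "'a \<times> rat" assume "a \<in> carrier G \<times> UNIV"
    then obtain x q where a: "a = (x, q)" "x \<in> carrier G" by auto
    obtain i j where "quotient_of q = (i, j)" by force
    then have ij: "q = of_int i / of_int j" "j > 0"
      using quotient_of_div quotient_of_denom_pos by auto
    show "\<exists>y n. y \<in> carrier G \<and> n > 0 \<and> ?c (frag_of a) = tensor_elem G y (1 / of_nat n)"
    proof (cases "i \<ge> 0")
      case True
      then have "q = of_nat (nat i) * (1 / of_nat (nat j))" using ij by simp
      then have "?c (frag_of a) = tensor_elem G (x [^] nat i) (1 / of_nat (nat j))"
        using tensor_elem_pow(2)[OF a(2)] a(1) by (simp add: tensor_elem_def[of G x])
      then show ?thesis using a ij by (intro exI[of _ "x [^] nat i"] exI[of _ "nat j"]) auto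
    next
      case False
      then have "q = - (of_nat (nat (- i)) * (1 / of_nat (nat j)))" using ij by simp
      then have "?c (frag_of a) = tensor_elem G (inv (x [^] nat (- i))) (1 / of_nat (nat j))"
        using tensor_elem_inv(2)[OF nat_pow_closed[OF a(2)]] tensor_elem_pow(2)[OF a(2)] a(1)
        by (simp add: tensor_elem_def[of G x])
      then show ?thesis using a ij by (intro exI[of _ "inv (x [^] nat (- i))"] exI[of _ "nat j"]) auto
    qed
  qed
  then show ?thesis using t that by blast
qed

text \<open>The extension \<open>?e\<close> of \<open>f\<close> and \<open>k\<close> to the free
  group maps relations to relations; for the second family this rests on the additivity of
  \<open>k\<close>. The image of a coset therefore lies in a single coset, which
  \<open>tensor_map\<close> fills up by adding all relations.\<close>

lemma tensor_map_elem:
  assumes f: "f \<in> hom G G" and k: "\<And>q r. k (q + r) = k q + k r" and x: "x \<in> carrier G"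
  shows "tensor_map G f k (tensor_elem G x q) = tensor_elem G (f x) (k q)"
proof -
  interpret T: comm_group "tensor_gens G" by (rule comm_group_tensor_gens)
  interpret R: subgroup "tensor_rels G" "tensor_gens G" by (rule subgroup_tensor_rels)
  let ?e = "frag_extend (\<lambda>(x, q). frag_of (f x, k q))"
  have fc: "f x \<in> carrier G" if "x \<in> carrier G" for x using hom_in_carrier[OF f that] .
  have e: "?e \<in> hom (tensor_gens G) (tensor_gens G)"
  proof (rule homI)
    fix t assume "t \<in> carrier (tensor_gens G)"
    then have "Poly_Mapping.keys t \<subseteq> carrier G \<times> UNIV" by (simp add: tensor_gens_def)
    then have "(\<Union>x\<in>Poly_Mapping.keys t. Poly_Mapping.keys ((\<lambda>(x, q). frag_of (f x, k q)) x)) \<subseteq> carrier G \<times> UNIV"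
      using fc by (auto simp: keys_frag_of)
    then show "?e t \<in> carrier (tensor_gens G)"
      using keys_frag_extend[of "\<lambda>(x, q). frag_of (f x, k q)" t] by (simp add: tensor_gens_def)
  qed (simp add: tensor_gens_def frag_extend_add)
  interpret e: group_hom "tensor_gens G" "tensor_gens G" ?e using e by unfold_locales
  have "?e ` rel_gens G \<subseteq> rel_gens G"
  proof
    fix z assume "z \<in> ?e ` rel_gens G"
    then consider x y q where "x \<in> carrier G" "y \<in> carrier G"
        "z = ?e (frag_of (x \<otimes> y, q) - frag_of (x, q) - frag_of (y, q))"
      | x q r where "x \<in> carrier G" "z = ?e (frag_of (x, q + r) - frag_of (x, q) - frag_of (x, r))"
      by blast
    then show "z \<in> rel_gens G"
    proof cases
      case 1
      then have "z = frag_of (f x \<otimes> f y, k q) - frag_of (f x, k q) - frag_of (f y, k q)"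
        by (simp add: frag_extend_diff hom_mult[OF f])
      then show ?thesis using 1 fc by blast
    next
      case 2
      then have "z = frag_of (f x, k q + k r) - frag_of (f x, k q) - frag_of (f x, k r)"
        by (simp add: frag_extend_diff k)
      then show ?thesis using 2 fc by blast
    qed
  qed
  then have eR: "?e ` tensor_rels G \<subseteq> tensor_rels G"
    unfolding tensor_rels_def e.generate_img[OF rel_gens_subset, symmetric] by (rule T.mono_generate)
  have "tensor_map G f k (tensor_elem G x q) = tensor_rels G #>\<^bsub>tensor_gens G\<^esub> ?e (frag_of (x, q))"
  proof
    show "tensor_map G f k (tensor_elem G x q) \<subseteq> tensor_rels G #>\<^bsub>tensor_gens G\<^esub> ?e (frag_of (x, q))"
    proof
      fix z assume "z \<in> tensor_map G f k (tensor_elem G x q)"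
      then obtain r s where rs: "r \<in> tensor_rels G" "s \<in> tensor_rels G" "z = r + ?e (s + frag_of (x, q))"
        by (auto simp: tensor_map_def tensor_elem_def set_mult_def r_coset_def tensor_gens_def)
      then have "z = (r + ?e s) + ?e (frag_of (x, q))" by (simp add: frag_extend_add)
      moreover have "r + ?e s \<in> tensor_rels G"
        using R.m_closed[OF rs(1), of "?e s"] eR rs(2) by (auto simp: tensor_gens_def)
      ultimately show "z \<in> tensor_rels G #>\<^bsub>tensor_gens G\<^esub> ?e (frag_of (x, q))"
        by (auto simp: r_coset_def tensor_gens_def)
    qed
    have z: "0 \<in> tensor_rels G" using R.one_closed by (simp add: tensor_gens_def)
    show "tensor_rels G #>\<^bsub>tensor_gens G\<^esub> ?e (frag_of (x, q)) \<subseteq> tensor_map G f k (tensor_elem G x q)"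
    proof
      fix w assume "w \<in> tensor_rels G #>\<^bsub>tensor_gens G\<^esub> ?e (frag_of (x, q))"
      then obtain r where r: "r \<in> tensor_rels G" "w = r + ?e (0 + frag_of (x, q))"
        by (auto simp: r_coset_def tensor_gens_def)
      have "0 + frag_of (x, q) \<in> tensor_elem G x q"
        using z unfolding tensor_elem_def r_coset_def tensor_gens_def by auto
      then have m: "?e (0 + frag_of (x, q)) \<in> ?e ` tensor_elem G x q" by (rule imageI)
      have "w = r \<otimes>\<^bsub>tensor_gens G\<^esub> ?e (0 + frag_of (x, q))" using r(2) by (simp add: tensor_gens_def)
      then show "w \<in> tensor_map G f k (tensor_elem G x q)"
        unfolding tensor_map_def set_mult_def by (intro UN_I[OF r(1)] UN_I[OF m]) simp
    qed
  qed
  then show ?thesis by (simp add: tensor_elem_def)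
qed

text \<open>The coordinates extend to \<open>M \<otimes> \<rat>\<close>, so they detect the kernel of \<open>x \<mapsto> x \<otimes> 1\<close>.\<close>

lemma tensor_elem_eq_imp_torsion:
  assumes db: "dual_basis G bs ks" and xy: "x \<in> carrier G" "y \<in> carrier G"
    and eq: "tensor_elem G x 1 = tensor_elem G y 1"
  shows "x \<otimes> inv y \<in> torsion G"
proof (rule dual_basisD(5)[OF db])
  show "x \<otimes> inv y \<in> carrier G" using xy by simp
  fix i assume i: "i < length bs"
  have k: "additive_on G (ks ! i)" using dual_basisD(3)[OF db i] .
  \<comment> \<open>The additive group of the rationals as a record, the target in the universal
    property of the free abelian group.\<close>
  define A :: "rat monoid" where "A = \<lparr>carrier = UNIV, monoid.mult = (+), one = 0\<rparr>"
  interpret A: comm_group A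
  proof (rule comm_groupI)
    fix q assume "q \<in> carrier A"
    show "\<exists>r\<in>carrier A. r \<otimes>\<^bsub>A\<^esub> q = \<one>\<^bsub>A\<^esub>" by (auto simp: A_def intro: exI[of _ "- q"])
  qed (auto simp: A_def)
  obtain h where h: "h \<in> hom (free_Abelian_group (carrier G \<times> (UNIV::rat set))) A"
    "\<And>a. a \<in> carrier G \<times> UNIV \<Longrightarrow> h (frag_of a) = (\<lambda>(x, q). of_int ((ks ! i) x) * q) a"
    by (rule A.free_Abelian_group_universal[of "\<lambda>(x, q). of_int ((ks ! i) x) * q" "carrier G \<times> UNIV"]) (auto simp: A_def)
  have hT: "h \<in> hom (tensor_gens G) A" using h(1) by (simp add: tensor_gens_def)
  interpret T: comm_group "tensor_gens G" by (rule comm_group_tensor_gens)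
  interpret h: group_hom "tensor_gens G" A h using hT by unfold_locales
  have hd: "h (s - t) = h s - h t" if st: "s \<in> carrier (tensor_gens G)" "t \<in> carrier (tensor_gens G)" for s t
  proof -
    have "h s = h ((s - t) \<otimes>\<^bsub>tensor_gens G\<^esub> t)" by (simp add: tensor_gens_def)
    also have "\<dots> = h (s - t) + h t" using h.hom_mult[OF diff_tensor_gens[OF st] st(2)] by (simp add: A_def)
    finally show ?thesis by simp
  qed
  have hf: "h (frag_of (x, q)) = of_int ((ks ! i) x) * q" if "x \<in> carrier G" for x q using h(2)[of "(x, q)"] that by simp
  have "rel_gens G \<subseteq> kernel (tensor_gens G) A h"
  proof
    fix z assume z: "z \<in> rel_gens G"
    then consider x y q where "x \<in> carrier G" "y \<in> carrier G"
        "z = frag_of (x \<otimes> y, q) - frag_of (x, q) - frag_of (y, q)"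
      | x q r where "x \<in> carrier G" "z = frag_of (x, q + r) - frag_of (x, q) - frag_of (x, r)"
      by blast
    then have "h z = 0"
    proof cases
      case 1
      then show ?thesis
        using k by (simp add: hd hf diff_tensor_gens frag_of_tensor_gens additive_onD ring_distribs)
    next
      case 2
      then show ?thesis
        by (simp add: hd hf diff_tensor_gens frag_of_tensor_gens ring_distribs)
    qed
    moreover have "z \<in> carrier (tensor_gens G)" using rel_gens_subset z by blast
    ultimately show "z \<in> kernel (tensor_gens G) A h" by (simp add: kernel_def A_def)
  qed
  then have "tensor_rels G \<subseteq> kernel (tensor_gens G) A h"
    unfolding tensor_rels_def by (rule T.generate_subgroup_incl[OF _ h.subgroup_kernel])
  moreover have "frag_of (x, 1) - frag_of (y, 1) \<in> tensor_rels G"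
    using eq tensor_class_eq_iff frag_of_tensor_gens xy unfolding tensor_elem_def by blast
  ultimately have "h (frag_of (x, 1) - frag_of (y, 1)) = 0" by (auto simp: kernel_def A_def)
  then have "(ks ! i) x = (ks ! i) y" using xy by (simp add: hd hf frag_of_tensor_gens)
  then show "(ks ! i) (x \<otimes> inv y) = 0" using k xy by (simp add: additive_onD additive_on_inv)
qed

section \<open>Killing torsion and clearing denominators\<close>

lemma pow_card_torsion: "finite (torsion G) \<Longrightarrow> x \<in> torsion G \<Longrightarrow> x [^] card (torsion G) = \<one>"
  using comm_group.power_order_eq_one[OF comm_group_subgroup[OF subgroup_torsion], of x]
  by (simp add: nat_pow_consistent[symmetric])

end

text \<open>A pure tensor with second factor 1 determines its first factor up to torsion, and the
  order of the finite torsion group kills this ambiguity.\<close>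

lemma (in comm_group) tensor_elem_eq_imp_pow_eq:
  assumes "dual_basis G bs ks" "finite (torsion G)" "x \<in> carrier G" "y \<in> carrier G"
    and "tensor_elem G x 1 = tensor_elem G y 1"
  shows "x [^] card (torsion G) = y [^] card (torsion G)"
proof -
  have "(x \<otimes> inv y) [^] card (torsion G) = \<one>"
    using pow_card_torsion[OF assms(2) tensor_elem_eq_imp_torsion[OF assms(1,3,4,5)]] .
  then have "x [^] card (torsion G) \<otimes> inv (y [^] card (torsion G)) = \<one>"
    using assms by (simp add: pow_mult_distrib m_comm nat_pow_inv)
  then show ?thesis using assms by (metis inv_closed inv_equality inv_inv nat_pow_closed)
qed

lemma (in comm_group) card_torsion_pos: "finite (torsion G) \<Longrightarrow> card (torsion G) > 0"
  using subgroup.one_closed[OF subgroup_torsion] by (metis card_gt_0_iff empty_iff)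

text \<open>One exponent \<open>D\<close> clears the denominators of \<open>\<psi>\<close> on a
  finite generating set, hence everywhere. The elements \<open>y x\<close> chosen afterwards are
  determined only up to torsion and need not form a homomorphism; their \<open>t\<close>-th powers,
  with \<open>t\<close> the order of the torsion of \<open>N\<close>, do, and are equivariant for
  the same reason.\<close>

lemma rational_hom_lift:
  assumes fg: "finitely_generated_gmodule G M \<rho>" and gN: "gmodule G N \<sigma>" and fin: "finite (carrier G)"
    and dbN: "dual_basis N bs ks" and tN: "finite (torsion N)"
    and psi: "\<psi> \<in> hom (tensor_Q M) (tensor_Q N)"
    and eqv: "equivariant G (tensor_Q M) (\<lambda>g. tensor_map M (\<rho> g) id) (\<lambda>g. tensor_map N (\<sigma> g) id) \<psi>"
  obtains \<alpha> k where "\<alpha> \<in> hom M N" "equivariant G M \<rho> \<sigma> \<alpha>" "k > 0"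
    "\<And>x. x \<in> carrier M \<Longrightarrow> \<psi> (tensor_elem M (x [^]\<^bsub>M\<^esub> (k::nat)) 1) = tensor_elem N (\<alpha> x) 1"
proof -
  obtain S where gM: "gmodule G M \<rho>" and S: "finite S" "S \<subseteq> carrier M"
    "generate M (\<Union>g\<in>carrier G. \<rho> g ` S) = carrier M"
    using fg by (auto simp: finitely_generated_gmodule_def)
  note MD = gmoduleD[OF gM] and ND = gmoduleD[OF gN]
  interpret M: comm_group M by fact
  interpret N: comm_group N by fact
  interpret QM: comm_group "tensor_Q M" by (rule M.comm_group_tensor_Q)
  interpret QN: comm_group "tensor_Q N" by (rule N.comm_group_tensor_Q)
  interpret psi: group_hom "tensor_Q M" "tensor_Q N" \<psi> using psi by unfold_locales
  note teM = M.tensor_elem_closed and teN = N.tensor_elem_closed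
  \<comment> \<open>The elements whose denominators \<open>D\<close> clears. They form a subgroup
    that can only grow when \<open>D\<close> is replaced by a multiple, so the product of exponents
    for the generators works for all of \<open>M\<close>.\<close>
  define T where "T D = {x \<in> carrier M. \<exists>y\<in>carrier N. \<psi> (tensor_elem M (x [^]\<^bsub>M\<^esub> (D::nat)) 1) = tensor_elem N y 1}" for D
  have psi_pow: "\<psi> (tensor_elem M (x [^]\<^bsub>M\<^esub> (n * m)) 1) = tensor_elem N (y [^]\<^bsub>N\<^esub> m) 1"
    if "x \<in> carrier M" "y \<in> carrier N" "\<psi> (tensor_elem M (x [^]\<^bsub>M\<^esub> n) 1) = tensor_elem N y 1" for x y and n m :: nat
    using that M.tensor_elem_pow(1)[of "x [^]\<^bsub>M\<^esub> n" m 1] N.tensor_elem_pow(1)[of y m 1]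
      psi.hom_nat_pow[OF teM[of "x [^]\<^bsub>M\<^esub> n" 1], of m] by (simp add: M.nat_pow_pow)
  have psi_mult: "\<psi> (tensor_elem M ((x \<otimes>\<^bsub>M\<^esub> x') [^]\<^bsub>M\<^esub> n) 1) = tensor_elem N (y \<otimes>\<^bsub>N\<^esub> y') 1"
    if "x \<in> carrier M" "y \<in> carrier N" "\<psi> (tensor_elem M (x [^]\<^bsub>M\<^esub> n) 1) = tensor_elem N y 1"
       "x' \<in> carrier M" "y' \<in> carrier N" "\<psi> (tensor_elem M (x' [^]\<^bsub>M\<^esub> n) 1) = tensor_elem N y' 1" for x y x' y' and n :: nat
    using that teM by (simp add: M.nat_pow_distrib M.tensor_elem_mult N.tensor_elem_mult psi.hom_mult)
  have exD: "\<exists>D>0. x \<in> T D" if x: "x \<in> carrier M" for x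
  proof -
    obtain y n where y: "y \<in> carrier N" "n > 0" "\<psi> (tensor_elem M x 1) = tensor_elem N y (1 / of_nat n)"
      using N.tensor_Q_elem_exists[OF psi.hom_closed[OF teM[OF x, of 1]]] by blast
    have "\<psi> (tensor_elem M (x [^]\<^bsub>M\<^esub> n) 1) = tensor_elem N y (1 / of_nat n) [^]\<^bsub>tensor_Q N\<^esub> n"
      using M.tensor_elem_pow(1)[OF x, of n 1] psi.hom_nat_pow[OF teM[OF x, of 1], of n] y(3) by simp
    also have "\<dots> = tensor_elem N y 1"
      using N.tensor_elem_pow[OF y(1), of n "1 / of_nat n"] y(2) by simp
    finally show ?thesis using x y by (auto simp: T_def)
  qed
  have subT: "subgroup (T D) M" for D
  proof (rule M.subgroupI)
    have "\<psi> (tensor_elem M (\<one>\<^bsub>M\<^esub> [^]\<^bsub>M\<^esub> D) 1) = tensor_elem N \<one>\<^bsub>N\<^esub> 1"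
      using group_hom.hom_one[OF M.tensor_elem_group_hom, of 1] group_hom.hom_one[OF N.tensor_elem_group_hom, of 1] by simp
    then have "\<one>\<^bsub>M\<^esub> \<in> T D" unfolding T_def by blast
    then show "T D \<noteq> {}" by blast
    fix x x' assume xx: "x \<in> T D" "x' \<in> T D"
    then show "x \<otimes>\<^bsub>M\<^esub> x' \<in> T D" using psi_mult unfolding T_def by blast
  next
    fix x assume "x \<in> T D"
    then obtain y where y: "x \<in> carrier M" "y \<in> carrier N" "\<psi> (tensor_elem M (x [^]\<^bsub>M\<^esub> D) 1) = tensor_elem N y 1"
      by (auto simp: T_def)
    have "\<psi> (tensor_elem M (inv\<^bsub>M\<^esub> x [^]\<^bsub>M\<^esub> D) 1) = tensor_elem N (inv\<^bsub>N\<^esub> y) 1"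
      using y teM by (simp add: M.nat_pow_inv M.tensor_elem_inv(1) N.tensor_elem_inv(1) psi.hom_inv)
    then show "inv\<^bsub>M\<^esub> x \<in> T D" using y unfolding T_def by blast
  qed (auto simp: T_def)
  have mono: "x \<in> T (D * E)" if "x \<in> T D" for x D E
    using that psi_pow[of x _ D E] unfolding T_def by blast
  let ?S = "\<Union>g\<in>carrier G. \<rho> g ` S"
  have fS: "finite ?S" using S(1) fin by auto
  have SM: "?S \<subseteq> carrier M" using MD(4) S(2) by auto
  obtain d where d: "\<And>s. s \<in> ?S \<Longrightarrow> d s > 0 \<and> s \<in> T (d s)"
  proof -
    have "\<forall>s\<in>?S. \<exists>D. D > 0 \<and> s \<in> T D" using exD SM by (meson subsetD)
    from bchoice[OF this] obtain d where "\<forall>s\<in>?S. d s > 0 \<and> s \<in> T (d s)" ..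
    then show ?thesis by (intro that[of d]) (rule bspec)
  qed
  define D where "D = prod d ?S"
  have Dpos: "D > 0" unfolding D_def using d by (intro prod_pos) blast
  have "s \<in> T D" if "s \<in> ?S" for s
  proof -
    have "D = d s * prod d (?S - {s})" unfolding D_def using fS that by (rule prod.remove)
    then show ?thesis using mono d[OF that] by simp
  qed
  then have "generate M ?S \<subseteq> T D" by (intro M.generate_subgroup_incl subT) blast
  then have "\<forall>x\<in>carrier M. \<exists>y. y \<in> carrier N \<and> \<psi> (tensor_elem M (x [^]\<^bsub>M\<^esub> D) 1) = tensor_elem N y 1"
    unfolding S(3) T_def by blast
  then obtain y where y: "\<And>x. x \<in> carrier M \<Longrightarrow> y x \<in> carrier N \<and> \<psi> (tensor_elem M (x [^]\<^bsub>M\<^esub> D) 1) = tensor_elem N (y x) 1"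
    using bchoice[of "carrier M" "\<lambda>x y. y \<in> carrier N \<and> \<psi> (tensor_elem M (x [^]\<^bsub>M\<^esub> D) 1) = tensor_elem N y 1"] by blast
  define t where "t = card (torsion N)"
  have tpos: "t > 0" unfolding t_def by (rule N.card_torsion_pos[OF tN])
  note eqp = N.tensor_elem_eq_imp_pow_eq[OF dbN tN, folded t_def]
  define \<alpha> where "\<alpha> x = y x [^]\<^bsub>N\<^esub> t" for x
  show ?thesis
  proof (rule that[of \<alpha> "D * t"])
    show "\<alpha> \<in> hom M N"
    proof (rule homI)
      fix x x' assume xx: "x \<in> carrier M" "x' \<in> carrier M"
      have "tensor_elem N (y (x \<otimes>\<^bsub>M\<^esub> x')) 1 = tensor_elem N (y x \<otimes>\<^bsub>N\<^esub> y x') 1"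
        using psi_mult[of x "y x" D x' "y x'"] y[OF xx(1)] y[OF xx(2)] y[OF M.m_closed[OF xx]] xx by simp
      then have "\<alpha> (x \<otimes>\<^bsub>M\<^esub> x') = (y x \<otimes>\<^bsub>N\<^esub> y x') [^]\<^bsub>N\<^esub> t"
        unfolding \<alpha>_def using y[OF xx(1)] y[OF xx(2)] y[OF M.m_closed[OF xx]] by (intro eqp) auto
      then show "\<alpha> (x \<otimes>\<^bsub>M\<^esub> x') = \<alpha> x \<otimes>\<^bsub>N\<^esub> \<alpha> x'"
        using y[OF xx(1)] y[OF xx(2)] by (simp add: \<alpha>_def N.pow_mult_distrib N.m_comm)
    qed (use y in \<open>simp add: \<alpha>_def\<close>)
    show "equivariant G M \<rho> \<sigma> \<alpha>"
      unfolding equivariant_def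
    proof (intro ballI)
      fix g x assume g: "g \<in> carrier G" and x: "x \<in> carrier M"
      have rx: "\<rho> g x \<in> carrier M" using MD(4)[OF g x] .
      have pow: "\<rho> g x [^]\<^bsub>M\<^esub> D = \<rho> g (x [^]\<^bsub>M\<^esub> D)"
        using group_hom.hom_nat_pow[of M M "\<rho> g" x D] MD(3)[OF g] M.is_group x by (simp add: group_hom_def group_hom_axioms_def)
      have "tensor_elem N (y (\<rho> g x)) 1 = \<psi> (tensor_elem M (\<rho> g (x [^]\<^bsub>M\<^esub> D)) 1)" using y[OF rx] pow by simp
      also have "tensor_elem M (\<rho> g (x [^]\<^bsub>M\<^esub> D)) 1 = tensor_map M (\<rho> g) id (tensor_elem M (x [^]\<^bsub>M\<^esub> D) 1)"
        using M.tensor_map_elem[OF MD(3)[OF g], of id "x [^]\<^bsub>M\<^esub> D" 1] x by simp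
      also have "\<psi> \<dots> = tensor_map N (\<sigma> g) id (\<psi> (tensor_elem M (x [^]\<^bsub>M\<^esub> D) 1))"
        using eqv g teM[of "x [^]\<^bsub>M\<^esub> D" 1] x by (auto simp: equivariant_def)
      also have "\<dots> = tensor_elem N (\<sigma> g (y x)) 1"
        using N.tensor_map_elem[OF ND(3)[OF g], of id "y x" 1] y[OF x] by simp
      finally have "\<alpha> (\<rho> g x) = \<sigma> g (y x) [^]\<^bsub>N\<^esub> t"
        unfolding \<alpha>_def using y[OF x] y[OF rx] ND(4)[OF g] by (intro eqp) auto
      also have "\<dots> = \<sigma> g (\<alpha> x)"
        unfolding \<alpha>_def using group_hom.hom_nat_pow[of N N "\<sigma> g" "y x" t] ND(3)[OF g] N.is_group y[OF x]
        by (simp add: group_hom_def group_hom_axioms_def)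
      finally show "\<alpha> (\<rho> g x) = \<sigma> g (\<alpha> x)" .
    qed
    show "D * t > 0" using Dpos tpos by simp
    fix x assume x: "x \<in> carrier M"
    show "\<psi> (tensor_elem M (x [^]\<^bsub>M\<^esub> (D * t)) 1) = tensor_elem N (\<alpha> x) 1"
      unfolding \<alpha>_def using psi_pow[OF x, of "y x" D t] y[OF x] by simp
  qed
qed

text \<open>After tensoring, the composition of the lifts becomes raising to the power
  \<open>k * l\<close>, one factor from each lift; the return to \<open>M\<close> costs the power
  \<open>card (torsion M)\<close>.\<close>

lemma rational_lift_comp:
  assumes "comm_group M" "comm_group N" and db: "dual_basis M as ls" and fin: "finite (torsion M)"
    and psi: "\<psi>' \<in> hom (tensor_Q N) (tensor_Q M)" "\<psi> \<in> hom (tensor_Q M) (tensor_Q N)"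
    and inv: "\<And>X. X \<in> carrier (tensor_Q M) \<Longrightarrow> \<psi>' (\<psi> X) = X"
    and a: "\<alpha> \<in> hom M N" "\<And>x. x \<in> carrier M \<Longrightarrow> \<psi> (tensor_elem M (x [^]\<^bsub>M\<^esub> (k::nat)) 1) = tensor_elem N (\<alpha> x) 1"
    and b: "\<beta> \<in> hom N M" "\<And>y. y \<in> carrier N \<Longrightarrow> \<psi>' (tensor_elem N (y [^]\<^bsub>N\<^esub> (l::nat)) 1) = tensor_elem M (\<beta> y) 1"
    and x: "x \<in> carrier M"
  shows "\<beta> (\<alpha> x) [^]\<^bsub>M\<^esub> card (torsion M) = x [^]\<^bsub>M\<^esub> (k * l * card (torsion M))"
proof -
  interpret M: comm_group M by fact
  interpret N: comm_group N by fact
  interpret p: group_hom "tensor_Q M" "tensor_Q N" \<psi>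
    using psi(2) M.comm_group_tensor_Q N.comm_group_tensor_Q by (auto simp: group_hom_def group_hom_axioms_def comm_group_def)
  interpret p': group_hom "tensor_Q N" "tensor_Q M" \<psi>' using psi(1) by unfold_locales
  have ax: "\<alpha> x \<in> carrier N" using a(1) x by (rule hom_in_carrier)
  have bax: "\<beta> (\<alpha> x) \<in> carrier M" using b(1) ax by (rule hom_in_carrier)
  have "tensor_elem M (\<beta> (\<alpha> x)) 1 = \<psi>' (tensor_elem N (\<alpha> x) 1 [^]\<^bsub>tensor_Q N\<^esub> l)"
    using b(2)[OF ax] N.tensor_elem_pow(1)[OF ax, of l 1] by simp
  also have "\<dots> = \<psi>' (\<psi> (tensor_elem M (x [^]\<^bsub>M\<^esub> k) 1) [^]\<^bsub>tensor_Q N\<^esub> l)" using a(2)[OF x] by simp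
  also have "\<dots> = tensor_elem M (x [^]\<^bsub>M\<^esub> k) 1 [^]\<^bsub>tensor_Q M\<^esub> l"
    using x M.tensor_elem_closed[of "x [^]\<^bsub>M\<^esub> k" 1] by (simp add: p'.hom_nat_pow inv)
  also have "\<dots> = tensor_elem M (x [^]\<^bsub>M\<^esub> (k * l)) 1"
    using M.tensor_elem_pow(1)[of "x [^]\<^bsub>M\<^esub> k" l 1] x by (simp add: M.nat_pow_pow)
  finally have "\<beta> (\<alpha> x) [^]\<^bsub>M\<^esub> card (torsion M) = (x [^]\<^bsub>M\<^esub> (k * l)) [^]\<^bsub>M\<^esub> card (torsion M)"
    using x bax by (intro M.tensor_elem_eq_imp_pow_eq[OF db fin]) auto
  then show ?thesis using x by (simp add: M.nat_pow_pow)
qed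

text \<open>Both \<open>\<psi>\<close> and its inverse lift. The compositions of the lifts are
  controlled only after a further power \<open>t\<close>; replacing \<open>\<beta>\<close> alone by
  its \<open>t\<close>-th power repairs both compositions, as \<open>\<alpha>\<close> commutes with
  powers.\<close>

lemma rationally_isomorphic_imp_isogeny:
  assumes fgM: "finitely_generated_gmodule G M \<rho>" and fgN: "finitely_generated_gmodule G N \<sigma>"
    and fin: "finite (carrier G)"
    and dbM: "dual_basis M as ls" and dbN: "dual_basis N bs ks"
    and ri: "rationally_isomorphic G M \<rho> N \<sigma>"
  obtains \<alpha> \<beta> k where "isogeny M N \<alpha> \<beta> k" "equivariant G M \<rho> \<sigma> \<alpha>" "equivariant G N \<sigma> \<rho> \<beta>"
proof -
  have gM: "gmodule G M \<rho>" and gN: "gmodule G N \<sigma>" using fgM fgN by (auto simp: finitely_generated_gmodule_def)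
  note MD = gmoduleD[OF gM] and ND = gmoduleD[OF gN]
  interpret M: comm_group M by fact
  interpret N: comm_group N by fact
  interpret QM: comm_group "tensor_Q M" by (rule M.comm_group_tensor_Q)
  interpret QN: comm_group "tensor_Q N" by (rule N.comm_group_tensor_Q)
  have tM: "finite (torsion M)" by (rule finite_torsion[OF fgM fin dbM])
  have tN: "finite (torsion N)" by (rule finite_torsion[OF fgN fin dbN])
  obtain \<psi> where psi: "\<psi> \<in> iso (tensor_Q M) (tensor_Q N)"
    and eqv: "equivariant G (tensor_Q M) (\<lambda>g. tensor_map M (\<rho> g) id) (\<lambda>g. tensor_map N (\<sigma> g) id) \<psi>"
    using ri by (auto simp: rationally_isomorphic_def)
  define \<psi>' where "\<psi>' = inv_into (carrier (tensor_Q M)) \<psi>"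
  have psi': "\<psi>' \<in> iso (tensor_Q N) (tensor_Q M)" unfolding \<psi>'_def by (rule QM.iso_set_sym[OF psi])
  have bij: "bij_betw \<psi> (carrier (tensor_Q M)) (carrier (tensor_Q N))" using psi by (simp add: iso_def)
  have inv1: "\<psi>' (\<psi> X) = X" if "X \<in> carrier (tensor_Q M)" for X
    unfolding \<psi>'_def using bij that by (rule bij_betw_inv_into_left)
  have inv2: "\<psi> (\<psi>' Y) = Y" if "Y \<in> carrier (tensor_Q N)" for Y
    unfolding \<psi>'_def using bij that by (rule bij_betw_inv_into_right)
  have h: "\<psi> \<in> hom (tensor_Q M) (tensor_Q N)" "\<psi>' \<in> hom (tensor_Q N) (tensor_Q M)"
    using psi psi' by (auto simp: iso_def)
  \<comment> \<open>The inverse of \<open>\<psi>\<close> cancels only inside the carrier, so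
    equivariance of the inverse requires the action to preserve it. Every element being a pure
    tensor, this can be read off \<open>tensor_map_elem\<close>.\<close>
  have actM: "tensor_map M (\<rho> g) id X \<in> carrier (tensor_Q M)" if g: "g \<in> carrier G" and X: "X \<in> carrier (tensor_Q M)" for g X
  proof -
    obtain y n where "y \<in> carrier M" "X = tensor_elem M y (1 / of_nat n)" using M.tensor_Q_elem_exists[OF X] by blast
    then show ?thesis using M.tensor_map_elem[OF MD(3)[OF g], of id] M.tensor_elem_closed MD(4)[OF g] by simp
  qed
  have eqv': "equivariant G (tensor_Q N) (\<lambda>g. tensor_map N (\<sigma> g) id) (\<lambda>g. tensor_map M (\<rho> g) id) \<psi>'"
    unfolding equivariant_def
  proof (intro ballI)
    fix g Y assume g: "g \<in> carrier G" and Y: "Y \<in> carrier (tensor_Q N)"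
    have X: "\<psi>' Y \<in> carrier (tensor_Q M)" using h(2) Y by (rule hom_in_carrier)
    have "\<psi> (tensor_map M (\<rho> g) id (\<psi>' Y)) = tensor_map N (\<sigma> g) id Y"
      using eqv g X inv2[OF Y] by (simp add: equivariant_def)
    then show "\<psi>' (tensor_map N (\<sigma> g) id Y) = tensor_map M (\<rho> g) id (\<psi>' Y)"
      using inv1[OF actM[OF g X]] by simp
  qed
  obtain \<alpha> k where a: "\<alpha> \<in> hom M N" "equivariant G M \<rho> \<sigma> \<alpha>" "k > 0"
    "\<And>x. x \<in> carrier M \<Longrightarrow> \<psi> (tensor_elem M (x [^]\<^bsub>M\<^esub> (k::nat)) 1) = tensor_elem N (\<alpha> x) 1"
    using rational_hom_lift[OF fgM gN fin dbN tN h(1) eqv] by blast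
  obtain \<beta> l where b: "\<beta> \<in> hom N M" "equivariant G N \<sigma> \<rho> \<beta>" "l > 0"
    "\<And>y. y \<in> carrier N \<Longrightarrow> \<psi>' (tensor_elem N (y [^]\<^bsub>N\<^esub> (l::nat)) 1) = tensor_elem M (\<beta> y) 1"
    using rational_hom_lift[OF fgN gM fin dbM tM h(2) eqv'] by blast
  interpret a: group_hom M N \<alpha> using a(1) by unfold_locales
  interpret b: group_hom N M \<beta> using b(1) by unfold_locales
  \<comment> \<open>A multiple of both torsion orders, so that one exponent serves the composition
    on \<open>M\<close> and the one on \<open>N\<close>.\<close>
  define t where "t = card (torsion M) * card (torsion N)"
  have tpos: "t > 0" unfolding t_def using M.card_torsion_pos[OF tM] N.card_torsion_pos[OF tN] by simp
  have ba: "\<beta> (\<alpha> x) [^]\<^bsub>M\<^esub> t = x [^]\<^bsub>M\<^esub> (k * l * t)" if x: "x \<in> carrier M" for x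
  proof -
    have "\<beta> (\<alpha> x) [^]\<^bsub>M\<^esub> card (torsion M) = x [^]\<^bsub>M\<^esub> (k * l * card (torsion M))"
      using inv1 a(4) b(4)
      by (intro rational_lift_comp[OF M.comm_group_axioms N.comm_group_axioms dbM tM h(2,1) _ a(1) _ b(1) _ x]) auto
    from arg_cong[OF this, of "\<lambda>z. z [^]\<^bsub>M\<^esub> card (torsion N)"] show ?thesis
      using x by (simp add: t_def M.nat_pow_pow mult.assoc)
  qed
  have ab: "\<alpha> (\<beta> y) [^]\<^bsub>N\<^esub> t = y [^]\<^bsub>N\<^esub> (k * l * t)" if y: "y \<in> carrier N" for y
  proof -
    have "\<alpha> (\<beta> y) [^]\<^bsub>N\<^esub> card (torsion N) = y [^]\<^bsub>N\<^esub> (l * k * card (torsion N))"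
      using inv2 a(4) b(4)
      by (intro rational_lift_comp[OF N.comm_group_axioms M.comm_group_axioms dbN tN h _ b(1) _ a(1) _ y]) auto
    from arg_cong[OF this, of "\<lambda>z. z [^]\<^bsub>N\<^esub> card (torsion M)"] show ?thesis
      using y by (simp add: t_def N.nat_pow_pow mult_ac)
  qed
  show ?thesis
  proof (rule that[of \<alpha> "\<lambda>y. \<beta> y [^]\<^bsub>M\<^esub> t" "k * l * t"])
    have "(\<lambda>y. \<beta> y [^]\<^bsub>M\<^esub> t) \<in> hom N M"
      by (intro homI) (auto simp: M.pow_mult_distrib M.m_comm)
    then show "isogeny M N \<alpha> (\<lambda>y. \<beta> y [^]\<^bsub>M\<^esub> t) (k * l * t)"
      unfolding isogeny_def using a(1,3) b(3) tpos ba ab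
      by (simp add: M.comm_group_axioms N.comm_group_axioms a.hom_nat_pow)
    show "equivariant G M \<rho> \<sigma> \<alpha>" by fact
    show "equivariant G N \<sigma> \<rho> (\<lambda>y. \<beta> y [^]\<^bsub>M\<^esub> t)"
      unfolding equivariant_def
    proof (intro ballI)
      fix g y assume g: "g \<in> carrier G" and y: "y \<in> carrier N"
      show "\<beta> (\<sigma> g y) [^]\<^bsub>M\<^esub> t = \<rho> g (\<beta> y [^]\<^bsub>M\<^esub> t)"
        using b(2) g y group_hom.hom_nat_pow[of M M "\<rho> g" "\<beta> y" t] MD(3)[OF g] M.is_group
        by (simp add: equivariant_def group_hom_def group_hom_axioms_def)
    qed
  qed
qed

section \<open>The adjoint of the induced map\<close>

text \<open>With \<open>Q\<close> the matrix of \<open>f\<close>, the commutation gives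
  \<open>Q T = T' Q\<close>. In general \<open>Q\<close> is invertible only over the rationals, but
  its determinant is a nonzero integer and cancels.\<close>

lemma det_coord_mat_conjugate:
  assumes iso: "isogeny A B f f' k" and dA: "dual_basis A as ls" and dB: "dual_basis B bs ks"
    and T: "T \<in> hom A A" and T': "T' \<in> hom B B" and comm: "\<And>x. x \<in> carrier A \<Longrightarrow> f (T x) = T' (f x)"
  shows "det (coord_mat ls (map T as)) = det (coord_mat ks (map T' bs))"
proof -
  interpret A: comm_group A using iso by (simp add: isogeny_def)
  interpret B: comm_group B using iso by (simp add: isogeny_def)
  have f: "f \<in> hom A B" using iso by (simp add: isogeny_def)
  note r = isogeny_rank_eq[OF iso dA dB]
  note lA = dual_basisD(1)[OF dA] and lB = dual_basisD(1)[OF dB]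
  have asA: "set as \<subseteq> carrier A" and bsB: "set bs \<subseteq> carrier B" using dA dB by (auto simp: dual_basis_def)
  have ksadd: "\<forall>l\<in>set ks. additive_on B l" using dB by (simp add: dual_basis_def)
  let ?n = "length as"
  let ?Q = "coord_mat ks (map f as)" and ?T = "coord_mat ls (map T as)" and ?T' = "coord_mat ks (map T' bs)"
  have c: "?Q \<in> carrier_mat ?n ?n" "?T \<in> carrier_mat ?n ?n" "?T' \<in> carrier_mat ?n ?n"
    using lA lB r(1) by (auto simp: coord_mat_def)
  have "?Q * ?T = coord_mat (map (\<lambda>l x. l (f x)) ks) as * coord_mat ls (map T as)"
    by (rule arg_cong[of _ _ "\<lambda>Q. Q * ?T"], intro eq_matI) (auto simp: coord_mat_def)
  also have "\<dots> = coord_mat (map (\<lambda>l x. l (f x)) ks) (map T as)"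
    using ksadd additive_on_comp[OF f] asA hom_in_carrier[OF T]
    by (intro A.coord_mat_expand[OF dA, symmetric]) auto
  also have "\<dots> = coord_mat (map (\<lambda>l x. l (T' x)) ks) (map f as)"
    using comm[OF subsetD[OF asA nth_mem]] by (intro eq_matI) (auto simp: coord_mat_def)
  also have "\<dots> = coord_mat (map (\<lambda>l x. l (T' x)) ks) bs * ?Q"
    using ksadd additive_on_comp[OF T'] asA hom_in_carrier[OF f]
    by (intro B.coord_mat_expand[OF dB]) auto
  also have "\<dots> = ?T' * ?Q"
    by (rule arg_cong[of _ _ "\<lambda>T. T * ?Q"], intro eq_matI) (auto simp: coord_mat_def)
  finally have QT: "?Q * ?T = ?T' * ?Q" .
  have "det ?Q * det ?T = det ?T' * det ?Q"
    unfolding det_mult[OF c(1,2), symmetric] det_mult[OF c(3,1), symmetric] QT ..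
  then show ?thesis using r(2) by (simp add: mult.commute)
qed

text \<open>The order \<open>n\<close> of the cokernel annihilates it, so \<open>n\<close>-th powers
  lie in the image of \<open>f\<close>; injectivity makes the preimage unique and therefore
  multiplicative.\<close>

lemma (in comm_group) quasi_inverse:
  assumes B: "comm_group B" and f: "f \<in> hom G B" and inj: "inj_on f (carrier G)"
    and fin: "finite (carrier (B Mod (f ` carrier G)))"
  obtains f' n where "f' \<in> hom B G" "n > 0" "\<And>y. y \<in> carrier B \<Longrightarrow> f (f' y) = y [^]\<^bsub>B\<^esub> (n::nat)"
    "\<And>x. x \<in> carrier G \<Longrightarrow> f' (f x) = x [^] n"
proof -
  interpret B: comm_group B by fact
  interpret f: group_hom G B f using f by unfold_locales
  let ?C = "f ` carrier G"
  have sC: "subgroup ?C B" by (rule f.img_is_subgroup)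
  interpret C: normal ?C B using sC by (simp add: B.normal_iff_subgroup)
  interpret Q: comm_group "B Mod ?C" by (rule B.abelian_FactGroup[OF sC])
  define n where "n = card (carrier (B Mod ?C))"
  have n: "n > 0" unfolding n_def using fin Q.one_closed by (metis card_gt_0_iff empty_iff)
  have pow: "y [^]\<^bsub>B\<^esub> n \<in> ?C" if y: "y \<in> carrier B" for y
  proof -
    have "?C #>\<^bsub>B\<^esub> y \<in> carrier (B Mod ?C)" using y by (auto simp: carrier_FactGroup)
    then have "(?C #>\<^bsub>B\<^esub> y) [^]\<^bsub>B Mod ?C\<^esub> n = ?C"
      unfolding n_def using Q.power_order_eq_one[OF fin] by simp
    then have "?C #>\<^bsub>B\<^esub> (y [^]\<^bsub>B\<^esub> n) = ?C" using C.FactGroup_pow[OF y, of n] by simp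
    then show ?thesis using B.coset_join1[OF _ _ sC] y C.subset by auto
  qed
  define f' where "f' y = inv_into (carrier G) f (y [^]\<^bsub>B\<^esub> n)" for y
  have f': "f' y \<in> carrier G" "f (f' y) = y [^]\<^bsub>B\<^esub> n" if "y \<in> carrier B" for y
    unfolding f'_def using pow[OF that] by (auto intro: inv_into_into f_inv_into_f)
  show ?thesis
  proof (rule that[OF _ n])
    show "f' \<in> hom B G"
    proof (rule homI)
      fix y z assume yz: "y \<in> carrier B" "z \<in> carrier B"
      have "f (f' (y \<otimes>\<^bsub>B\<^esub> z)) = f (f' y \<otimes> f' z)" using f' yz by (simp add: B.nat_pow_distrib)
      then show "f' (y \<otimes>\<^bsub>B\<^esub> z) = f' y \<otimes> f' z"
        using f'(1) yz by (intro inj_onD[OF inj]) auto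
    qed (rule f')
    show "f (f' y) = y [^]\<^bsub>B\<^esub> n" if "y \<in> carrier B" for y using f'(2)[OF that] .
    fix x assume x: "x \<in> carrier G"
    have "f (f' (f x)) = f (x [^] n)" using f'(2)[of "f x"] x by (simp add: f.hom_nat_pow)
    then show "f' (f x) = x [^] n" using f'(1)[of "f x"] x by (intro inj_onD[OF inj]) auto
  qed
qed

lemma induced_map_hom:
  assumes "perm_lattice G I H" "perm_lattice G J H'"
    and th: "\<theta> \<in> hom (perm_module G I H) (perm_module G J H')"
    and eq: "equivariant G (perm_module G I H) (perm_action G I H) (perm_action G J H') \<theta>"
  shows "induced_map (perm_module G I H) \<theta> \<in> hom (Hom_G G (perm_module G J H') (perm_action G J H') M \<rho>)
     (Hom_G G (perm_module G I H) (perm_action G I H) M \<rho>)"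
proof -
  interpret L1: perm_lattice G I H by fact
  interpret L2: perm_lattice G J H' by fact
  have tc: "\<theta> x \<in> carrier L2.P" if "x \<in> carrier L1.P" for x using hom_in_carrier[OF th that] .
  show ?thesis
  proof (rule homI)
    fix f assume f: "f \<in> carrier (L2.HomP M \<rho>)"
    have "induced_map L1.P \<theta> f \<in> hom L1.P M"
      using f tc hom_mult[OF th] unfolding induced_map_def
      by (intro homI) (auto simp: L2.Hom_G_closed[OF f] L2.Hom_G_mem hom_mult)
    moreover have "equivariant G L1.P L1.\<pi> \<rho> (induced_map L1.P \<theta> f)"
      using f tc eq unfolding induced_map_def
      by (auto simp: equivariant_def L2.Hom_G_mem L1.perm_action_closed)
    ultimately show "induced_map L1.P \<theta> f \<in> carrier (L1.HomP M \<rho>)"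
      by (simp add: L1.Hom_G_mem induced_map_def)
  next
    fix f f' assume "f \<in> carrier (L2.HomP M \<rho>)" "f' \<in> carrier (L2.HomP M \<rho>)"
    show "induced_map L1.P \<theta> (f \<otimes>\<^bsub>L2.HomP M \<rho>\<^esub> f')
       = induced_map L1.P \<theta> f \<otimes>\<^bsub>L1.HomP M \<rho>\<^esub> induced_map L1.P \<theta> f'"
      using tc by (auto simp: induced_map_def L1.Hom_G_mult L2.Hom_G_mult)
  qed
qed

text \<open>Precomposition reverses the order of the two maps, and an \<open>n\<close>-th power
  inside a homomorphism comes out as the \<open>n\<close>-th power of the homomorphism.\<close>

lemma induced_map_induced_map:
  assumes L: "perm_lattice G I H" and gm: "gmodule G M \<rho>"
    and f: "f \<in> carrier (Hom_G G (perm_module G I H) (perm_action G I H) M \<rho>)"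
    and th: "\<And>x. x \<in> carrier (perm_module G I H) \<Longrightarrow> \<theta> x \<in> carrier Q \<and> \<eta> (\<theta> x) = x [^]\<^bsub>perm_module G I H\<^esub> (n::nat)"
  shows "induced_map (perm_module G I H) \<theta> (induced_map Q \<eta> f)
     = f [^]\<^bsub>Hom_G G (perm_module G I H) (perm_action G I H) M \<rho>\<^esub> n"
proof -
  interpret L: perm_lattice G I H by fact
  interpret M: comm_group M by (rule gmoduleD) fact
  interpret A: comm_group "L.HomP M \<rho>" by (rule L.comm_group_Hom_G[OF gm])
  show ?thesis
  proof (rule extensionalityI[of _ "carrier L.P"])
    show "f [^]\<^bsub>L.HomP M \<rho>\<^esub> n \<in> extensional (carrier L.P)" using A.nat_pow_closed[OF f, of n] by (simp add: L.Hom_G_mem)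
    fix x assume x: "x \<in> carrier L.P"
    have "f (x [^]\<^bsub>L.P\<^esub> n) = f x [^]\<^bsub>M\<^esub> n"
      using group_hom.hom_nat_pow[of L.P M f x n] f x L.P.is_group M.is_group
      by (simp add: L.Hom_G_mem group_hom_def group_hom_axioms_def)
    then show "induced_map L.P \<theta> (induced_map Q \<eta> f) x = (f [^]\<^bsub>L.HomP M \<rho>\<^esub> n) x"
      using x th[OF x] L.eval_pow[OF gm f x, of n] by (simp add: induced_map_def)
  qed (simp add: induced_map_def)
qed

text \<open>Passes from a product over subgroups, as in \<open>regulator_constant\<close>, to a
  product over an index set in which a subgroup may occur several times.\<close>

lemma prod_power_card_fibres:
  fixes d :: "'k \<Rightarrow> 'r::comm_monoid_mult"
  assumes "finite S" "finite I" "h ` I \<subseteq> S"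
  shows "(\<Prod>K\<in>S. d K ^ card {i \<in> I. h i = K}) = (\<Prod>i\<in>I. d (h i))"
proof -
  have "(\<Prod>K\<in>S. d K ^ card {i \<in> I. h i = K}) = (\<Prod>K\<in>S. \<Prod>i\<in>{i \<in> I. h i = K}. d (h i))"
    by (intro prod.cong) auto
  also have "\<dots> = (\<Prod>i\<in>I. d (h i))" using assms by (intro prod.group)
  finally show ?thesis .
qed

text \<open>The exponent of a subgroup is a difference of two multiplicities. Splitting the power
  accordingly uses that the determinants are nonzero, which \<open>pairing_det_fixed_nonzero\<close>
  will supply.\<close>

lemma regulator_constant_subgroup_difference:
  assumes "finite (carrier G)" "finite I" "finite J"
    "\<And>i. i \<in> I \<Longrightarrow> subgroup (H i) G" "\<And>j. j \<in> J \<Longrightarrow> subgroup (H' j) G"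
    "\<And>K. subgroup K G \<Longrightarrow> pairing_det (fixed_submodule M \<rho> K) (\<lambda>x y. 1 / of_nat (card K) * B x y) \<noteq> 0"
  shows "regulator_constant G (subgroup_difference I H J H') M \<rho> B
    = (\<Prod>i\<in>I. pairing_det (fixed_submodule M \<rho> (H i)) (\<lambda>x y. 1 / of_nat (card (H i)) * B x y))
      / (\<Prod>j\<in>J. pairing_det (fixed_submodule M \<rho> (H' j)) (\<lambda>x y. 1 / of_nat (card (H' j)) * B x y))"
proof -
  define d where "d K = pairing_det (fixed_submodule M \<rho> K) (\<lambda>x y. 1 / of_nat (card K) * B x y)" for K
  have fS: "finite {K. subgroup K G}"
    by (rule finite_subset[of _ "Pow (carrier G)"]) (use assms(1) subgroup.subset in auto)
  note pc = prod_power_card_fibres[OF fS assms(2), of H d] prod_power_card_fibres[OF fS assms(3), of H' d]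
  have "regulator_constant G (subgroup_difference I H J H') M \<rho> B
     = (\<Prod>K | subgroup K G. d K ^ card {i \<in> I. H i = K} / d K ^ card {j \<in> J. H' j = K})"
    unfolding regulator_constant_def subgroup_difference_def d_def
    using assms(6) by (intro prod.cong) (auto simp: power_int_diff)
  then show ?thesis using pc assms(4,5) by (simp add: prod_dividef d_def image_subset_iff)
qed

section \<open>The transpose of the matrix of \<open>\<phi>\<close>\<close>

locale perm_lattice_map = L1: perm_lattice G I H + L2: perm_lattice G J H'
  for G :: "('g, 'a) monoid_scheme" (structure)
    and I :: "'i set" and H :: "'i \<Rightarrow> 'g set" and J :: "'j set" and H' :: "'j \<Rightarrow> 'g set" +
  fixes \<phi> :: "('i \<Rightarrow> 'g set \<Rightarrow>\<^sub>0 int) \<Rightarrow> ('j \<Rightarrow> 'g set \<Rightarrow>\<^sub>0 int)"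
  assumes phi_hom: "\<phi> \<in> hom L1.P L2.P" and phi_equivariant: "equivariant G L1.P L1.\<pi> L2.\<pi> \<phi>"
begin

definition entry where "entry d x = L2.chi d (\<phi> (L1.eps x))"

text \<open>Precomposition with the transpose of the matrix of \<open>\<phi>\<close>, given by its values on the basis.\<close>

definition transpose_map :: "('m, 'b) monoid_scheme \<Rightarrow> (('i \<Rightarrow> 'g set \<Rightarrow>\<^sub>0 int) \<Rightarrow> 'm) \<Rightarrow> ('j \<Rightarrow> 'g set \<Rightarrow>\<^sub>0 int) \<Rightarrow> 'm" where
  "transpose_map M f = L2.extend M (\<lambda>d. finprod M (\<lambda>x. f (L1.eps x) [^]\<^bsub>M\<^esub> entry d x) L1.X)"

abbreviation "phi_map \<equiv> induced_map L1.P \<phi>"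

text \<open>\<open>\<phi>\<close> commutes with the permutations of the two bases. This symmetry of
  the matrix is what makes its transpose equivariant too.\<close>

lemma entry_act:
  assumes "g \<in> carrier G" "d \<in> L2.X" "x \<in> L1.X"
  shows "entry (L2.act g d) (L1.act g x) = entry d x"
proof -
  have "\<phi> (L1.eps (L1.act g x)) = L2.\<pi> g (\<phi> (L1.eps x))"
    using phi_equivariant assms(1) L1.eps_P[OF assms(3)]
    unfolding equivariant_def L1.perm_action_eps[OF assms(3), symmetric] by blast
  then show ?thesis
    unfolding entry_def using L2.chi_perm_action[OF assms(1,2)] hom_in_carrier[OF phi_hom L1.eps_P[OF assms(3)]] by simp
qed

text \<open>For equivariance, \<open>\<rho> g\<close> is moved inside the product; by
  \<open>entry_act\<close> the exponent of the factor at \<open>x\<close> is also the entry at the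
  translates of \<open>d\<close> and \<open>x\<close>, and reindexing \<open>L1.X\<close> by the
  action of \<open>g\<close> yields the value at the translate of \<open>d\<close>.\<close>

lemma transpose_map:
  assumes gm: "gmodule G M \<rho>" and f: "f \<in> carrier (L1.HomP M \<rho>)"
  shows "transpose_map M f \<in> carrier (L2.HomP M \<rho>)"
    "\<And>d. d \<in> L2.X \<Longrightarrow> transpose_map M f (L2.eps d) = finprod M (\<lambda>x. f (L1.eps x) [^]\<^bsub>M\<^esub> entry d x) L1.X"
proof -
  note MD = gmoduleD[OF gm]
  interpret M: comm_group M by fact
  define v where "v d = finprod M (\<lambda>x. f (L1.eps x) [^]\<^bsub>M\<^esub> entry d x) L1.X" for d
  have fM: "f (L1.eps x) \<in> carrier M" if "x \<in> L1.X" for x using L1.Hom_G_closed[OF f L1.eps_P[OF that]] .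
  have vM: "v d \<in> carrier M" for d unfolding v_def using fM by (intro M.finprod_closed) auto
  have tv: "transpose_map M f = L2.extend M v" unfolding transpose_map_def v_def ..
  have ex: "L2.extend M v \<in> hom L2.P M" "\<And>d. d \<in> L2.X \<Longrightarrow> L2.extend M v (L2.eps d) = v d"
    using L2.extend_hom[OF MD(2), of v] vM by auto
  have "v (L2.act g d) = \<rho> g (v d)" if g: "g \<in> carrier G" and d: "d \<in> L2.X" for g d
  proof -
    have fe: "f (L1.eps (L1.act g x)) = \<rho> g (f (L1.eps x))" if "x \<in> L1.X" for x
      using L1.equivariant_iff_eps[OF gm, of f] f g that by (auto simp: L1.Hom_G_mem)
    have "\<rho> g (v d) = finprod M (\<lambda>x. \<rho> g (f (L1.eps x) [^]\<^bsub>M\<^esub> entry d x)) L1.X"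
      unfolding v_def using fM by (intro M.hom_finprod[OF MD(2) MD(3)[OF g] L1.fin_X]) auto
    also have "\<dots> = finprod M (\<lambda>x. f (L1.eps (L1.act g x)) [^]\<^bsub>M\<^esub> entry (L2.act g d) (L1.act g x)) L1.X"
      using fM fe g d MD(4)[OF g] hom_int_pow[OF MD(3)[OF g] _ M.is_group M.is_group]
      by (intro M.finprod_cong') (auto simp: entry_act)
    also have "\<dots> = finprod M (\<lambda>x. f (L1.eps x) [^]\<^bsub>M\<^esub> entry (L2.act g d) x) (L1.act g ` L1.X)"
      using L1.act_bij[OF g] fM by (intro M.finprod_reindex[symmetric]) (auto simp: bij_betw_def)
    also have "L1.act g ` L1.X = L1.X" using L1.act_bij[OF g] by (simp add: bij_betw_def)
    finally show ?thesis by (simp add: v_def)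
  qed
  then have "equivariant G L2.P L2.\<pi> \<rho> (L2.extend M v)"
    using L2.equivariant_iff_eps[OF gm ex(1)] ex(2) L2.act_X by simp
  then show "transpose_map M f \<in> carrier (L2.HomP M \<rho>)"
    using ex(1) unfolding tv by (auto simp: L2.Hom_G_mem L2.extend_def)
  show "transpose_map M f (L2.eps d) = finprod M (\<lambda>x. f (L1.eps x) [^]\<^bsub>M\<^esub> entry d x) L1.X" if "d \<in> L2.X" for d
    using ex(2)[OF that] unfolding tv by (simp add: v_def)
qed

lemma Hom2_eqI:
  assumes "gmodule G M \<rho>" "f \<in> carrier (L2.HomP M \<rho>)" "f' \<in> carrier (L2.HomP M \<rho>)"
    "\<And>d. d \<in> L2.X \<Longrightarrow> f (L2.eps d) = f' (L2.eps d)"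
  shows "f = f'"
  using L2.Hom_G_eqI[OF assms(1-3)] assms(4) L2.base_in_X by blast

lemma transpose_map_hom:
  assumes gm: "gmodule G M \<rho>"
  shows "transpose_map M \<in> hom (L1.HomP M \<rho>) (L2.HomP M \<rho>)"
proof (rule homI)
  note tm = transpose_map[OF gm]
  interpret M: comm_group M by (rule gmoduleD) fact
  interpret A1: comm_group "L1.HomP M \<rho>" by (rule L1.comm_group_Hom_G[OF gm])
  interpret A2: comm_group "L2.HomP M \<rho>" by (rule L2.comm_group_Hom_G[OF gm])
  fix f f' assume ff: "f \<in> carrier (L1.HomP M \<rho>)" "f' \<in> carrier (L1.HomP M \<rho>)"
  have fM: "f (L1.eps x) \<in> carrier M" "f' (L1.eps x) \<in> carrier M" if "x \<in> L1.X" for x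
    using L1.Hom_G_closed[OF _ L1.eps_P[OF that]] ff by blast+
  show "transpose_map M (f \<otimes>\<^bsub>L1.HomP M \<rho>\<^esub> f') = transpose_map M f \<otimes>\<^bsub>L2.HomP M \<rho>\<^esub> transpose_map M f'"
  proof (rule Hom2_eqI[OF gm])
    fix d assume d: "d \<in> L2.X"
    have "transpose_map M (f \<otimes>\<^bsub>L1.HomP M \<rho>\<^esub> f') (L2.eps d)
       = finprod M (\<lambda>x. (f \<otimes>\<^bsub>L1.HomP M \<rho>\<^esub> f') (L1.eps x) [^]\<^bsub>M\<^esub> entry d x) L1.X"
      using tm(2)[OF A1.m_closed[OF ff] d] .
    also have "\<dots> = finprod M (\<lambda>x. f (L1.eps x) [^]\<^bsub>M\<^esub> entry d x \<otimes>\<^bsub>M\<^esub> f' (L1.eps x) [^]\<^bsub>M\<^esub> entry d x) L1.X"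
      using fM L1.eps_P by (intro M.finprod_cong') (auto simp: L1.Hom_G_mult M.int_pow_distrib)
    also have "\<dots> = transpose_map M f (L2.eps d) \<otimes>\<^bsub>M\<^esub> transpose_map M f' (L2.eps d)"
      unfolding tm(2)[OF ff(1) d] tm(2)[OF ff(2) d] using fM by (intro M.finprod_multf) auto
    finally show "transpose_map M (f \<otimes>\<^bsub>L1.HomP M \<rho>\<^esub> f') (L2.eps d)
       = (transpose_map M f \<otimes>\<^bsub>L2.HomP M \<rho>\<^esub> transpose_map M f') (L2.eps d)"
      using L2.eps_P[OF d] by (simp add: L2.Hom_G_mult)
  qed (intro tm(1) A1.m_closed A2.m_closed ff)+
qed (rule transpose_map[OF gm])

lemma phi_map_hom: "phi_map \<in> hom (L2.HomP M \<rho>) (L1.HomP M \<rho>)"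
  by (rule induced_map_hom[OF L1.perm_lattice_axioms L2.perm_lattice_axioms phi_hom phi_equivariant])

text \<open>Both sides expand to \<open>1 / |G|\<close> times the same double sum over
  \<open>L1.X\<close> and \<open>L2.X\<close>: on the left by expanding \<open>\<phi>\<close> in the
  first slot, on the right by expanding the transpose in the second. Hence the use of
  \<open>hom_pairing_sum_eps\<close>, whose factor is the same for both modules.\<close>

lemma hom_pairing_adjoint:
  assumes gm: "gmodule G M \<rho>" and rp: "regulator_pairing G M \<rho> B"
    and f: "f \<in> carrier (L2.HomP M \<rho>)" and f': "f' \<in> carrier (L1.HomP M \<rho>)"
  shows "L1.hom_pairing B (phi_map f) f' = L2.hom_pairing B f (transpose_map M f')"
proof -
  note MD = gmoduleD[OF gm]
  interpret M: comm_group M by fact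
  have bil: "bilinear_pairing M B"
    and inv: "\<forall>g\<in>carrier G. \<forall>x\<in>carrier M. \<forall>y\<in>carrier M. B (\<rho> g x) (\<rho> g y) = B x y"
    using rp by (auto simp: regulator_pairing_def)
  have Badd1: "additive_on M (\<lambda>x. B x y)" if "y \<in> carrier M" for y
    using bil that by (auto simp: bilinear_pairing_def additive_on_def)
  have Badd2: "additive_on M (B x)" if "x \<in> carrier M" for x
    using bil that by (auto simp: bilinear_pairing_def additive_on_def)
  have fM: "f (L2.eps d) \<in> carrier M" if "d \<in> L2.X" for d using L2.Hom_G_closed[OF f L2.eps_P[OF that]] .
  have fM': "f' (L1.eps x) \<in> carrier M" if "x \<in> L1.X" for x using L1.Hom_G_closed[OF f' L1.eps_P[OF that]] .
  have fh: "f \<in> hom L2.P M" using f by (simp add: L2.Hom_G_mem)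
  have 1: "B (phi_map f (L1.eps x)) (f' (L1.eps x)) = (\<Sum>d\<in>L2.X. of_int (entry d x) * B (f (L2.eps d)) (f' (L1.eps x)))"
    if x: "x \<in> L1.X" for x
  proof -
    have "B (phi_map f (L1.eps x)) (f' (L1.eps x)) = B (f (\<phi> (L1.eps x))) (f' (L1.eps x))"
      using L1.eps_P[OF x] by (simp add: induced_map_def)
    also have "\<dots> = (\<Sum>d\<in>L2.X. of_int (entry d x) * B (f (L2.eps d)) (f' (L1.eps x)))"
      unfolding entry_def
      by (rule L2.additive_P_expand[OF additive_on_comp[OF fh Badd1[OF fM'[OF x]]] hom_in_carrier[OF phi_hom L1.eps_P[OF x]]])
    finally show ?thesis .
  qed
  have 2: "B (f (L2.eps d)) (transpose_map M f' (L2.eps d)) = (\<Sum>x\<in>L1.X. of_int (entry d x) * B (f (L2.eps d)) (f' (L1.eps x)))"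
    if d: "d \<in> L2.X" for d
  proof -
    have "B (f (L2.eps d)) (transpose_map M f' (L2.eps d)) = (\<Sum>x\<in>L1.X. B (f (L2.eps d)) (f' (L1.eps x) [^]\<^bsub>M\<^esub> entry d x))"
      unfolding transpose_map(2)[OF gm f' d] using fM'
      by (intro M.additive_on_finprod[OF Badd2[OF fM[OF d]] L1.fin_X]) auto
    also have "\<dots> = (\<Sum>x\<in>L1.X. of_int (entry d x) * B (f (L2.eps d)) (f' (L1.eps x)))"
      using M.additive_on_int_pow[OF Badd2[OF fM[OF d]] fM'] by (intro sum.cong) auto
    finally show ?thesis .
  qed
  have "(\<Sum>x\<in>L1.X. B (phi_map f (L1.eps x)) (f' (L1.eps x)))
     = (\<Sum>x\<in>L1.X. \<Sum>d\<in>L2.X. of_int (entry d x) * B (f (L2.eps d)) (f' (L1.eps x)))"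
    using 1 by (intro sum.cong) auto
  also have "\<dots> = (\<Sum>d\<in>L2.X. \<Sum>x\<in>L1.X. of_int (entry d x) * B (f (L2.eps d)) (f' (L1.eps x)))"
    by (rule sum.swap)
  also have "\<dots> = (\<Sum>d\<in>L2.X. B (f (L2.eps d)) (transpose_map M f' (L2.eps d)))"
    using 2 by (intro sum.cong) auto
  finally show ?thesis
    using L1.hom_pairing_sum_eps[OF gm hom_in_carrier[OF phi_map_hom f] f' inv]
      L2.hom_pairing_sum_eps[OF gm f transpose_map(1)[OF gm f'] inv] by simp
qed

end

section \<open>Functoriality of \<open>(P, M)\<close> in \<open>M\<close>\<close>

context perm_lattice
begin

definition push :: "('m \<Rightarrow> 'n) \<Rightarrow> (('i \<Rightarrow> 'g set \<Rightarrow>\<^sub>0 int) \<Rightarrow> 'm) \<Rightarrow> ('i \<Rightarrow> 'g set \<Rightarrow>\<^sub>0 int) \<Rightarrow> 'n" where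
  "push a f = (\<lambda>p\<in>carrier P. a (f p))"

lemma push_hom:
  assumes a: "a \<in> hom M N" and eq: "equivariant G M \<rho> \<sigma> a"
  shows "push a \<in> hom (HomP M \<rho>) (HomP N \<sigma>)"
proof (rule homI)
  fix f assume f: "f \<in> carrier (HomP M \<rho>)"
  note fc = Hom_G_closed[OF f]
  have "push a f \<in> hom P N"
    using f fc hom_in_carrier[OF a] hom_mult[OF a] unfolding push_def
    by (intro homI) (auto simp: Hom_G_mem hom_mult)
  moreover have "equivariant G P \<pi> \<sigma> (push a f)"
    using f fc eq unfolding push_def by (auto simp: equivariant_def Hom_G_mem perm_action_closed)
  ultimately show "push a f \<in> carrier (HomP N \<sigma>)" by (simp add: Hom_G_mem push_def)
next
  fix f f' assume "f \<in> carrier (HomP M \<rho>)" "f' \<in> carrier (HomP M \<rho>)"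
  then show "push a (f \<otimes>\<^bsub>HomP M \<rho>\<^esub> f') = push a f \<otimes>\<^bsub>HomP N \<sigma>\<^esub> push a f'"
    unfolding push_def Hom_G_mult by (intro restrict_ext) (simp add: hom_mult[OF a] Hom_G_closed)
qed

lemma push_push:
  assumes gm: "gmodule G M \<rho>" and ba: "\<And>x. x \<in> carrier M \<Longrightarrow> b (a x) = x [^]\<^bsub>M\<^esub> (k::nat)"
    and f: "f \<in> carrier (HomP M \<rho>)"
  shows "push b (push a f) = f [^]\<^bsub>HomP M \<rho>\<^esub> k"
proof (rule extensionalityI[of _ "carrier P"])
  interpret A: comm_group "HomP M \<rho>" by (rule comm_group_Hom_G[OF gm])
  show "f [^]\<^bsub>HomP M \<rho>\<^esub> k \<in> extensional (carrier P)" using A.nat_pow_closed[OF f, of k] by (simp add: Hom_G_mem)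
  fix p assume "p \<in> carrier P"
  then show "push b (push a f) p = (f [^]\<^bsub>HomP M \<rho>\<^esub> k) p"
    using eval_pow[OF gm f] ba Hom_G_closed[OF f] by (simp add: push_def)
qed (simp add: push_def)

lemma push_isogeny:
  assumes "gmodule G M \<rho>" "gmodule G N \<sigma>" "isogeny M N a b k" "equivariant G M \<rho> \<sigma> a" "equivariant G N \<sigma> \<rho> b"
  shows "isogeny (HomP M \<rho>) (HomP N \<sigma>) (push a) (push b) k"
proof -
  have ab: "a \<in> hom M N" "b \<in> hom N M" "k > 0" "\<And>x. x \<in> carrier M \<Longrightarrow> b (a x) = x [^]\<^bsub>M\<^esub> k"
    "\<And>y. y \<in> carrier N \<Longrightarrow> a (b y) = y [^]\<^bsub>N\<^esub> k"
    using assms(3) by (auto simp: isogeny_def)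
  show ?thesis
    unfolding isogeny_def
    by (intro conjI ballI comm_group_Hom_G push_hom push_push) (use assms ab in simp_all)
qed

end

section \<open>The quantity as a determinant, and its invariance\<close>

locale perm_isogeny = perm_lattice_map +
  assumes phi_inj: "inj_on \<phi> (carrier L1.P)" and phi_coker: "finite (carrier (L2.P Mod (\<phi> ` carrier L1.P)))"
begin

text \<open>The quasi-inverse \<open>\<psi>\<close> of \<open>\<phi>\<close> is equivariant:
  \<open>\<phi> \<circ> \<psi>\<close> is a power map, which commutes with the action, and the
  injective \<open>\<phi>\<close> can be cancelled. Precomposition with \<open>\<psi>\<close> is
  then inverse to \<open>phi_map\<close> up to the power \<open>n\<close>.\<close>

lemma phi_map_isogeny:
  assumes gm: "gmodule G M \<rho>"
  obtains f' n where "isogeny (L2.HomP M \<rho>) (L1.HomP M \<rho>) phi_map f' n"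
proof -
  obtain \<psi> n where psi: "\<psi> \<in> hom L2.P L1.P" "n > 0"
    "\<And>y. y \<in> carrier L2.P \<Longrightarrow> \<phi> (\<psi> y) = y [^]\<^bsub>L2.P\<^esub> (n::nat)"
    "\<And>x. x \<in> carrier L1.P \<Longrightarrow> \<psi> (\<phi> x) = x [^]\<^bsub>L1.P\<^esub> n"
    using L1.P.quasi_inverse[OF L2.comm_group_P phi_hom phi_inj phi_coker] by blast
  have pc: "\<psi> y \<in> carrier L1.P" if "y \<in> carrier L2.P" for y using hom_in_carrier[OF psi(1) that] .
  have fc: "\<phi> x \<in> carrier L2.P" if "x \<in> carrier L1.P" for x using hom_in_carrier[OF phi_hom that] .
  have "equivariant G L2.P L2.\<pi> L1.\<pi> \<psi>"
    unfolding equivariant_def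
  proof (intro ballI)
    fix g y assume g: "g \<in> carrier G" and y: "y \<in> carrier L2.P"
    have gy: "L2.\<pi> g y \<in> carrier L2.P" by (rule L2.perm_action_closed[OF g y])
    have "group_hom L2.P L2.P (L2.\<pi> g)"
      using L2.perm_action_hom[OF g] L2.P.is_group by (simp add: group_hom_def group_hom_axioms_def)
    from group_hom.hom_nat_pow[OF this y]
    have "L2.\<pi> g (y [^]\<^bsub>L2.P\<^esub> n) = L2.\<pi> g y [^]\<^bsub>L2.P\<^esub> n" .
    then have "\<phi> (\<psi> (L2.\<pi> g y)) = L2.\<pi> g (\<phi> (\<psi> y))" using psi(3)[OF gy] psi(3)[OF y] by simp
    also have "\<dots> = \<phi> (L1.\<pi> g (\<psi> y))" using phi_equivariant g pc[OF y] by (simp add: equivariant_def)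
    finally show "\<psi> (L2.\<pi> g y) = L1.\<pi> g (\<psi> y)"
      using phi_inj pc[OF gy] L1.perm_action_closed[OF g pc[OF y]] by (simp add: inj_onD)
  qed
  then have ih: "induced_map L2.P \<psi> \<in> hom (L1.HomP M \<rho>) (L2.HomP M \<rho>)"
    by (rule induced_map_hom[OF L2.perm_lattice_axioms L1.perm_lattice_axioms psi(1)])
  interpret A1: comm_group "L1.HomP M \<rho>" by (rule L1.comm_group_Hom_G[OF gm])
  interpret A2: comm_group "L2.HomP M \<rho>" by (rule L2.comm_group_Hom_G[OF gm])
  note ii = induced_map_induced_map[OF L2.perm_lattice_axioms gm, of _ \<psi> L1.P \<phi> n]
    induced_map_induced_map[OF L1.perm_lattice_axioms gm, of _ \<phi> L2.P \<psi> n]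
  have "isogeny (L2.HomP M \<rho>) (L1.HomP M \<rho>) phi_map (induced_map L2.P \<psi>) n"
    unfolding isogeny_def
    by (intro conjI ballI A1.comm_group_axioms A2.comm_group_axioms phi_map_hom ih psi(2) ii)
      (use pc fc psi(3,4) in simp_all)
  then show ?thesis by (rule that)
qed

text \<open>The Gram matrix of the pulled back pairing factors as the Gram matrix on
  \<open>(P2, M)\<close> times the integer matrix of the endomorphism. The determinant of the first
  factor is also the denominator of the regulator constant; it cancels because the pairing is
  non-degenerate on all invariants.\<close>

lemma regulator_quantity_eq_det:
  assumes fg: "finitely_generated_gmodule G M \<rho>" and rp: "regulator_pairing G M \<rho> B"
  obtains bs ks where "dual_basis (L2.HomP M \<rho>) bs ks"
    "regulator_quantity G I H J H' \<phi> M \<rho> B = of_int (det (coord_mat ks (map (\<lambda>f. transpose_map M (phi_map f)) bs)))"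
proof -
  have gm: "gmodule G M \<rho>" using fg by (simp add: finitely_generated_gmodule_def)
  interpret M: comm_group M by (rule gmoduleD) fact
  let ?A1 = "L1.HomP M \<rho>" and ?A2 = "L2.HomP M \<rho>"
  interpret A1: comm_group ?A1 by (rule L1.comm_group_Hom_G[OF gm])
  interpret A2: comm_group ?A2 by (rule L2.comm_group_Hom_G[OF gm])
  have bil: "bilinear_pairing M B" using rp by (simp add: regulator_pairing_def)
  obtain es where "basis_mod_torsion M es" using rp by (auto simp: regulator_pairing_def nondegenerate_mod_torsion_def)
  then obtain es' where de: "dual_basis M es es'" by (rule M.basis_mod_torsion_imp_dual_basis)
  have tM: "finite (torsion M)" by (rule finite_torsion[OF fg L1.fin_G de])
  \<comment> \<open>Bases are chosen as functions of the subgroup, so that one choice serves both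
    families \<open>H\<close> and \<open>H'\<close>.\<close>
  define b where "b K = (SOME cs. \<exists>ls. dual_basis (fixed_submodule M \<rho> K) cs ls)" for K
  define k where "k K = (SOME ls. dual_basis (fixed_submodule M \<rho> K) (b K) ls)" for K
  have dK: "dual_basis (fixed_submodule M \<rho> K) (b K) (k K)" if "subgroup K G" for K
  proof -
    have "\<exists>ls. dual_basis (fixed_submodule M \<rho> K) (b K) ls"
      unfolding b_def using exists_dual_basis_fixed[OF gm subgroup.subset[OF that] de] by (rule someI_ex)
    then show ?thesis unfolding k_def by (rule someI_ex)
  qed
  obtain ixs where ixs: "distinct ixs" "set ixs = I" using finite_distinct_list[OF L1.fin_I] by blast
  obtain jxs where jxs: "distinct jxs" "set jxs = J" using finite_distinct_list[OF L2.fin_I] by blast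
  have "\<exists>as ls. dual_basis ?A1 as ls"
    using L1.dual_basis_Hom_G[OF gm ixs, of "\<lambda>i. b (H i)" "\<lambda>i. k (H i)"] dK[OF L1.sub_H] by blast
  then obtain as ls where d1: "dual_basis ?A1 as ls" by blast
  have "\<exists>bs ks. dual_basis ?A2 bs ks"
    using L2.dual_basis_Hom_G[OF gm jxs, of "\<lambda>j. b (H' j)" "\<lambda>j. k (H' j)"] dK[OF L2.sub_H] by blast
  then obtain bs ks where d2: "dual_basis ?A2 bs ks" by blast
  let ?F1 = "L1.hom_pairing B" and ?F2 = "L2.hom_pairing B"
  note F1 = L1.bilinear_hom_pairing[OF gm bil] and F2 = L2.bilinear_hom_pairing[OF gm bil]
  define pd where "pd K = pairing_det (fixed_submodule M \<rho> K) (\<lambda>x y. 1 / of_nat (card K) * B x y)" for K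
  have pd: "pd K \<noteq> 0" if "subgroup K G" for K
    unfolding pd_def by (rule pairing_det_fixed_nonzero[OF gm rp that L1.fin_G])
  have pd1: "pairing_det ?A1 ?F1 = (\<Prod>i\<in>I. pd (H i))"
    unfolding pd_def using L1.pairing_det_Hom_G[OF gm bil, of "\<lambda>i. b (H i)" "\<lambda>i. k (H i)"] dK[OF L1.sub_H] by blast
  have pd2: "pairing_det ?A2 ?F2 = (\<Prod>j\<in>J. pd (H' j))"
    unfolding pd_def using L2.pairing_det_Hom_G[OF gm bil, of "\<lambda>j. b (H' j)" "\<lambda>j. k (H' j)"] dK[OF L2.sub_H] by blast
  have pd2_nz: "pairing_det ?A2 ?F2 \<noteq> 0" unfolding pd2 using pd L2.sub_H L2.fin_I by simp
  have rc: "regulator_constant G (subgroup_difference I H J H') M \<rho> B = pairing_det ?A1 ?F1 / pairing_det ?A2 ?F2"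
    unfolding pd1 pd2 pd_def
    by (rule regulator_constant_subgroup_difference[OF L1.fin_G L1.fin_I L2.fin_I L1.sub_H L2.sub_H pd[unfolded pd_def]])
  obtain f' n where iso: "isogeny ?A2 ?A1 phi_map f' n" by (rule phi_map_isogeny[OF gm])
  have t1: "finite (torsion ?A1)" and t2: "finite (torsion ?A2)"
    using L1.finite_torsion_Hom_G[OF gm tM] L2.finite_torsion_Hom_G[OF gm tM] by auto
  note cov = isogeny_pairing_det[OF iso d2 d1 t2 t1 F1]
  \<comment> \<open>An isogeny has torsion kernel. Finite torsion then makes the order of the kernel
    a nonzero number, which can be cancelled.\<close>
  have "kernel ?A2 ?A1 phi_map \<subseteq> torsion ?A2"
  proof
    fix f assume "f \<in> kernel ?A2 ?A1 phi_map"
    then have f: "f \<in> carrier ?A2" "phi_map f = \<one>\<^bsub>?A1\<^esub>" by (auto simp: kernel_def)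
    have "f' \<in> hom ?A1 ?A2" "f' (phi_map f) = f [^]\<^bsub>?A2\<^esub> n" "n > 0" using iso f(1) by (auto simp: isogeny_def)
    then have "f [^]\<^bsub>?A2\<^esub> n = \<one>\<^bsub>?A2\<^esub>" using f(2) hom_one[of f' ?A1 ?A2] A1.is_group A2.is_group by simp
    then show "f \<in> torsion ?A2" using f(1) \<open>n > 0\<close> by (auto simp: torsion_def)
  qed
  then have kf: "finite (kernel ?A2 ?A1 phi_map)" using t2 by (rule finite_subset)
  moreover have "\<one>\<^bsub>?A2\<^esub> \<in> kernel ?A2 ?A1 phi_map"
    using hom_one[OF phi_map_hom A2.is_group A1.is_group] by (simp add: kernel_def)
  ultimately have ker_nz: "card (kernel ?A2 ?A1 phi_map) \<noteq> 0" by (metis card_0_eq empty_iff)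
  have tors_nz: "card (torsion ?A1) \<noteq> 0" using A1.card_torsion_pos[OF t1] by simp
  let ?T = "\<lambda>f. transpose_map M (phi_map f)"
  have bsA: "set bs \<subseteq> carrier ?A2" using d2 by (simp add: dual_basis_def)
  have TA: "?T f \<in> carrier ?A2" if "f \<in> carrier ?A2" for f
    using hom_in_carrier[OF transpose_map_hom[OF gm] hom_in_carrier[OF phi_map_hom that]] .
  let ?F = "\<lambda>f f'. ?F1 (phi_map f) (phi_map f')"
  have "bilinear_pairing ?A2 ?F"
    by (rule bilinear_pairing_comp[OF phi_map_hom F1])
  then have "pairing_det ?A2 ?F = det (gram ?F bs bs)" by (rule A2.pairing_det_eq_det_gram[OF d2])
  \<comment> \<open>Adjointness moves \<open>phi_map\<close> from the first slot to the second,
    where it becomes the endomorphism \<open>?T\<close>.\<close>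
  also have "gram ?F bs bs = gram ?F2 bs (map ?T bs)"
  proof (rule eq_matI)
    fix i j assume "i < dim_row (gram ?F2 bs (map ?T bs))" "j < dim_col (gram ?F2 bs (map ?T bs))"
    then have ij: "i < length bs" "j < length bs" by (auto simp: gram_def)
    then have "bs ! i \<in> carrier ?A2" "bs ! j \<in> carrier ?A2" using bsA by auto
    then show "gram ?F bs bs $$ (i, j) = gram ?F2 bs (map ?T bs) $$ (i, j)"
      using ij hom_pairing_adjoint[OF gm rp _ hom_in_carrier[OF phi_map_hom]] by (simp add: gram_def)
  qed (auto simp: gram_def)
  also have "\<dots> = gram ?F2 bs bs * map_mat of_int (coord_mat ks (map ?T bs))"
    using bsA TA by (intro A2.gram_expand_right[OF d2 F2]) auto
  also have "det \<dots> = det (gram ?F2 bs bs) * det (map_mat of_int (coord_mat ks (map ?T bs)) :: complex mat)"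
    using dual_basisD(1)[OF d2] by (intro det_mult[of _ "length bs"]) (auto simp: coord_mat_def gram_def)
  also have "det (gram ?F2 bs bs) = pairing_det ?A2 ?F2" using A2.pairing_det_eq_det_gram[OF d2 F2] by simp
  also have "det (map_mat of_int (coord_mat ks (map ?T bs)) :: complex mat) = of_int (det (coord_mat ks (map ?T bs)))"
    by (rule of_int_hom.hom_det)
  finally have pdF: "pairing_det ?A2 ?F = pairing_det ?A2 ?F2 * of_int (det (coord_mat ks (map ?T bs)))" .
  \<comment> \<open>Collected over one denominator, the numerator is the right-hand side of the
    covolume identity \<open>cov\<close>, whose left-hand side contains the determinant just
    computed.\<close>
  have "regulator_quantity G I H J H' \<phi> M \<rho> B
     = pairing_det ?A1 ?F1 * (of_nat (Coset.order (?A1 Mod (phi_map ` carrier ?A2))))\<^sup>2 * (of_nat (card (torsion ?A2)))\<^sup>2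
       / (pairing_det ?A2 ?F2 * (of_nat (card (torsion ?A1)))\<^sup>2 * (of_nat (card (kernel ?A2 ?A1 phi_map)))\<^sup>2)"
    unfolding regulator_quantity_def Let_def rc by (simp add: mult_ac)
  also have "\<dots> = of_int (det (coord_mat ks (map ?T bs)))"
    unfolding cov[symmetric] pdF using pd2_nz tors_nz ker_nz by simp
  finally show ?thesis using that[OF d2] by simp
qed

text \<open>The endomorphism is built from the integer matrix of \<open>\<phi>\<close>, so
  postcomposition with the equivariant \<open>\<alpha>\<close> intertwines its versions for
  \<open>M\<close> and \<open>N\<close>. As \<open>L2.push \<alpha>\<close> is an isogeny, the two
  determinants agree.\<close>

lemma regulator_quantity_cong:
  assumes M: "finitely_generated_gmodule G M \<rho>" "regulator_pairing G M \<rho> B"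
    and N: "finitely_generated_gmodule G N \<sigma>" "regulator_pairing G N \<sigma> C"
    and ri: "rationally_isomorphic G M \<rho> N \<sigma>"
  shows "regulator_quantity G I H J H' \<phi> M \<rho> B = regulator_quantity G I H J H' \<phi> N \<sigma> C"
proof -
  have gM: "gmodule G M \<rho>" and gN: "gmodule G N \<sigma>" using M(1) N(1) by (auto simp: finitely_generated_gmodule_def)
  interpret M: comm_group M by (rule gmoduleD) fact
  interpret N: comm_group N by (rule gmoduleD) fact
  obtain es where "basis_mod_torsion M es" using M(2) by (auto simp: regulator_pairing_def nondegenerate_mod_torsion_def)
  then obtain es' where dM: "dual_basis M es es'" by (rule M.basis_mod_torsion_imp_dual_basis)
  obtain fs where "basis_mod_torsion N fs" using N(2) by (auto simp: regulator_pairing_def nondegenerate_mod_torsion_def)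
  then obtain fs' where dN: "dual_basis N fs fs'" by (rule N.basis_mod_torsion_imp_dual_basis)
  obtain \<alpha> \<beta> k where ab: "isogeny M N \<alpha> \<beta> k" "equivariant G M \<rho> \<sigma> \<alpha>" "equivariant G N \<sigma> \<rho> \<beta>"
    by (rule rationally_isomorphic_imp_isogeny[OF M(1) N(1) L1.fin_G dM dN ri])
  have a: "\<alpha> \<in> hom M N" using ab(1) by (simp add: isogeny_def)
  obtain bs ks where m: "dual_basis (L2.HomP M \<rho>) bs ks"
    "regulator_quantity G I H J H' \<phi> M \<rho> B = of_int (det (coord_mat ks (map (\<lambda>f. transpose_map M (phi_map f)) bs)))"
    by (rule regulator_quantity_eq_det[OF M])
  obtain cs ls where n: "dual_basis (L2.HomP N \<sigma>) cs ls"
    "regulator_quantity G I H J H' \<phi> N \<sigma> C = of_int (det (coord_mat ls (map (\<lambda>f. transpose_map N (phi_map f)) cs)))"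
    by (rule regulator_quantity_eq_det[OF N])
  have TM: "(\<lambda>f. transpose_map M (phi_map f)) \<in> hom (L2.HomP M \<rho>) (L2.HomP M \<rho>)"
    using hom_compose[OF phi_map_hom transpose_map_hom[OF gM]] by (simp add: comp_def)
  have TN: "(\<lambda>f. transpose_map N (phi_map f)) \<in> hom (L2.HomP N \<sigma>) (L2.HomP N \<sigma>)"
    using hom_compose[OF phi_map_hom transpose_map_hom[OF gN]] by (simp add: comp_def)
  note pa = L2.push_hom[OF a ab(2)]
  have comm: "L2.push \<alpha> (transpose_map M (phi_map f)) = transpose_map N (phi_map (L2.push \<alpha> f))"
    if f: "f \<in> carrier (L2.HomP M \<rho>)" for f
  proof (rule Hom2_eqI[OF gN])
    show "L2.push \<alpha> (transpose_map M (phi_map f)) \<in> carrier (L2.HomP N \<sigma>)"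
      by (rule hom_in_carrier[OF pa hom_in_carrier[OF TM f]])
    show "transpose_map N (phi_map (L2.push \<alpha> f)) \<in> carrier (L2.HomP N \<sigma>)"
      by (rule hom_in_carrier[OF TN hom_in_carrier[OF pa f]])
    fix d assume d: "d \<in> L2.X"
    have pf: "phi_map f \<in> carrier (L1.HomP M \<rho>)" by (rule hom_in_carrier[OF phi_map_hom f])
    have pfM: "phi_map f (L1.eps x) \<in> carrier M" if "x \<in> L1.X" for x
      by (rule L1.Hom_G_closed[OF pf L1.eps_P[OF that]])
    have eq: "phi_map (L2.push \<alpha> f) (L1.eps x) = \<alpha> (phi_map f (L1.eps x))" if "x \<in> L1.X" for x
      using L1.eps_P[OF that] hom_in_carrier[OF phi_hom L1.eps_P[OF that]] by (simp add: induced_map_def L2.push_def)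
    have "L2.push \<alpha> (transpose_map M (phi_map f)) (L2.eps d)
       = \<alpha> (finprod M (\<lambda>x. phi_map f (L1.eps x) [^]\<^bsub>M\<^esub> entry d x) L1.X)"
      using transpose_map(2)[OF gM pf d] L2.eps_P[OF d] by (simp add: L2.push_def)
    also have "\<dots> = finprod N (\<lambda>x. \<alpha> (phi_map f (L1.eps x) [^]\<^bsub>M\<^esub> entry d x)) L1.X"
      using pfM by (intro M.hom_finprod[OF N.comm_group_axioms a L1.fin_X]) auto
    also have "\<dots> = finprod N (\<lambda>x. phi_map (L2.push \<alpha> f) (L1.eps x) [^]\<^bsub>N\<^esub> entry d x) L1.X"
      using pfM eq hom_in_carrier[OF a] hom_int_pow[OF a _ M.is_group N.is_group] by (intro N.finprod_cong') auto
    also have "\<dots> = transpose_map N (phi_map (L2.push \<alpha> f)) (L2.eps d)"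
      using transpose_map(2)[OF gN hom_in_carrier[OF phi_map_hom hom_in_carrier[OF pa f]] d] by simp
    finally show "L2.push \<alpha> (transpose_map M (phi_map f)) (L2.eps d) = transpose_map N (phi_map (L2.push \<alpha> f)) (L2.eps d)" .
  qed
  have "det (coord_mat ks (map (\<lambda>f. transpose_map M (phi_map f)) bs)) = det (coord_mat ls (map (\<lambda>f. transpose_map N (phi_map f)) cs))"
    using comm by (intro det_coord_mat_conjugate[OF L2.push_isogeny[OF gM gN ab] m(1) n(1) TM TN])
  then show ?thesis using m(2) n(2) by simp
qed

end

theorem theoremR:
  fixes G :: "('g, 'a) monoid_scheme"
    and I :: "'i set" and H :: "'i \<Rightarrow> 'g set"
    and J :: "'j set" and H' :: "'j \<Rightarrow> 'g set"
    and \<phi> :: "('i \<Rightarrow> 'g set \<Rightarrow>\<^sub>0 int) \<Rightarrow> ('j \<Rightarrow> 'g set \<Rightarrow>\<^sub>0 int)"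
    and M :: "('m, 'b) monoid_scheme" and \<rho> :: "'g \<Rightarrow> 'm \<Rightarrow> 'm"
    and N :: "('n, 'c) monoid_scheme" and \<sigma> :: "'g \<Rightarrow> 'n \<Rightarrow> 'n"
    and B :: "'m \<Rightarrow> 'm \<Rightarrow> complex" and C :: "'n \<Rightarrow> 'n \<Rightarrow> complex"
  assumes "group G" and "finite (carrier G)"
    and "finite I" and "\<And>i. i \<in> I \<Longrightarrow> subgroup (H i) G"
    and "finite J" and "\<And>j. j \<in> J \<Longrightarrow> subgroup (H' j) G"
    and "\<phi> \<in> hom (perm_module G I H) (perm_module G J H')"
    and "equivariant G (perm_module G I H) (perm_action G I H) (perm_action G J H') \<phi>"
    and "inj_on \<phi> (carrier (perm_module G I H))"
    and "finite (carrier (perm_module G J H' Mod (\<phi> ` carrier (perm_module G I H))))"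
    and "finitely_generated_gmodule G M \<rho>" and "regulator_pairing G M \<rho> B"
    and "finitely_generated_gmodule G N \<sigma>" and "regulator_pairing G N \<sigma> C"
    and "rationally_isomorphic G M \<rho> N \<sigma>"
  shows "regulator_quantity G I H J H' \<phi> M \<rho> B = regulator_quantity G I H J H' \<phi> N \<sigma> C"
proof -
  have "perm_lattice G I H" "perm_lattice G J H'"
    using assms(1-6) by (auto simp: perm_lattice_def perm_lattice_axioms_def)
  then interpret perm_isogeny G I H J H' \<phi>
    using assms(7-10) by (auto simp: perm_isogeny_def perm_isogeny_axioms_def perm_lattice_map_def perm_lattice_map_axioms_def)
  show ?thesis by (rule regulator_quantity_cong[OF assms(11-15)])
qed

end
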